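(* Let $C:f=0$ be a reduced curve of degree $d$ in $\mathbb{P}^2$ over $\mathbb{C}$ with $mdr(f)\ge 1$. For any line $L$ in $\mathbb{P}^2$ we have $$\tau(C)\le (d-1)^2-d_1^Ld_2^L.$$ Moreover, equality holds for a line $L$ if and only if the curve $C$ is free, and then it holds for any line $L$.
   Context: Let $S=\mathbb{C}[x,y,z]$ with its standard grading, and let $f\in S$ be a reduced homogeneous polynomial of degree $d$ defining $C\subset\mathbb{P}^2$. - $AR(f)\subset S^{\oplus 3}$ is the graded $S$-module with $AR(f)_k=\{(a,b,c)\in S_k^{\oplus 3}: af_x+bf_y+cf_z=0\}$, and $mdr(f)=\min\{k: AR(f)_k\ne 0\}$. - $E_C=\widetilde{AR(f)}$ is the sheaf on $\mathbb{P}^2$ associated to $AR(f)$; it is a rank two vector bundle. - For a line $L\subset\mathbb{P}^2$, $d_1^L\le d_2^L$ are the integers with $E_C|_L\simeq\mathcal{O}_L(-d_1^L)\oplus\mathcal{O}_L(-d_2^L)$. - $\tau(C)=\sum_{p\in C}\tau(C,p)$ is the total Tjurina number, where $\tau(C,p)=\dim_{\mathbb{C}}\mathcal{O}_{\mathbb{P}^2,p}/(g,g_u,g_v)$ if $g(u,v)=0$ is a local equation of $C$ at $p$ in local coordinates $(u,v)$. - $C$ is free if $AR(f)$ is a free graded $S$-module. *)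

theory Defs
  imports
    "HOL-Analysis.Analysis"
    "HOL-Library.Poly_Mapping"
    "HOL-Computational_Algebra.Fraction_Field"
    "HOL-Computational_Algebra.Squarefree"
begin

unbundle no fps_syntax
unbundle vec_syntax

section \<open>Polynomials over the complex numbers\<close>

text \<open>A polynomial is a finitely supported map from exponent vectors to coefficients. The ring
  S is \<open>3 mpoly\<close>; the indices \<open>1\<close>, \<open>2\<close>, \<open>3\<close> of the numeral type \<open>3\<close> stand for x, y, z.\<close>

type_synonym 'n mpoly = "('n \<Rightarrow>\<^sub>0 nat) \<Rightarrow>\<^sub>0 complex"

definition const :: "complex \<Rightarrow> 'n mpoly" where
  "const c = Poly_Mapping.single 0 c"

definition var :: "'n \<Rightarrow> 'n mpoly" where
  "var i = Poly_Mapping.single (Poly_Mapping.single i 1) 1"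

definition pdiff :: "'n \<Rightarrow> 'n mpoly \<Rightarrow> 'n mpoly" where
  "pdiff i p = (\<Sum>m \<in> Poly_Mapping.keys p.
     Poly_Mapping.single (m - Poly_Mapping.single i 1)
       (of_nat (Poly_Mapping.lookup m i) * Poly_Mapping.lookup p m))"

text \<open>Substitution of the elements \<open>a i\<close> of a ring R for the variables, where \<open>h\<close> is the
  structure map from the complex numbers to R.\<close>

definition subst ::
    "(complex \<Rightarrow> 'r) \<Rightarrow> ('n \<Rightarrow> 'r) \<Rightarrow> ('n::finite) mpoly \<Rightarrow> 'r::comm_ring_1" where
  "subst h a p = (\<Sum>m \<in> Poly_Mapping.keys p.
     h (Poly_Mapping.lookup p m) * (\<Prod>i\<in>UNIV. a i ^ Poly_Mapping.lookup m i))"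

definition eval :: "('n::finite) mpoly \<Rightarrow> complex ^ 'n \<Rightarrow> complex" where
  "eval p v = subst (\<lambda>c. c) (\<lambda>i. v $ i) p"

text \<open>The homogeneous component of degree \<open>k\<close>; it is zero for negative \<open>k\<close>.\<close>

definition homog :: "int \<Rightarrow> ('n::finite) mpoly set" where
  "homog k = {p. \<forall>m \<in> Poly_Mapping.keys p. int (\<Sum>i\<in>UNIV. Poly_Mapping.lookup m i) = k}"


section \<open>Jacobian syzygies\<close>

definition syz :: "3 mpoly \<Rightarrow> (3 mpoly ^ 3) set" where
  "syz f = {r. (\<Sum>i\<in>UNIV. r $ i * pdiff i f) = 0}"

definition AR :: "3 mpoly \<Rightarrow> int \<Rightarrow> (3 mpoly ^ 3) set" where
  "AR f k = {r \<in> syz f. \<forall>i. r $ i \<in> homog k}"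

definition mdr :: "3 mpoly \<Rightarrow> nat" where
  "mdr f = (LEAST k. AR f (int k) \<noteq> {0})"

text \<open>C is free if AR(f) has an S-basis consisting of homogeneous elements.\<close>

definition free_curve :: "3 mpoly \<Rightarrow> bool" where
  "free_curve f \<longleftrightarrow> (\<exists>B. B \<subseteq> (\<Union>k. AR f k) \<and>
     \<not> module.dependent vector_scalar_mult B \<and> module.span vector_scalar_mult B = syz f)"


section \<open>The projective plane\<close>

text \<open>Points of the projective plane are the one-dimensional linear subspaces of \<open>complex ^ 3\<close>.
  The predicates \<open>vanishes\<close> and \<open>nonvanishing\<close> are used for homogeneous polynomials only, where
  they are complementary.\<close>

type_synonym point = "(complex ^ 3) set"

definition proj_plane :: "point set" where
  "proj_plane = {vec.span {v} | v. v \<noteq> 0}"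

definition vanishes :: "3 mpoly \<Rightarrow> point \<Rightarrow> bool" where
  "vanishes g P \<longleftrightarrow> (\<forall>v\<in>P. v \<noteq> 0 \<longrightarrow> eval g v = 0)"

definition nonvanishing :: "3 mpoly \<Rightarrow> point \<Rightarrow> bool" where
  "nonvanishing g P \<longleftrightarrow> (\<forall>v\<in>P. v \<noteq> 0 \<longrightarrow> eval g v \<noteq> 0)"

definition curve :: "3 mpoly \<Rightarrow> point set" where
  "curve f = {P \<in> proj_plane. vanishes f P}"

definition lines :: "point set set" where
  "lines = {curve l | l. l \<in> homog 1 \<and> l \<noteq> 0}"

definition zariski_open :: "point set \<Rightarrow> bool" where
  "zariski_open U \<longleftrightarrow>
     (\<exists>G \<subseteq> (\<Union>k. homog k). U = {P \<in> proj_plane. \<exists>g\<in>G. nonvanishing g P})"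

definition open_in :: "point set \<Rightarrow> point set \<Rightarrow> bool" where
  "open_in L V \<longleftrightarrow> (\<exists>U. zariski_open U \<and> V = U \<inter> L)"


section \<open>Sheaves associated to graded modules, and their restriction to a line\<close>

text \<open>A graded submodule M (with shifted grading allowed) of the free module \<open>(3 mpoly) ^ 'n\<close> is
  given by its homogeneous components \<open>M k\<close>. As M is torsion free, its localizations are
  realized inside the vector space of \<open>'n\<close>-tuples of elements of the fraction field of S.\<close>

type_synonym 'n gmod = "int \<Rightarrow> (3 mpoly ^ 'n) set"
type_synonym 'n ratvec = "(3 mpoly fract) ^ 'n"

text \<open>\<open>twist D\<close> is the direct sum of the S(-D i). In particular \<open>twist 0\<close> with index type \<open>1\<close> is S
  itself, with associated sheaf the structure sheaf of the plane.\<close>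

definition twist :: "int ^ ('n::finite) \<Rightarrow> 'n gmod" where
  "twist D k = {r. \<forall>i. r $ i \<in> homog (k - D $ i)}"

definition frac_vec :: "3 mpoly ^ ('n::finite) \<Rightarrow> 3 mpoly \<Rightarrow> 'n ratvec" where
  "frac_vec m g = (\<chi> i. Fract (m $ i) g)"

text \<open>The stalk at P of the sheaf associated to M: fractions of degree 0.\<close>

definition stalk :: "('n::finite) gmod \<Rightarrow> point \<Rightarrow> ('n ratvec) set" where
  "stalk M P = {frac_vec m g | m g k. m \<in> M k \<and> g \<in> homog k \<and> nonvanishing g P}"

text \<open>The stalk at P of the ideal sheaf of the closed subset L.\<close>

definition ideal_stalk :: "point set \<Rightarrow> point \<Rightarrow> (3 mpoly fract) set" where
  "ideal_stalk L P = {Fract a g | a g k. a \<in> homog k \<and> (\<forall>Q\<in>L. vanishes a Q) \<and>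
                        g \<in> homog k \<and> nonvanishing g P}"

definition ideal_mult :: "point set \<Rightarrow> ('n::finite) gmod \<Rightarrow> point \<Rightarrow> ('n ratvec) set" where
  "ideal_mult L M P = {(\<Sum>j<n. c j *s e j) | (n::nat) c e.
                         \<forall>j<n. c j \<in> ideal_stalk L P \<and> e j \<in> stalk M P}"

text \<open>Let F be the sheaf associated to M and I the ideal sheaf of L. The pullback of F to L has
  the stalks F_P / I_P F_P, and its sections over an open subset V of L are the families of
  elements of these stalks (here: cosets of I_P F_P) that locally come from sections m/g of F.
  Families are normalized to be \<open>undefined\<close> outside V.\<close>

type_synonym 'n family = "point \<Rightarrow> ('n ratvec) set"

definition res_sections :: "point set \<Rightarrow> ('n::finite) gmod \<Rightarrow> point set \<Rightarrow> ('n::finite) family set" where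
  "res_sections L M V = {s \<in> extensional V.
     \<forall>P\<in>V. \<exists>W m g k. open_in L W \<and> P \<in> W \<and> W \<subseteq> V \<and> m \<in> M k \<and> g \<in> homog k \<and>
       (\<forall>Q\<in>W. nonvanishing g Q \<and> s Q = {frac_vec m g + y | y. y \<in> ideal_mult L M Q})}"

definition sec_add :: "point set \<Rightarrow> ('n::finite) family \<Rightarrow> 'n family \<Rightarrow> 'n family" where
  "sec_add V s t = (\<lambda>P\<in>V. {a + b | a b. a \<in> s P \<and> b \<in> t P})"

text \<open>The product of the section \<open>c\<close> of the structure sheaf of L, represented over the index
  type \<open>1\<close>, with \<open>s\<close>. Products of representatives need not fill a whole coset, hence the
  summand \<open>y\<close>.\<close>

definition sec_scale ::
    "point set \<Rightarrow> ('n::finite) gmod \<Rightarrow> point set \<Rightarrow> 1 family \<Rightarrow> 'n family \<Rightarrow> 'n family" where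
  "sec_scale L M V c s =
     (\<lambda>P\<in>V. {(a $ 1) *s b + y | a b y. a \<in> c P \<and> b \<in> s P \<and> y \<in> ideal_mult L M P})"

text \<open>The restrictions to L of the sheaves associated to M and N are isomorphic as sheaves of
  modules over the structure sheaf of L.\<close>

definition res_isomorphic :: "point set \<Rightarrow> ('n::finite) gmod \<Rightarrow> ('m::finite) gmod \<Rightarrow> bool" where
  "res_isomorphic L M N \<longleftrightarrow>
     (\<exists>\<phi> :: point set \<Rightarrow> 'n family \<Rightarrow> 'm family. \<forall>V. open_in L V \<longrightarrow>
        bij_betw (\<phi> V) (res_sections L M V) (res_sections L N V) \<and>
        (\<forall>s \<in> res_sections L M V. \<forall>t \<in> res_sections L M V.
           \<phi> V (sec_add V s t) = sec_add V (\<phi> V s) (\<phi> V t)) \<and>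
        (\<forall>c \<in> res_sections L (twist 0) V. \<forall>s \<in> res_sections L M V.
           \<phi> V (sec_scale L M V c s) = sec_scale L N V c (\<phi> V s)) \<and>
        (\<forall>W. open_in L W \<and> W \<subseteq> V \<longrightarrow>
           (\<forall>s \<in> res_sections L M V. \<phi> W (restrict s W) = restrict (\<phi> V s) W)))"

text \<open>\<open>splits_on f L d1 d2\<close>: the restriction of E_C to L is isomorphic to the direct sum of
  O_L(-d1) and O_L(-d2), where d1 \<open>\<le>\<close> d2.\<close>

definition splits_on :: "3 mpoly \<Rightarrow> point set \<Rightarrow> int \<Rightarrow> int \<Rightarrow> bool" where
  "splits_on f L d1 d2 \<longleftrightarrow>
     d1 \<le> d2 \<and> res_isomorphic L (AR f) (twist (vector [d1, d2] :: int ^ 2))"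


section \<open>Tjurina numbers\<close>

text \<open>Dimension of V/W, for subspaces W \<open>\<subseteq>\<close> V: the number of elements of a subset of V inducing a
  basis of V/W.\<close>

definition quot_basis ::
    "(complex \<Rightarrow> 'v \<Rightarrow> 'v) \<Rightarrow> 'v set \<Rightarrow> 'v set \<Rightarrow> ('v::ab_group_add) set \<Rightarrow> bool" where
  "quot_basis smul V W B \<longleftrightarrow> finite B \<and> B \<subseteq> V \<and>
     (\<forall>c. (\<Sum>b\<in>B. smul (c b) b) \<in> W \<longrightarrow> (\<forall>b\<in>B. c b = 0)) \<and>
     (\<forall>v\<in>V. \<exists>c. v - (\<Sum>b\<in>B. smul (c b) b) \<in> W)"

definition quot_dim ::
    "(complex \<Rightarrow> 'v \<Rightarrow> 'v) \<Rightarrow> 'v set \<Rightarrow> ('v::ab_group_add) set \<Rightarrow> nat" where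
  "quot_dim smul V W = (THE n. \<exists>B. quot_basis smul V W B \<and> card B = n)"

text \<open>A basis (w1, w2, w3) of \<open>complex ^ 3\<close>, the rows of a matrix, with w1 on P gives the local
  coordinates (u, v) at P with inverse (u, v) \<open>\<mapsto>\<close> [w1 + u w2 + v w3], and the local equation
  g(u, v) = f(w1 + u w2 + v w3) of C. Here u = \<open>var 1\<close> and v = \<open>var 2\<close>.\<close>

definition frame_at :: "point \<Rightarrow> complex ^ 3 ^ 3 \<Rightarrow> bool" where
  "frame_at P w \<longleftrightarrow> w $ 1 \<in> P \<and> invertible w"

definition local_eq :: "3 mpoly \<Rightarrow> complex ^ 3 ^ 3 \<Rightarrow> 2 mpoly" where
  "local_eq f w =
     subst const (\<lambda>i. const (w $ 1 $ i) + const (w $ 2 $ i) * var 1 + const (w $ 3 $ i) * var 2) f"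

text \<open>In these coordinates the local ring at P is the localization of the polynomial ring in
  u, v at the origin.\<close>

definition local_ring :: "(2 mpoly fract) set" where
  "local_ring = {Fract a b | a b. eval b 0 \<noteq> 0}"

definition tjurina_ideal :: "2 mpoly \<Rightarrow> (2 mpoly fract) set" where
  "tjurina_ideal g = {a * Fract g 1 + b * Fract (pdiff 1 g) 1 + c * Fract (pdiff 2 g) 1 | a b c.
                        a \<in> local_ring \<and> b \<in> local_ring \<and> c \<in> local_ring}"

text \<open>The choice of coordinates is immaterial, as the dimension does not depend on it.\<close>

definition tjurina_at :: "3 mpoly \<Rightarrow> point \<Rightarrow> nat" where
  "tjurina_at f P = quot_dim (\<lambda>c x. Fract (const c) 1 * x) local_ring
                      (tjurina_ideal (local_eq f (SOME w. frame_at P w)))"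

text \<open>The sum runs over the points with nonzero contribution, since \<open>sum\<close> over the infinite set
  \<open>curve f\<close> would be 0. For reduced C these points are the finitely many singular points of C.\<close>

definition tjurina :: "3 mpoly \<Rightarrow> nat" where
  "tjurina f = (\<Sum>P \<in> {P \<in> curve f. tjurina_at f P \<noteq> 0}. tjurina_at f P)"

end

theory Submission
  imports Defs
    "HOL-Computational_Algebra.Fundamental_Theorem_Algebra"
    "HOL-Computational_Algebra.Field_as_Ring"
    "HOL-Computational_Algebra.Polynomial_Factorial"
begin

text \<open>Let \<open>L\<close> be a line with equation \<open>l\<close>, let \<open>N\<close> be the image of \<open>AR(f)\<close> in the free module of rank
  three over the coordinate ring \<open>R = \<complex>[s, t]\<close> of \<open>L\<close>, and let \<open>G\<close> be the graded \<open>R\<close>-module of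
  global sections of the twists of the restriction of \<open>E\<^sub>C\<close> to \<open>L\<close>. The splitting type says that
  \<open>G\<close> is free with generators in degrees \<open>d\<^sub>1\<close> and \<open>d\<^sub>2\<close>. As \<open>l\<close> is a nonzerodivisor on
  \<open>S\<^sup>3 / AR(f)\<close>, the module \<open>N\<close> is \<open>AR(f) / l AR(f)\<close>; it is contained in \<open>G\<close> and agrees with it in
  large degrees. So everything is determined by the Hilbert functions: the dimension of
  \<open>AR(f)\<^sub>k\<close> is \<open>dim S\<^bsub>k - d\<^sub>1\<^esub> + dim S\<^bsub>k - d\<^sub>2\<^esub> - \<Sum>\<^bsub>j \<le> k\<^esub> dim (G / N)\<^sub>j\<close>.

  On the other hand the partial derivatives give an exact sequence of \<open>AR(f)\<^sub>k\<close>, \<open>S\<^sub>k\<^sup>3\<close> and the part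
  of degree \<open>k + d - 1\<close> of the Jacobian ideal, and the codimension of the Jacobian ideal in a large
  degree is \<open>\<tau>(C)\<close>. Comparing the two for all large \<open>k\<close> yields \<open>d\<^sub>1 + d\<^sub>2 = d - 1\<close> and
  \<open>\<tau>(C) = (d - 1)\<^sup>2 - d\<^sub>1 d\<^sub>2 - dim (G / N)\<close>, which is the inequality
  (\<open>tjurina_splitting_formula\<close>). Equality means \<open>N = G\<close>. In that case the two generators of \<open>G\<close>
  lift to \<open>AR(f)\<close> and form a basis by the graded Nakayama lemma (\<open>lifting_imp_free\<close>). Conversely, if
  \<open>AR(f)\<close> is free, then so is \<open>N\<close>, and an element of \<open>G\<close> whose products with powers of \<open>s\<close> and \<open>t\<close>
  lie in \<open>N\<close> lies in \<open>N\<close> itself (\<open>free_imp_lifting\<close>).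

  Two facts remain. The first is that the Hilbert function of the Jacobian algebra is eventually
  \<open>\<tau>(C)\<close> (\<open>hilbert_function_jacobian\<close>). As \<open>f\<close> is squarefree, some line misses the singular points.
  Multiplication by its equation is eventually bijective on the Jacobian algebra, so its graded
  pieces become the algebra of the affine chart complementary to the line. That algebra has finite
  dimension, and by the weak Nullstellensatz and the Chinese remainder theorem it is the product
  of its localizations at the singular points, whose dimensions are the local Tjurina numbers.

  The second is the description of \<open>G\<close> (\<open>splitting_basis\<close>). As a line is irreducible, a section of
  the restriction of a sheaf associated to a submodule of a free module is a vector of rational
  functions in one variable. An isomorphism of restricted sheaves thus becomes a relation between
  such vectors that is linear over the regular functions, and it is evaluated on the two standard
  charts of the line.\<close>

section \<open>Polynomial rings, substitution and homogeneous components\<close>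

locale ring_map =
  fixes h :: "'a::comm_ring_1 \<Rightarrow> 'b::comm_ring_1"
  assumes map_one [simp]: "h 1 = 1"
    and map_add: "h (a + b) = h a + h b"
    and map_mult: "h (a * b) = h a * h b"
begin

lemma map_zero [simp]: "h 0 = 0"
  using map_add[of 0 0] by simp

lemma map_uminus: "h (- a) = - h a"
  using map_add[of a "- a"] by (simp add: add_eq_0_iff)

lemma map_diff: "h (a - b) = h a - h b"
  using map_add[of a "- b"] by (simp add: map_uminus)

lemma map_sum: "h (sum g A) = (\<Sum>x\<in>A. h (g x))"
  by (induction A rule: infinite_finite_induct) (auto simp: map_add)

lemma map_prod: "h (prod g A) = (\<Prod>x\<in>A. h (g x))"
  by (induction A rule: infinite_finite_induct) (auto simp: map_mult)

lemma map_power: "h (a ^ n) = h a ^ n"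
  by (induction n) (auto simp: map_mult)

lemmas hom_simps = map_add map_mult map_uminus map_diff map_sum map_prod map_power

end

lemma ring_map_comp: "ring_map g \<Longrightarrow> ring_map h \<Longrightarrow> ring_map (\<lambda>x. g (h x))"
  by (auto simp: ring_map_def)

lemma mpoly_sum_single:
  "p = (\<Sum>m\<in>Poly_Mapping.keys p. Poly_Mapping.single m (Poly_Mapping.lookup p m))"
proof (rule poly_mapping_eqI)
  fix k
  show "Poly_Mapping.lookup p k = Poly_Mapping.lookup
     (\<Sum>m\<in>Poly_Mapping.keys p. Poly_Mapping.single m (Poly_Mapping.lookup p m)) k"
    by (auto simp: lookup_sum lookup_single when_def in_keys_iff)
qed

lemma single_add_induct [case_names single add]:
  assumes "\<And>m c. P (Poly_Mapping.single m c)"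
    and "\<And>p q. P p \<Longrightarrow> P q \<Longrightarrow> P (p + q)"
  shows "P (p :: 'a \<Rightarrow>\<^sub>0 'b::comm_monoid_add)"
proof -
  have "P (\<Sum>m\<in>A. Poly_Mapping.single m (g m))" if "finite A" for A and g :: "'a \<Rightarrow> 'b"
    using that
  proof (induction A rule: finite_induct)
    case empty
    show ?case using assms(1)[of undefined 0] by simp
  next
    case (insert x F)
    then show ?case using assms by simp
  qed
  from this[of "Poly_Mapping.keys p" "Poly_Mapping.lookup p", OF finite_keys]
  show ?thesis by (simp flip: mpoly_sum_single)
qed

lemma ring_map_const: "ring_map (const :: complex \<Rightarrow> 'n mpoly)"
  by unfold_locales (auto simp: const_def single_add mult_single)

interpretation const: ring_map "const :: complex \<Rightarrow> 'n mpoly"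
  by (rule ring_map_const)

lemma const_eq_iff [simp]: "const a = (const b :: 'n mpoly) \<longleftrightarrow> a = b"
  by (auto simp: const_def inj_single dest: injD[OF inj_single])

lemma const_eq_0_iff [simp]: "const a = (0 :: 'n mpoly) \<longleftrightarrow> a = 0"
  using const_eq_iff[of a 0] by (simp del: const_eq_iff)

lemma single_as_monomial:
  "Poly_Mapping.single m c = const c * (\<Prod>i\<in>UNIV. var i ^ Poly_Mapping.lookup m (i::'n::finite))"
proof -
  have pow: "var i ^ n = Poly_Mapping.single (Poly_Mapping.single i n) 1" for i :: 'n and n
    by (induction n) (auto simp: var_def mult_single simp flip: single_add single_one)
  have prd: "(\<Prod>i\<in>A. Poly_Mapping.single (g i) 1) = (Poly_Mapping.single (\<Sum>i\<in>A. g i) 1 :: 'n mpoly)"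
    if "finite A" for A :: "'n set" and g
    using that by (induction A rule: finite_induct) (auto simp: mult_single)
  have sm: "(\<Sum>i\<in>UNIV. Poly_Mapping.single i (Poly_Mapping.lookup m i)) = m"
    by (rule poly_mapping_eqI) (auto simp: lookup_sum lookup_single when_def)
  show ?thesis
    by (simp add: pow prd sm const_def mult_single)
qed

lemma mpoly_induct [case_names const var add mult]:
  fixes p :: "'n::finite mpoly"
  assumes c: "\<And>c. P (const c)" and v: "\<And>i. P (var i)"
    and a: "\<And>p q. P p \<Longrightarrow> P q \<Longrightarrow> P (p + q)"
    and m: "\<And>p q. P p \<Longrightarrow> P q \<Longrightarrow> P (p * q)"
  shows "P p"
proof (induction p rule: single_add_induct)
  case (single m c)
  have pw: "P (var i ^ n)" for i n
    using c[of 1] by (induction n) (auto intro: m v)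
  have "P (\<Prod>i\<in>A. var i ^ Poly_Mapping.lookup m i)" if "finite A" for A
    using that c[of 1] by (induction A rule: finite_induct) (auto intro!: assms pw)
  then show ?case
    unfolding single_as_monomial by (intro assms) auto
qed (rule a)

lemma subst_superset:
  assumes "ring_map h" "finite A" "Poly_Mapping.keys p \<subseteq> A"
  shows "subst h a p = (\<Sum>m\<in>A. h (Poly_Mapping.lookup p m) * (\<Prod>i\<in>UNIV. a i ^ Poly_Mapping.lookup m i))"
proof -
  interpret ring_map h by fact
  show ?thesis
    unfolding subst_def using assms
    by (intro sum.mono_neutral_left) (auto simp: in_keys_iff)
qed

lemma ring_map_subst:
  fixes h :: "complex \<Rightarrow> 'r::comm_ring_1" and a :: "'n::finite \<Rightarrow> 'r"
  assumes "ring_map h"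
  shows "ring_map (subst h a)" "subst h a (const c) = h c" "subst h a (var i) = a i"
proof -
  interpret ring_map h by fact
  define M where "M m = (\<Prod>i\<in>UNIV. a i ^ Poly_Mapping.lookup m i)" for m
  have sing: "subst h a (Poly_Mapping.single m c) = h c * M m" for m c
    by (cases "c = 0") (auto simp: subst_def M_def)
  have add: "subst h a (p + q) = subst h a p + subst h a q" for p q
  proof -
    let ?A = "Poly_Mapping.keys p \<union> Poly_Mapping.keys q"
    have "Poly_Mapping.keys (p + q) \<subseteq> ?A" by (rule keys_add)
    then show ?thesis
      by (simp add: subst_superset[of h ?A, OF assms] lookup_add map_add algebra_simps sum.distrib)
  qed
  have Madd: "M (m + m') = M m * M m'" for m m'
    by (simp add: M_def lookup_add power_add prod.distrib)
  have M0: "M 0 = 1" by (simp add: M_def)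
  have mult: "subst h a (p * q) = subst h a p * subst h a q" for p q
  proof (induction p rule: single_add_induct)
    case (single m c)
    show ?case
    proof (induction q rule: single_add_induct)
      case (single m' c')
      show ?case by (simp add: mult_single sing Madd map_mult algebra_simps)
    qed (simp add: add algebra_simps)
  qed (simp add: add algebra_simps)
  show cc: "subst h a (const c) = h c" for c
    by (simp add: const_def sing M0)
  have "subst h a 1 = 1" using cc[of 1] by simp
  then show "ring_map (subst h a)" by unfold_locales (auto simp: add mult)
  have "M (Poly_Mapping.single i 1) = (\<Prod>j\<in>UNIV. if j = i then a i else 1)"
    unfolding M_def by (intro prod.cong) (auto simp: lookup_single when_def)
  then show "subst h a (var i) = a i"
    by (simp add: var_def sing)
qed

lemma ring_map_eqI:
  fixes g g' :: "'n::finite mpoly \<Rightarrow> 'r::comm_ring_1"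
  assumes "ring_map g" "ring_map g'" "\<And>c. g (const c) = g' (const c)" "\<And>i. g (var i) = g' (var i)"
  shows "g p = g' p"
  by (induction p rule: mpoly_induct) (auto simp: assms ring_map.map_add ring_map.map_mult)

lemma ring_map_ident: "ring_map (\<lambda>c. c)"
  by unfold_locales auto

lemma ring_map_pconst: "ring_map (\<lambda>c. [:c:])"
  by unfold_locales (auto simp: algebra_simps)

interpretation eval: ring_map "\<lambda>p. eval p v" for v :: "complex ^ 'n::finite"
  unfolding eval_def by (rule ring_map_subst(1)[OF ring_map_ident])

lemma eval_const [simp]: "eval (const c) v = c"
  unfolding eval_def by (rule ring_map_subst(2)[OF ring_map_ident])

lemma eval_var [simp]: "eval (var i) v = v $ i"
  unfolding eval_def by (rule ring_map_subst(3)[OF ring_map_ident])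

subsection \<open>Homogeneous polynomials\<close>

definition mdeg :: "('n::finite \<Rightarrow>\<^sub>0 nat) \<Rightarrow> nat" where
  "mdeg m = (\<Sum>i\<in>UNIV. Poly_Mapping.lookup m i)"

lemma homog_iff: "p \<in> homog k \<longleftrightarrow> (\<forall>m. Poly_Mapping.lookup p m \<noteq> 0 \<longrightarrow> int (mdeg m) = k)"
  by (auto simp: homog_def mdeg_def in_keys_iff)

lemma mdeg_add: "mdeg (m + m') = mdeg m + mdeg m'"
  by (simp add: mdeg_def lookup_add sum.distrib)

lemma mdeg_single: "mdeg (Poly_Mapping.single i n) = n"
  by (simp add: mdeg_def lookup_single when_def)

lemma mdeg_0 [simp]: "mdeg 0 = 0" by (simp add: mdeg_def)

lemma mdeg_eq_0_iff: "mdeg m = 0 \<longleftrightarrow> m = 0"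
  by (auto simp: mdeg_def intro: poly_mapping_eqI)

lemma homog_0 [simp]: "0 \<in> homog k" by (simp add: homog_iff)

lemma homog_add: "p \<in> homog k \<Longrightarrow> q \<in> homog k \<Longrightarrow> p + q \<in> homog k"
  by (auto simp: homog_iff lookup_add) (metis add.right_neutral add_0)

lemma homog_sum: "(\<And>x. x \<in> A \<Longrightarrow> g x \<in> homog k) \<Longrightarrow> sum g A \<in> homog k"
  by (induction A rule: infinite_finite_induct) (auto intro: homog_add)

lemma homog_single: "c = 0 \<or> k = int (mdeg m) \<Longrightarrow> Poly_Mapping.single m c \<in> homog k"
  by (auto simp: homog_iff lookup_single when_def split: if_splits)

lemma homog_const: "const c \<in> homog 0"
  unfolding const_def by (rule homog_single) simp

lemma homog_1: "1 \<in> homog 0"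
  using homog_const[of 1] by simp

lemma homog_var: "var i \<in> homog 1"
  unfolding var_def by (rule homog_single) (simp add: mdeg_single)

lemma homog_mult:
  assumes "p \<in> homog j" "q \<in> homog k"
  shows "p * q \<in> homog (j + k)"
  unfolding homog_def mdeg_def[symmetric]
proof safe
  fix m assume "m \<in> Poly_Mapping.keys (p * q)"
  then obtain a b where "m = a + b" "a \<in> Poly_Mapping.keys p" "b \<in> Poly_Mapping.keys q"
    using keys_mult[of p q] by auto
  then show "int (mdeg m) = j + k" using assms by (auto simp: homog_iff in_keys_iff mdeg_add)
qed

lemma homog_cmult: "p \<in> homog k \<Longrightarrow> const c * p \<in> homog k"
  using homog_mult[OF homog_const, of p k c] by simp

lemma homog_uminus: "p \<in> homog k \<Longrightarrow> - p \<in> homog k"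
  by (auto simp: homog_iff)

lemma homog_diff: "p \<in> homog k \<Longrightarrow> q \<in> homog k \<Longrightarrow> p - q \<in> homog k"
  using homog_add[OF _ homog_uminus, of p k q] by simp

lemma homog_power: "p \<in> homog k \<Longrightarrow> p ^ n \<in> homog (int n * k)"
  by (induction n) (auto simp: homog_1 algebra_simps intro: homog_mult)

lemma homog_power1: "p \<in> homog 1 \<Longrightarrow> p ^ n \<in> homog (int n)"
  using homog_power[of p 1 n] by simp

lemma homog_neg: "p \<in> homog k \<Longrightarrow> k < 0 \<Longrightarrow> p = 0"
  by (intro poly_mapping_eqI) (auto simp: homog_iff)

lemma homog_deg0: "p \<in> homog 0 \<Longrightarrow> p = const (Poly_Mapping.lookup p 0)"
  by (intro poly_mapping_eqI)
     (auto simp: homog_iff const_def lookup_single when_def mdeg_eq_0_iff)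

definition hcomp :: "int \<Rightarrow> 'n::finite mpoly \<Rightarrow> 'n mpoly" where
  "hcomp k p = (\<Sum>m\<in>{m \<in> Poly_Mapping.keys p. int (mdeg m) = k}.
     Poly_Mapping.single m (Poly_Mapping.lookup p m))"

lemma lookup_hcomp:
  "Poly_Mapping.lookup (hcomp k p) m = (if int (mdeg m) = k then Poly_Mapping.lookup p m else 0)"
  by (auto simp: hcomp_def lookup_sum lookup_single when_def in_keys_iff)

lemma hcomp_homog: "hcomp k p \<in> homog k"
  by (auto simp: homog_iff lookup_hcomp split: if_splits)

lemma hcomp_add: "hcomp k (p + q) = hcomp k p + hcomp k q"
  by (intro poly_mapping_eqI) (auto simp: lookup_hcomp lookup_add)

lemma hcomp_0 [simp]: "hcomp k 0 = 0"
  by (intro poly_mapping_eqI) (auto simp: lookup_hcomp)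

lemma hcomp_sum: "hcomp k (sum g A) = (\<Sum>x\<in>A. hcomp k (g x))"
  by (induction A rule: infinite_finite_induct) (auto simp: hcomp_add)

lemma hcomp_of_homog: "p \<in> homog j \<Longrightarrow> hcomp k p = (if j = k then p else 0)"
  by (intro poly_mapping_eqI) (auto simp: lookup_hcomp homog_iff)

lemma hcomp_mult:
  assumes "a \<in> homog j"
  shows "hcomp (j + k) (a * p) = a * hcomp k p"
proof (induction p rule: single_add_induct)
  case (single m c)
  have s: "Poly_Mapping.single m c \<in> homog (int (mdeg m))" by (rule homog_single) simp
  show ?case
    using hcomp_of_homog[OF homog_mult[OF assms s], of "j + k"] hcomp_of_homog[OF s, of k] by simp
qed (simp add: hcomp_add algebra_simps)

lemma hcomp_sum_eq:
  "\<exists>n. \<forall>N\<ge>n. p = (\<Sum>k<N. hcomp (int k) p)"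
proof -
  define n where "n = Suc (Max (insert 0 (mdeg ` Poly_Mapping.keys p)))"
  have le: "mdeg m < n" if "Poly_Mapping.lookup p m \<noteq> 0" for m
    using that unfolding n_def by (auto simp: in_keys_iff less_Suc_eq_le intro!: Max_ge)
  have "p = (\<Sum>k<N. hcomp (int k) p)" if "n \<le> N" for N
  proof (rule poly_mapping_eqI)
    fix m
    show "Poly_Mapping.lookup p m = Poly_Mapping.lookup (\<Sum>k<N. hcomp (int k) p) m"
      using le[of m] that by (cases "Poly_Mapping.lookup p m = 0") (auto simp: lookup_sum lookup_hcomp)
  qed
  then show ?thesis by blast
qed

text \<open>Positive-degree forms lie in the ideal of the variables, degree by degree. Iterating this
  replaces all arguments with monomial bases by an induction on the degree.\<close>

lemma homog_step:
  fixes p :: "'n::finite mpoly"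
  assumes "p \<in> homog (k + 1)" "k \<ge> 0"
  shows "\<exists>q. (\<forall>i. q i \<in> homog k) \<and> p = (\<Sum>i\<in>UNIV. var i * q i)"
proof -
  have "\<exists>q. (\<forall>i. q i \<in> homog k) \<and> Poly_Mapping.single m (Poly_Mapping.lookup p m) = (\<Sum>i\<in>UNIV. var i * q i)"
    if m: "m \<in> Poly_Mapping.keys p" for m
  proof -
    have d: "int (mdeg m) = k + 1" using assms m by (auto simp: homog_iff in_keys_iff)
    then obtain i where i: "Poly_Mapping.lookup m i > 0"
      using assms(2) by (auto simp: mdeg_def) (metis (mono_tags, lifting) add_nonneg_pos
        int_ops(1) neq0_conv of_nat_0 order_less_irrefl sum.neutral zero_less_one)
    define m' where "m' = m - Poly_Mapping.single i 1"
    have mm: "m = Poly_Mapping.single i 1 + m'"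
      using i by (intro poly_mapping_eqI) (auto simp: m'_def lookup_add lookup_minus lookup_single when_def)
    let ?c = "Poly_Mapping.lookup p m"
    have "int (mdeg m') = k" using d mm by (simp add: mdeg_add mdeg_single)
    then have "Poly_Mapping.single m' ?c \<in> homog k" by (intro homog_single) simp
    moreover have "Poly_Mapping.single m ?c = var i * Poly_Mapping.single m' ?c"
      by (subst (1) mm) (simp add: var_def mult_single)
    moreover have "(\<Sum>j\<in>UNIV. var j * (if j = i then Poly_Mapping.single m' ?c else 0))
        = var i * Poly_Mapping.single m' ?c"
      by (subst sum.remove[of _ i]) auto
    ultimately show ?thesis
      by (intro exI[of _ "\<lambda>j. if j = i then Poly_Mapping.single m' ?c else 0"]) auto
  qed
  then obtain Q where Q: "\<And>m i. m \<in> Poly_Mapping.keys p \<Longrightarrow> Q m i \<in> homog k"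
    "\<And>m. m \<in> Poly_Mapping.keys p \<Longrightarrow>
       Poly_Mapping.single m (Poly_Mapping.lookup p m) = (\<Sum>i\<in>UNIV. var i * Q m i)"
    by metis
  have "p = (\<Sum>m\<in>Poly_Mapping.keys p. \<Sum>i\<in>UNIV. var i * Q m i)"
    by (subst mpoly_sum_single[of p]) (auto intro!: sum.cong Q(2))
  also have "\<dots> = (\<Sum>i\<in>UNIV. var i * (\<Sum>m\<in>Poly_Mapping.keys p. Q m i))"
    by (subst sum.swap) (simp add: sum_distrib_left)
  finally show ?thesis
    by (intro exI[of _ "\<lambda>i. \<Sum>m\<in>Poly_Mapping.keys p. Q m i"]) (auto intro: homog_sum Q)
qed

subsection \<open>Partial derivatives\<close>

lemma pdiff_superset:
  assumes "finite A" "Poly_Mapping.keys p \<subseteq> A"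
  shows "pdiff i p = (\<Sum>m\<in>A. Poly_Mapping.single (m - Poly_Mapping.single i 1)
           (of_nat (Poly_Mapping.lookup m i) * Poly_Mapping.lookup p m))"
  unfolding pdiff_def using assms
  by (intro sum.mono_neutral_left) (auto simp: in_keys_iff)

lemma pdiff_single: "pdiff i (Poly_Mapping.single m c) =
    Poly_Mapping.single (m - Poly_Mapping.single i 1) (of_nat (Poly_Mapping.lookup m i) * c)"
  by (cases "c = 0") (auto simp: pdiff_def)

lemma pdiff_add: "pdiff i (p + q) = pdiff i p + pdiff i q"
proof -
  let ?A = "Poly_Mapping.keys p \<union> Poly_Mapping.keys q"
  have "Poly_Mapping.keys (p + q) \<subseteq> ?A" by (rule keys_add)
  then show ?thesis
    by (simp add: pdiff_superset[of ?A] lookup_add algebra_simps sum.distrib single_add)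
qed

lemma pdiff_0 [simp]: "pdiff i 0 = 0" by (simp add: pdiff_def)

lemma pdiff_sum: "pdiff i (sum g A) = (\<Sum>x\<in>A. pdiff i (g x))"
  by (induction A rule: infinite_finite_induct) (auto simp: pdiff_add)

lemma pdiff_const [simp]: "pdiff i (const c) = 0"
  by (simp add: const_def pdiff_single)

lemma pdiff_var: "pdiff i (var j) = (if i = j then 1 else 0)"
  by (auto simp: var_def pdiff_single lookup_single when_def)

lemma pdiff_mult: "pdiff i (p * q) = pdiff i p * q + p * pdiff i (q :: 'n::finite mpoly)"
proof (induction p rule: single_add_induct)
  case (single m c)
  let ?e = "Poly_Mapping.single i (1::nat)"
  show ?case
  proof (induction q rule: single_add_induct)
    case (single m' c')
    have 1: "Poly_Mapping.single (m + m' - ?e) (of_nat (Poly_Mapping.lookup m i) * c * c') =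
        Poly_Mapping.single (m - ?e + m') (of_nat (Poly_Mapping.lookup m i) * c * c')"
    proof (cases "Poly_Mapping.lookup m i = 0")
      case False
      then have "m + m' - ?e = m - ?e + m'"
        by (intro poly_mapping_eqI) (auto simp: lookup_add lookup_minus lookup_single when_def)
      then show ?thesis by simp
    qed simp
    have 2: "Poly_Mapping.single (m + m' - ?e) (of_nat (Poly_Mapping.lookup m' i) * c * c') =
        Poly_Mapping.single (m + (m' - ?e)) (of_nat (Poly_Mapping.lookup m' i) * c * c')"
    proof (cases "Poly_Mapping.lookup m' i = 0")
      case False
      then have "m + m' - ?e = m + (m' - ?e)"
        by (intro poly_mapping_eqI) (auto simp: lookup_add lookup_minus lookup_single when_def)
      then show ?thesis by simp
    qed simp
    show ?case using 1 2
      by (simp add: mult_single pdiff_single lookup_add algebra_simps single_add)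
  qed (simp add: pdiff_add algebra_simps)
qed (simp add: pdiff_add algebra_simps)

lemma pdiff_homog: "p \<in> homog k \<Longrightarrow> pdiff i p \<in> homog (k - 1)"
  unfolding pdiff_def
proof (intro homog_sum homog_single)
  fix m assume p: "p \<in> homog k" and m: "m \<in> Poly_Mapping.keys p"
  show "of_nat (Poly_Mapping.lookup m i) * Poly_Mapping.lookup p m = 0 \<or>
        k - 1 = int (mdeg (m - Poly_Mapping.single i 1))"
  proof (cases "Poly_Mapping.lookup m i = 0")
    case False
    have "m = Poly_Mapping.single i 1 + (m - Poly_Mapping.single i 1)"
      using False by (intro poly_mapping_eqI) (auto simp: lookup_add lookup_minus lookup_single when_def)
    then have "mdeg m = 1 + mdeg (m - Poly_Mapping.single i 1)"
      by (metis mdeg_add mdeg_single)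
    moreover have "int (mdeg m) = k" using p m by (auto simp: homog_iff in_keys_iff)
    ultimately show ?thesis by simp
  qed simp
qed

lemma chain_rule:
  fixes a :: "'n::finite \<Rightarrow> 'm::finite mpoly"
  shows "pdiff j (subst const a p) = (\<Sum>i\<in>UNIV. subst const a (pdiff i p) * pdiff j (a i))"
proof (induction p rule: mpoly_induct)
  interpret ring_map "subst const a" by (rule ring_map_subst[OF ring_map_const])
  note sc = ring_map_subst(2)[OF ring_map_const, of a]
  note sv = ring_map_subst(3)[OF ring_map_const, of a]
  {
    case (const c)
    show ?case by (simp add: sc)
  next
    case (var i)
    have "(\<Sum>k\<in>UNIV. subst const a (pdiff k (var i)) * pdiff j (a k)) =
          (\<Sum>k\<in>UNIV. if k = i then pdiff j (a k) else 0)"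
      by (intro sum.cong) (auto simp: pdiff_var)
    then show ?case by (simp add: sv)
  next
    case (add p q)
    then show ?case by (simp add: map_add pdiff_add algebra_simps sum.distrib)
  next
    case (mult p q)
    then show ?case
      by (simp add: map_mult map_add pdiff_mult algebra_simps sum.distrib sum_distrib_left)
  }
qed

lemma euler_identity:
  fixes p :: "'n::finite mpoly"
  assumes "p \<in> homog (int k)"
  shows "(\<Sum>i\<in>UNIV. var i * pdiff i p) = const (of_nat k) * p"
  using assms
proof (induction k arbitrary: p)
  case 0
  then obtain c where "p = const c" using homog_deg0[of p] by auto
  then show ?case by simp
next
  case (Suc k)
  then obtain q where q: "\<And>i. q i \<in> homog (int k)" "p = (\<Sum>i\<in>UNIV. var i * q i)"
    using homog_step[of p "int k"] by (auto simp: add.commute)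
  have "(\<Sum>i\<in>UNIV. var i * pdiff i (var j * q j)) = const (of_nat (Suc k)) * (var j * q j)" for j
  proof -
    have "(\<Sum>i\<in>UNIV. var i * pdiff i (var j * q j)) =
      (\<Sum>i\<in>UNIV. (if i = j then var j * q j else 0)) + var j * (\<Sum>i\<in>UNIV. var i * pdiff i (q j))"
      unfolding sum_distrib_left sum.distrib[symmetric]
      by (intro sum.cong) (auto simp: pdiff_mult pdiff_var algebra_simps)
    then show ?thesis using Suc.IH[OF q(1)[of j]]
      by (simp add: const.map_add algebra_simps)
  qed
  note * = this
  have "(\<Sum>i\<in>UNIV. var i * pdiff i p) = (\<Sum>j\<in>UNIV. \<Sum>i\<in>UNIV. var i * pdiff i (var j * q j))"
    unfolding q(2) pdiff_sum sum_distrib_left by (rule sum.swap)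
  then show ?case by (simp only: * q(2) sum_distrib_left)
qed

section \<open>Frames: restriction to a line and dehomogenization\<close>

text \<open>The rows of \<open>w\<close> form a basis of \<open>\<complex>\<^sup>3\<close>; \<open>coord w j\<close> is the \<open>j\<close>-th coordinate in this basis. All
  lines, charts and points are treated as coordinate lines, charts and points of such a frame.\<close>

definition coord :: "complex ^ 3 ^ 3 \<Rightarrow> 3 \<Rightarrow> 3 mpoly" where
  "coord w j = (\<Sum>i\<in>UNIV. const (matrix_inv w $ i $ j) * var i)"

lemma matrix_inv_props:
  fixes w :: "complex ^ 'n ^ 'n"
  assumes "invertible w"
  shows "w ** matrix_inv w = mat 1" "matrix_inv w ** w = mat 1"
  using someI_ex[of "\<lambda>A'. w ** A' = mat 1 \<and> A' ** w = mat 1"] assms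
  by (auto simp: invertible_def matrix_inv_def)

lemma coord_homog: "coord w j \<in> homog 1"
  unfolding coord_def by (intro homog_sum homog_cmult homog_var)

lemma subst_coord:
  assumes w: "invertible w" and h: "ring_map h"
    and a: "\<And>i. a i = (\<Sum>k\<in>UNIV. h (w $ k $ i) * y k)"
  shows "subst h a (coord w j) = y j"
proof -
  interpret h: ring_map h by fact
  interpret s: ring_map "subst h a" by (rule ring_map_subst[OF h])
  have "subst h a (coord w j) = (\<Sum>i\<in>UNIV. h (matrix_inv w $ i $ j) * (\<Sum>k\<in>UNIV. h (w $ k $ i) * y k))"
    unfolding coord_def by (simp add: s.map_sum s.map_mult ring_map_subst[OF h] a)
  also have "\<dots> = (\<Sum>k\<in>UNIV. \<Sum>i\<in>UNIV. h (matrix_inv w $ i $ j) * (h (w $ k $ i) * y k))"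
    unfolding sum_distrib_left by (rule sum.swap)
  also have "\<dots> = (\<Sum>k\<in>UNIV. h (\<Sum>i\<in>UNIV. w $ k $ i * matrix_inv w $ i $ j) * y k)"
    by (simp add: h.map_sum h.map_mult sum_distrib_right sum_distrib_left algebra_simps)
  also have "\<dots> = (\<Sum>k\<in>UNIV. if k = j then y k else 0)"
    using matrix_inv_props(1)[OF w]
    by (intro sum.cong) (auto simp: vec_eq_iff matrix_matrix_mult_def mat_def)
  finally show ?thesis by simp
qed

lemma var_as_coord:
  assumes w: "invertible w"
  shows "var i = (\<Sum>j\<in>UNIV. const (w $ j $ i) * coord w j)"
proof -
  have "(\<Sum>j\<in>UNIV. const (w $ j $ i) * coord w j) =
     (\<Sum>k\<in>UNIV. \<Sum>j\<in>UNIV. const (w $ j $ i) * (const (matrix_inv w $ k $ j) * var k))"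
    unfolding coord_def sum_distrib_left by (rule sum.swap)
  also have "\<dots> = (\<Sum>k\<in>UNIV. const (\<Sum>j\<in>UNIV. matrix_inv w $ k $ j * w $ j $ i) * var k)"
    by (simp add: const.map_sum const.map_mult sum_distrib_right sum_distrib_left algebra_simps)
  also have "\<dots> = (\<Sum>k\<in>UNIV. if k = i then var k else 0)"
    using matrix_inv_props(2)[OF w]
    by (intro sum.cong) (auto simp: vec_eq_iff matrix_matrix_mult_def mat_def)
  finally show ?thesis by simp
qed

lemma eval_coord:
  assumes "invertible w"
  shows "eval (coord w j) (\<Sum>k\<in>UNIV. c k *s w $ k) = c j"
  unfolding eval_def
  by (rule subst_coord[OF assms ring_map_ident]) (simp add: mult.commute)

lemma eval_coord_row:
  assumes "invertible w"
  shows "eval (coord w j) (w $ k) = (if j = k then 1 else 0)"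
proof -
  have "(\<Sum>i\<in>UNIV. (if i = k then 1 else 0) *s w $ i) = (\<Sum>i\<in>UNIV. (if i = k then w $ i else 0))"
    by (intro sum.cong) auto
  then show ?thesis using eval_coord[OF assms, of j "\<lambda>i. if i = k then 1 else 0"] by simp
qed

lemma vec_as_rows:
  assumes "invertible w"
  shows "v = (\<Sum>k\<in>UNIV. eval (coord w k) v *s w $ k)"
proof -
  have "v $ i = (\<Sum>k\<in>UNIV. eval (coord w k) v *s w $ k) $ i" for i
    using arg_cong[OF var_as_coord[OF assms, of i], of "\<lambda>p. eval p v"]
    by (simp add: eval.map_sum eval.map_mult mult.commute)
  then show ?thesis by (simp add: vec_eq_iff)
qed

lemma frame_step:
  assumes "p \<in> homog (k + 1)" "k \<ge> 0" "invertible w"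
  shows "\<exists>q. (\<forall>i. q i \<in> homog k) \<and> p = (\<Sum>i\<in>UNIV. coord w i * q i)"
proof -
  obtain q where q: "\<And>i. q i \<in> homog k" "p = (\<Sum>i\<in>UNIV. var i * q i)"
    using homog_step[OF assms(1,2)] by auto
  have "p = (\<Sum>i\<in>UNIV. \<Sum>j\<in>UNIV. coord w j * (const (w $ j $ i) * q i))"
    unfolding q(2) by (simp add: var_as_coord[OF assms(3)] sum_distrib_left sum_distrib_right algebra_simps)
  also have "\<dots> = (\<Sum>j\<in>UNIV. coord w j * (\<Sum>i\<in>UNIV. const (w $ j $ i) * q i))"
    unfolding sum_distrib_left by (rule sum.swap)
  finally show ?thesis
    by (intro exI[of _ "\<lambda>j. \<Sum>i\<in>UNIV. const (w $ j $ i) * q i"]) (auto intro: homog_sum homog_cmult q)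
qed

lemma eval_scale: "p \<in> homog (int k) \<Longrightarrow> eval p (c *s v) = c ^ k * eval p v"
proof (induction k arbitrary: p)
  case 0
  then obtain a where "p = const a" using homog_deg0[of p] by auto
  then show ?case by simp
next
  case (Suc k)
  then obtain q where "\<And>i. q i \<in> homog (int k)" "p = (\<Sum>i\<in>UNIV. var i * q i)"
    using homog_step[of p "int k"] by (auto simp: add.commute)
  then show ?case using Suc.IH by (simp add: eval.map_sum eval.map_mult sum_distrib_left algebra_simps)
qed

subsection \<open>Permuting a frame\<close>

definition permute :: "(3 \<Rightarrow> 3) \<Rightarrow> complex ^ 3 ^ 3 \<Rightarrow> complex ^ 3 ^ 3" where
  "permute \<sigma> w = (\<chi> k. w $ \<sigma> k)"

lemma permute_row [simp]: "permute \<sigma> w $ k = w $ \<sigma> k"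
  by (simp add: permute_def)

lemma invertible_permute:
  assumes "invertible w" "inj \<sigma>"
  shows "invertible (permute \<sigma> w)"
proof -
  define c where "c = (\<chi> i j. matrix_inv w $ i $ \<sigma> j)"
  have "(w ** matrix_inv w) $ \<sigma> i $ \<sigma> j = (mat 1 :: complex^3^3) $ \<sigma> i $ \<sigma> j" for i j
    by (simp add: matrix_inv_props[OF assms(1)])
  then have "(permute \<sigma> w ** c) $ i $ j = mat 1 $ i $ j" for i j
    using injD[OF assms(2)] by (auto simp: matrix_matrix_mult_def c_def mat_def split: if_splits)
  then have "permute \<sigma> w ** c = mat 1" by (simp add: vec_eq_iff)
  then show ?thesis using matrix_left_right_inverse invertible_def by blast
qed

lemma coord_permute:
  assumes "invertible w" "inj \<sigma>"
  shows "coord (permute \<sigma> w) j = coord w (\<sigma> j)"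
proof -
  note inv = invertible_permute[OF assms]
  have b: "bij \<sigma>" using finite_UNIV_inj_surj[OF finite assms(2)] assms(2) by (auto simp: bij_def)
  have "subst const var (coord (permute \<sigma> w) j) = coord w (\<sigma> j)"
  proof (rule subst_coord[OF inv ring_map_const])
    fix i
    show "var i = (\<Sum>k\<in>UNIV. const (permute \<sigma> w $ k $ i) * coord w (\<sigma> k))"
      using sum.reindex_bij_betw[OF b, of "\<lambda>k. const (w $ k $ i) * coord w k"]
      by (simp add: var_as_coord[OF assms(1), of i])
  qed
  moreover have "subst const var p = p" for p :: "3 mpoly"
    by (rule ring_map_eqI[of _ "\<lambda>p. p :: 3 mpoly", OF ring_map_subst(1)[OF ring_map_const]])
       (auto simp: ring_map_ident ring_map_subst(2,3)[OF ring_map_const])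
  ultimately show ?thesis by simp
qed

subsection \<open>Restriction to a line\<close>

text \<open>The line \<open>coord w 3 = 0\<close> is parametrized by \<open>w $ 1 + t w $ 2\<close>, with \<open>w $ 2\<close> at infinity.
  A form of degree \<open>k\<close> restricts to a polynomial in \<open>t\<close> of degree at most \<open>k\<close>, the defect being
  the order of vanishing at infinity.\<close>

definition rest :: "complex ^ 3 ^ 3 \<Rightarrow> 3 mpoly \<Rightarrow> complex poly" where
  "rest w p = subst (\<lambda>c. [:c:]) (\<lambda>i. [:w $ 1 $ i, w $ 2 $ i:]) p"

interpretation rest: ring_map "rest w" for w
  unfolding rest_def by (rule ring_map_subst(1)[OF ring_map_pconst])

lemma rest_const [simp]: "rest w (const c) = [:c:]"
  unfolding rest_def by (rule ring_map_subst(2)[OF ring_map_pconst])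

lemma rest_var: "rest w (var i) = [:w $ 1 $ i, w $ 2 $ i:]"
  unfolding rest_def by (rule ring_map_subst(3)[OF ring_map_pconst])

lemma rest_coord [simp]:
  assumes "invertible w"
  shows "rest w (coord w 1) = 1" "rest w (coord w 2) = [:0, 1:]" "rest w (coord w 3) = 0"
proof -
  have "rest w (coord w j) = (if j = 1 then 1 else if j = 2 then [:0, 1:] else 0)" for j
    unfolding rest_def by (rule subst_coord[OF assms ring_map_pconst]) (simp add: sum_3)
  then show "rest w (coord w 1) = 1" "rest w (coord w 2) = [:0, 1:]" "rest w (coord w 3) = 0"
    by auto
qed

lemma poly_rest: "poly (rest w p) t = eval p (w $ 1 + t *s w $ 2)"
proof -
  have "ring_map (\<lambda>p. poly (rest w p) t)"
    by unfold_locales (auto simp: rest.hom_simps)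
  from this eval.ring_map_axioms show ?thesis
    by (rule ring_map_eqI[of "\<lambda>p. poly (rest w p) t"]) (auto simp: rest_var)
qed

lemma frame_decomp_ex:
  assumes w: "invertible w" and "p \<in> homog (int k)"
  shows "\<exists>p' c. p' \<in> homog (int k - 1) \<and>
    p = coord w 3 * p' + (\<Sum>i\<le>k. const (c i) * coord w 2 ^ i * coord w 1 ^ (k - i))"
  using assms(2)
proof (induction k arbitrary: p)
  case 0
  then obtain a where "p = const a" using homog_deg0[of p] by auto
  then show ?case by (intro exI[of _ 0] exI[of _ "\<lambda>_. a"]) simp
next
  case (Suc k)
  let ?X = "coord w"
  obtain q where q: "\<And>i. q i \<in> homog (int k)" "p = (\<Sum>i\<in>UNIV. ?X i * q i)"
    using frame_step[of p "int k" w] Suc.prems w by (auto simp: add.commute)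
  obtain a c where 1: "a \<in> homog (int k - 1)"
    "q 1 = ?X 3 * a + (\<Sum>i\<le>k. const (c i) * ?X 2 ^ i * ?X 1 ^ (k - i))"
    using Suc.IH[OF q(1)] by blast
  obtain b e where 2: "b \<in> homog (int k - 1)"
    "q 2 = ?X 3 * b + (\<Sum>i\<le>k. const (e i) * ?X 2 ^ i * ?X 1 ^ (k - i))"
    using Suc.IH[OF q(1)] by blast
  define g where "g i = (if i \<le> k then c i else 0) + (if i = 0 then 0 else e (i - 1))" for i
  have s1: "(\<Sum>i\<le>Suc k. const (if i \<le> k then c i else 0) * ?X 2 ^ i * ?X 1 ^ (Suc k - i)) =
     ?X 1 * (\<Sum>i\<le>k. const (c i) * ?X 2 ^ i * ?X 1 ^ (k - i))"
    by (simp add: sum_distrib_left) (intro sum.cong, auto simp: Suc_diff_le algebra_simps)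
  have s2: "(\<Sum>i\<le>Suc k. const (if i = 0 then 0 else e (i - 1)) * ?X 2 ^ i * ?X 1 ^ (Suc k - i)) =
     ?X 2 * (\<Sum>i\<le>k. const (e i) * ?X 2 ^ i * ?X 1 ^ (k - i))"
    by (subst sum.atMost_Suc_shift) (simp add: sum_distrib_left algebra_simps)
  have "(\<Sum>i\<le>Suc k. const (g i) * ?X 2 ^ i * ?X 1 ^ (Suc k - i)) =
     ?X 1 * (\<Sum>i\<le>k. const (c i) * ?X 2 ^ i * ?X 1 ^ (k - i)) +
     ?X 2 * (\<Sum>i\<le>k. const (e i) * ?X 2 ^ i * ?X 1 ^ (k - i))"
    unfolding s1[symmetric] s2[symmetric] g_def const.map_add
    by (simp add: sum.distrib algebra_simps)
  then have "p = ?X 3 * (?X 1 * a + ?X 2 * b + q 3) +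
     (\<Sum>i\<le>Suc k. const (g i) * ?X 2 ^ i * ?X 1 ^ (Suc k - i))"
    unfolding q(2) sum_3 1 2 by (simp add: algebra_simps)
  moreover have "?X 1 * a + ?X 2 * b + q 3 \<in> homog (int (Suc k) - 1)"
    using homog_mult[OF coord_homog 1(1), of w 1] homog_mult[OF coord_homog 2(1), of w 2] q(1)[of 3]
    by (auto intro!: homog_add)
  ultimately show ?case by blast
qed

text \<open>Modulo \<open>coord w 3\<close> a form is the homogenization of its restriction. This determines the image and
  the kernel of the restriction in each degree.\<close>

lemma frame_decomp:
  assumes w: "invertible w" and p: "p \<in> homog (int k)"
  shows "degree (rest w p) \<le> k"
    and "\<exists>p'\<in>homog (int k - 1). p = coord w 3 * p' +
       (\<Sum>i\<le>k. const (coeff (rest w p) i) * coord w 2 ^ i * coord w 1 ^ (k - i))"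
proof -
  obtain p' c where *: "p' \<in> homog (int k - 1)"
    "p = coord w 3 * p' + (\<Sum>i\<le>k. const (c i) * coord w 2 ^ i * coord w 1 ^ (k - i))"
    using frame_decomp_ex[OF assms] by auto
  have "rest w p = (\<Sum>i\<le>k. [:c i:] * [:0, 1:] ^ i)"
    by (subst *(2)) (simp add: rest.hom_simps w)
  then have r: "rest w p = (\<Sum>i\<le>k. monom (c i) i)"
    by (simp add: monom_altdef)
  then show "degree (rest w p) \<le> k"
    by (auto intro!: degree_sum_le order.trans[OF degree_monom_le])
  have "coeff (rest w p) i = c i" if "i \<le> k" for i
    using that by (simp add: r coeff_sum)
  then have "(\<Sum>i\<le>k. const (coeff (rest w p) i) * coord w 2 ^ i * coord w 1 ^ (k - i)) =
      (\<Sum>i\<le>k. const (c i) * coord w 2 ^ i * coord w 1 ^ (k - i))"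
    by (intro sum.cong) auto
  then show "\<exists>p'\<in>homog (int k - 1). p = coord w 3 * p' +
       (\<Sum>i\<le>k. const (coeff (rest w p) i) * coord w 2 ^ i * coord w 1 ^ (k - i))"
    using *(1) by (intro bexI[of _ p']) (simp only: *(2)[symmetric], rule *(1))
qed

lemma rest_kernel:
  assumes w: "invertible w" and p: "p \<in> homog k" and 0: "rest w p = 0"
  shows "\<exists>p'\<in>homog (k - 1). p = coord w 3 * p'"
proof (cases "k < 0")
  case True
  then show ?thesis using homog_neg[OF p] by (intro bexI[of _ 0]) auto
next
  case False
  then show ?thesis using frame_decomp(2)[OF w, of p "nat k"] p 0 by simp
qed

lemma rest_surj:
  assumes w: "invertible w" and q: "degree q \<le> k"
  shows "\<exists>p\<in>homog (int k). rest w p = q"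
proof
  let ?p = "\<Sum>i\<le>k. const (coeff q i) * (coord w 2 ^ i * coord w 1 ^ (k - i))"
  show "?p \<in> homog (int k)"
  proof (intro homog_sum homog_cmult)
    fix i assume "i \<in> {..k}"
    then show "coord w 2 ^ i * coord w 1 ^ (k - i) \<in> homog (int k)"
      using homog_mult[OF homog_power1[OF coord_homog[of w 2], of i] homog_power1[OF coord_homog[of w 1], of "k - i"]]
      by (simp add: of_nat_diff)
  qed
  have "rest w ?p = (\<Sum>i\<le>k. monom (coeff q i) i)"
    by (simp add: rest.hom_simps w monom_altdef)
  also have "\<dots> = q" by (rule poly_as_sum_of_monoms'[OF q])
  finally show "rest w ?p = q" .
qed

lemma coeff_rest_infinity:
  assumes w: "invertible w" and p: "p \<in> homog (int k)"
  shows "coeff (rest w p) k = eval p (w $ 2)"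
proof -
  obtain p' where "p = coord w 3 * p' +
       (\<Sum>i\<le>k. const (coeff (rest w p) i) * coord w 2 ^ i * coord w 1 ^ (k - i))"
    using frame_decomp(2)[OF assms] by auto
  from arg_cong[OF this, of "\<lambda>p. eval p (w $ 2)"]
  have "eval p (w $ 2) = (\<Sum>i\<le>k. coeff (rest w p) i * 0 ^ (k - i))"
    by (simp add: eval.hom_simps eval_coord_row[OF w])
  also have "\<dots> = (\<Sum>i\<le>k. if i = k then coeff (rest w p) i else 0)"
    by (intro sum.cong) (auto simp: power_0_left)
  finally show ?thesis by simp
qed

lemma coord_dvd_iff:
  assumes w: "invertible w" and p: "p \<in> homog k"
  shows "coord w 3 dvd p \<longleftrightarrow> rest w p = 0"
  using rest_kernel[OF assms] by (auto simp: rest.hom_simps w elim!: dvdE)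

lemma coord_nonzero: "invertible w \<Longrightarrow> coord w j \<noteq> 0"
  using eval_coord_row[of w j j] by auto

subsection \<open>Dehomogenization\<close>

lemma ring_map_local_eq: "ring_map (\<lambda>p. local_eq p w)"
  unfolding local_eq_def by (rule ring_map_subst(1)[OF ring_map_const])

interpretation loc: ring_map "\<lambda>p. local_eq p w" for w
  by (rule ring_map_local_eq)

lemma local_eq_const [simp]: "local_eq (const c) w = const c"
  unfolding local_eq_def by (rule ring_map_subst(2)[OF ring_map_const])

lemma local_eq_var:
  "local_eq (var i) w = const (w $ 1 $ i) + const (w $ 2 $ i) * var 1 + const (w $ 3 $ i) * var 2"
  unfolding local_eq_def by (rule ring_map_subst(3)[OF ring_map_const])

lemma local_eq_coord:
  assumes "invertible w"
  shows "local_eq (coord w 1) w = 1" "local_eq (coord w 2) w = var 1" "local_eq (coord w 3) w = var 2"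
proof -
  have "local_eq (coord w j) w = (if j = 1 then 1 else if j = 2 then var 1 else var 2)" for j
    unfolding local_eq_def by (rule subst_coord[OF assms ring_map_const]) (simp add: sum_3)
  then show "local_eq (coord w 1) w = 1" "local_eq (coord w 2) w = var 1" "local_eq (coord w 3) w = var 2"
    by auto
qed

lemma eval_local_eq: "eval (local_eq p w) v = eval p (w $ 1 + v $ 1 *s w $ 2 + v $ 2 *s w $ 3)"
  by (rule ring_map_eqI[of "\<lambda>p. eval (local_eq p w) v", OF ring_map_comp[OF eval.ring_map_axioms ring_map_local_eq]
       eval.ring_map_axioms]) (auto simp: local_eq_var eval.hom_simps)

text \<open>If the dehomogenization of a form vanishes, then so does its restriction to the line
  \<open>coord w 3 = 0\<close>, and \<open>coord w 3\<close> can be divided out; hence induction on the degree.\<close>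

lemma dehom_inj:
  fixes \<Phi> :: "3 mpoly \<Rightarrow> 'r::idom"
  assumes w: "invertible w" and \<Phi>: "ring_map \<Phi>" and s: "ring_map s" "\<And>p. s (\<Phi> p) = rest w p"
    and X: "\<Phi> (coord w 3) \<noteq> 0" and p: "p \<in> homog k" "\<Phi> p = 0"
  shows "p = 0"
proof (cases "k < 0")
  case True then show ?thesis using homog_neg p(1) by blast
next
  case False
  have "p = 0" if "p \<in> homog (int n)" "\<Phi> p = 0" for n p
    using that
  proof (induction n arbitrary: p rule: less_induct)
    case (less n)
    have "rest w p = 0" using s(2)[of p] less.prems(2) ring_map.map_zero[OF s(1)] by simp
    then obtain p' where p': "p' \<in> homog (int n - 1)" "p = coord w 3 * p'"
      using rest_kernel[OF w less.prems(1)] by blast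
    have "\<Phi> p' = 0" using p'(2) less.prems(2) X by (simp add: ring_map.map_mult[OF \<Phi>])
    moreover have "p' = 0" if "n = 0" using homog_neg[OF p'(1)] that by simp
    ultimately have "p' = 0" using less.IH[of "n - 1" p'] p'(1)
      by (cases "n = 0") (auto simp: of_nat_diff)
    then show ?case using p'(2) by simp
  qed
  from this[of p "nat k"] False p show ?thesis by simp
qed

text \<open>A form may be multiplied by powers of \<open>coord w 1\<close>, which becomes \<open>1\<close>; so homogenizations can be
  brought to a common degree before they are added.\<close>

lemma dehom_raise:
  assumes "ring_map \<Phi>" "\<Phi> (coord w 1) = 1" and "G \<in> homog (int k)" "\<Phi> G = p" "k \<le> n"
  shows "\<exists>G\<in>homog (int n). \<Phi> G = p"
proof
  show "coord w 1 ^ (n - k) * G \<in> homog (int n)"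
    using homog_mult[OF homog_power1[OF coord_homog[of w 1]] assms(3), of "n - k"] assms(5) by simp
  show "\<Phi> (coord w 1 ^ (n - k) * G) = p"
    using assms(4) by (simp add: ring_map.hom_simps[OF assms(1)] assms(2))
qed

lemma dehom_add:
  assumes \<Phi>: "ring_map \<Phi>" "\<Phi> (coord w 1) = 1"
    and "\<exists>k. \<exists>G\<in>homog (int k). \<Phi> G = p" "\<exists>k. \<exists>G\<in>homog (int k). \<Phi> G = q"
  shows "\<exists>k. \<exists>G\<in>homog (int k). \<Phi> G = p + q"
proof -
  obtain k l G H where *: "G \<in> homog (int k)" "\<Phi> G = p" "H \<in> homog (int l)" "\<Phi> H = q"
    using assms(3,4) by blast
  obtain G' H' where "G' \<in> homog (int (k + l))" "\<Phi> G' = p" "H' \<in> homog (int (k + l))" "\<Phi> H' = q"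
    using dehom_raise[OF \<Phi> *(1,2), of "k + l"] dehom_raise[OF \<Phi> *(3,4), of "k + l"] by auto
  then show ?thesis
    by (intro exI[of _ "k + l"] bexI[of _ "G' + H'"]) (auto simp: ring_map.map_add[OF \<Phi>(1)] intro: homog_add)
qed

lemma dehom_mult:
  assumes \<Phi>: "ring_map \<Phi>"
    and "\<exists>k. \<exists>G\<in>homog (int k). \<Phi> G = p" "\<exists>k. \<exists>G\<in>homog (int k). \<Phi> G = q"
  shows "\<exists>k. \<exists>G\<in>homog (int k). \<Phi> G = p * q"
proof -
  obtain k l G H where *: "G \<in> homog (int k)" "\<Phi> G = p" "H \<in> homog (int l)" "\<Phi> H = q"
    using assms(2,3) by blast
  then show ?thesis using homog_mult[OF *(1,3)]
    by (intro exI[of _ "k + l"] bexI[of _ "G * H"]) (auto simp: ring_map.map_mult[OF \<Phi>])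
qed

lemma dehom_coord: "\<exists>k. \<exists>G\<in>homog (int k). \<Phi> G = \<Phi> (coord w j)"
  using coord_homog[of w j] by (intro exI[of _ 1] bexI[of _ "coord w j"]) auto

lemma dehom_const: "\<exists>k. \<exists>G\<in>homog (int k). \<Phi> G = \<Phi> (const c)"
  using homog_const[of c] by (intro exI[of _ 0] bexI[of _ "const c"]) auto

lemma local_eq_inj:
  assumes w: "invertible w" and p: "p \<in> homog k" "local_eq p w = 0"
  shows "p = 0"
proof -
  define s where "s = subst (\<lambda>c. [:c:]) (\<lambda>i::2. if i = 1 then [:0, 1::complex:] else 0)"
  have s: "ring_map s" unfolding s_def by (rule ring_map_subst(1)[OF ring_map_pconst])
  have sv: "s (const c) = [:c:]" "s (var i) = (if i = 1 then [:0, 1:] else 0)" for c i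
    unfolding s_def using ring_map_subst(2,3)[OF ring_map_pconst] by blast+
  have sr: "s (local_eq p w) = rest w p" for p
  proof (rule ring_map_eqI[of "\<lambda>p. s (local_eq p w)" "rest w"])
    show "ring_map (\<lambda>p. s (local_eq p w))" by (rule ring_map_comp[OF s ring_map_local_eq])
    show "s (local_eq (var i) w) = rest w (var i)" for i
      by (simp add: local_eq_var ring_map.hom_simps[OF s] sv rest_var)
    show "s (local_eq (const c) w) = rest w (const c)" for c
      by (simp add: sv)
  qed (rule rest.ring_map_axioms)
  have "var 2 \<noteq> (0 :: 2 mpoly)" using eval_var[of "2 :: 2" "\<chi> i. 1"] by (auto simp del: eval_var)
  then have X: "local_eq (coord w 3) w \<noteq> 0" by (simp add: local_eq_coord[OF w])
  show ?thesis by (rule dehom_inj[OF w ring_map_local_eq s sr X p])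
qed

lemma local_eq_surj:
  assumes w: "invertible w"
  shows "\<exists>k. \<exists>G\<in>homog (int k). local_eq G w = p"
proof (induction p rule: mpoly_induct)
  case (const c)
  then show ?case using dehom_const[of "\<lambda>p. local_eq p w" c] by simp
next
  case (var i)
  have "i = 1 \<or> i = 2" using exhaust_2 by auto
  then show ?case using dehom_coord[of "\<lambda>p. local_eq p w"] local_eq_coord[OF w] by metis
next
  case (add p q)
  then show ?case by (rule dehom_add[OF ring_map_local_eq local_eq_coord(1)[OF w]])
next
  case (mult p q)
  then show ?case by (rule dehom_mult[OF ring_map_local_eq])
qed

subsection \<open>Frames adapted to a point or a line\<close>

lemma frame_through:
  fixes v :: "complex ^ 3"
  assumes "v \<noteq> 0"
  shows "\<exists>w :: complex ^ 3 ^ 3. invertible w \<and> w $ 1 = v"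
proof -
  have "v $ 1 \<noteq> 0 \<or> v $ 2 \<noteq> 0 \<or> v $ 3 \<noteq> 0"
    using assms by (auto simp: vec_eq_iff forall_3)
  then consider "v $ 1 \<noteq> 0" | "v $ 2 \<noteq> 0" | "v $ 3 \<noteq> 0" by blast
  then show ?thesis
  proof cases
    case 1
    then show ?thesis
      by (intro exI[of _ "vector [v, vector [0,1,0], vector [0,0,1]]"]) (auto simp: invertible_det_nz det_3)
  next
    case 2
    then show ?thesis
      by (intro exI[of _ "vector [v, vector [1,0,0], vector [0,0,1]]"]) (auto simp: invertible_det_nz det_3)
  next
    case 3
    then show ?thesis
      by (intro exI[of _ "vector [v, vector [1,0,0], vector [0,1,0]]"]) (auto simp: invertible_det_nz det_3)
  qed
qed

lemma linear_form:
  assumes "l \<in> homog 1"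
  shows "\<exists>a. l = (\<Sum>i\<in>UNIV. const (a i) * var i)"
proof -
  obtain q where q: "\<And>i. q i \<in> homog 0" "l = (\<Sum>i\<in>UNIV. var i * q i)"
    using homog_step[of l 0] assms by auto
  then have "q i = const (Poly_Mapping.lookup (q i) 0)" for i using homog_deg0 by blast
  then show ?thesis using q(2)
    by (intro exI[of _ "\<lambda>i. Poly_Mapping.lookup (q i) 0"]) (simp add: mult.commute)
qed

lemma frame_of_line:
  assumes l: "l \<in> homog 1" "l \<noteq> (0 :: 3 mpoly)"
  shows "\<exists>w. invertible w \<and> coord w 3 = l"
proof -
  obtain a where a: "l = (\<Sum>i\<in>UNIV. const (a i) * var i)" using linear_form[OF l(1)] by blast
  then have "\<exists>i. a i \<noteq> 0" using l(2) by (metis (no_types, lifting) const.map_zero mult_zero_left sum.neutral)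
  then consider "a 1 \<noteq> 0" | "a 2 \<noteq> 0" | "a 3 \<noteq> 0" by (metis exhaust_3)
  then have "\<exists>c :: complex ^ 3 ^ 3. invertible c \<and> (\<forall>i. c $ i $ 3 = a i)"
  proof cases
    case 1
    then show ?thesis
      by (intro exI[of _ "vector [vector [0,0,a 1], vector [1,0,a 2], vector [0,1,a 3]]"])
         (auto simp: invertible_det_nz det_3 forall_3)
  next
    case 2
    then show ?thesis
      by (intro exI[of _ "vector [vector [1,0,a 1], vector [0,0,a 2], vector [0,1,a 3]]"])
         (auto simp: invertible_det_nz det_3 forall_3)
  next
    case 3
    then show ?thesis
      by (intro exI[of _ "vector [vector [1,0,a 1], vector [0,1,a 2], vector [0,0,a 3]]"])
         (auto simp: invertible_det_nz det_3 forall_3)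
  qed
  then obtain c :: "complex ^ 3 ^ 3" where c: "invertible c" "\<And>i. c $ i $ 3 = a i" by blast
  define w where "w = matrix_inv c"
  have cw: "w ** c = mat 1" "c ** w = mat 1" using matrix_inv_props[OF c(1)] by (auto simp: w_def)
  then have w: "invertible w" by (auto simp: invertible_def)
  have "matrix_inv w = (matrix_inv w ** w) ** c"
    using cw(1) by (simp flip: matrix_mul_assoc)
  then have "matrix_inv w = c" using matrix_inv_props[OF w] by simp
  then have "coord w 3 = l" by (simp add: coord_def a c(2))
  with w show ?thesis by blast
qed

section \<open>Dimensions of quotients\<close>

locale cvs = vector_space scale for scale :: "complex \<Rightarrow> 'b::ab_group_add \<Rightarrow> 'b"
begin

abbreviation combo :: "('b \<Rightarrow> complex) \<Rightarrow> 'b set \<Rightarrow> 'b" where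
  "combo c B \<equiv> \<Sum>b\<in>B. scale (c b) b"

text \<open>Quotients are not formed as types. A basis of \<open>V/W\<close> is a set of representatives in \<open>V\<close>, and
  independence and spanning are understood modulo \<open>W\<close>.\<close>

definition fin_quot :: "'b set \<Rightarrow> 'b set \<Rightarrow> bool" where
  "fin_quot V W \<longleftrightarrow> (\<exists>B. quot_basis scale V W B)"

definition indep_mod :: "'b set \<Rightarrow> 'b set \<Rightarrow> bool" where
  "indep_mod W B \<longleftrightarrow> (\<forall>c. combo c B \<in> W \<longrightarrow> (\<forall>b\<in>B. c b = 0))"

definition span_mod :: "'b set \<Rightarrow> 'b set \<Rightarrow> 'b set \<Rightarrow> bool" where
  "span_mod V W B \<longleftrightarrow> (\<forall>v\<in>V. \<exists>c. v - combo c B \<in> W)"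

lemma indep_modD: "indep_mod W B \<Longrightarrow> combo c B \<in> W \<Longrightarrow> b \<in> B \<Longrightarrow> c b = 0"
  by (auto simp: indep_mod_def)

lemma quot_basis_iff:
  "quot_basis scale V W B \<longleftrightarrow> finite B \<and> B \<subseteq> V \<and> indep_mod W B \<and> span_mod V W B"
  by (simp add: quot_basis_def indep_mod_def span_mod_def)

lemma combo_in: "subspace V \<Longrightarrow> B \<subseteq> V \<Longrightarrow> combo c B \<in> V"
  by (intro subspace_sum subspace_scale) auto

lemma indep_mod_distinct:
  assumes "indep_mod W B" "finite B" "b \<in> B" "b' \<in> B" "b - b' \<in> W"
  shows "b = b'"
proof (rule ccontr)
  assume ne: "b \<noteq> b'"
  let ?c = "\<lambda>x. if x = b then 1 else if x = b' then -1 else (0::complex)"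
  have "combo ?c B =
        (\<Sum>x\<in>B. (if x = b then b else 0) + (if x = b' then - b' else 0))"
    by (rule sum.cong) (auto simp: ne)
  also have "\<dots> = b - b'" using assms by (simp add: sum.distrib)
  finally have "combo ?c B \<in> W" using assms by simp
  then have "?c b = 0" using indep_modD[OF assms(1), of ?c b] assms(3) by blast
  then show False by simp
qed

text \<open>The exchange bound for quotients follows from the one for vector spaces: replace each
  vector of \<open>B'\<close> by its reduction to the span of \<open>B\<close>.\<close>

lemma indep_mod_card_le:
  assumes W: "subspace W" and B: "finite B" "span_mod V W B" and B': "finite B'" "B' \<subseteq> V" "indep_mod W B'"
  shows "card B' \<le> card B"
proof -
  have "\<forall>x. \<exists>c. x \<in> B' \<longrightarrow> x - combo c B \<in> W" using B(2) B'(2) by (auto simp: span_mod_def)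
  then obtain c where c: "\<And>x. x \<in> B' \<Longrightarrow> x - combo (c x) B \<in> W" by metis
  define \<pi> where "\<pi> x = combo (c x) B" for x
  have d: "x - \<pi> x \<in> W" if "x \<in> B'" for x using c[OF that] by (simp add: \<pi>_def)
  have inj: "inj_on \<pi> B'"
  proof (rule inj_onI)
    fix x y assume xy: "x \<in> B'" "y \<in> B'" "\<pi> x = \<pi> y"
    have "x - y = (x - \<pi> x) - (y - \<pi> y)" using xy by simp
    then have "x - y \<in> W" using subspace_diff[OF W d[OF xy(1)] d[OF xy(2)]] by simp
    then show "x = y" using indep_mod_distinct[OF B'(3,1)] xy by blast
  qed
  have "independent (\<pi> ` B')"
  proof (rule independent_if_scalars_zero)
    show "finite (\<pi> ` B')" using B' by simp
    fix f x assume f: "(\<Sum>x\<in>\<pi> ` B'. scale (f x) x) = 0" and x: "x \<in> \<pi> ` B'"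
    have "combo (\<lambda>x. f (\<pi> x)) B' = (\<Sum>x\<in>B'. scale (f (\<pi> x)) (x - \<pi> x)) + (\<Sum>x\<in>B'. scale (f (\<pi> x)) (\<pi> x))"
      by (simp add: scale_right_diff_distrib sum_subtractf)
    also have "(\<Sum>x\<in>B'. scale (f (\<pi> x)) (\<pi> x)) = 0"
      using f by (simp add: sum.reindex[OF inj])
    finally have "combo (\<lambda>x. f (\<pi> x)) B' \<in> W"
      using d by (auto intro!: subspace_sum[OF W] subspace_scale[OF W])
    then have "f (\<pi> b) = 0" if "b \<in> B'" for b using indep_modD[OF B'(3), of "\<lambda>x. f (\<pi> x)" b] that by blast
    then show "f x = 0" using x by auto
  qed
  moreover have "\<pi> ` B' \<subseteq> span B"
    by (auto simp: \<pi>_def intro: span_base intro!: span_sum span_scale)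
  ultimately have "card (\<pi> ` B') \<le> card B"
    using independent_span_bound[OF B(1)] by blast
  then show ?thesis by (simp add: card_image[OF inj])
qed

lemma quot_dim_eq:
  assumes "subspace W" "quot_basis scale V W B"
  shows "quot_dim scale V W = card B"
  unfolding quot_dim_def
proof (rule the_equality)
  show "\<exists>B'. quot_basis scale V W B' \<and> card B' = card B" using assms by blast
  fix n assume "\<exists>B'. quot_basis scale V W B' \<and> card B' = n"
  then obtain B' where "quot_basis scale V W B'" "card B' = n" by blast
  then show "n = card B" using assms indep_mod_card_le[OF assms(1)]
    by (auto simp: quot_basis_iff intro!: le_antisym)
qed

lemma fin_quot_of_span_mod:
  assumes W: "subspace W" and G: "finite G" "G \<subseteq> V" "span_mod V W G"
  shows "fin_quot V W"
proof -
  let ?P = "\<lambda>n. \<exists>B. finite B \<and> B \<subseteq> V \<and> span_mod V W B \<and> card B = n"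
  have "\<exists>n. ?P n" using G by blast
  then have "?P (Least ?P)" by (rule LeastI_ex)
  then obtain B where B: "finite B" "B \<subseteq> V" "span_mod V W B" and lst: "card B = Least ?P" by blast
  have "indep_mod W B"
    unfolding indep_mod_def
  proof (intro allI impI ballI, rule ccontr)
    fix c b assume c: "combo c B \<in> W" and b: "b \<in> B" "c b \<noteq> 0"
    have "span_mod V W (B - {b})"
      unfolding span_mod_def
    proof
      fix v assume "v \<in> V"
      then obtain e where e: "v - combo e B \<in> W" using B(3) unfolding span_mod_def by blast
      let ?e = "\<lambda>x. e x - e b / c b * c x"
      have "combo ?e (B - {b}) = combo ?e B"
        using b B(1) by (subst (2) sum.remove[of _ b]) auto
      also have "\<dots> = combo e B - scale (e b / c b) (combo c B)"
        by (simp add: scale_left_diff_distrib sum_subtractf scale_sum_right)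
      finally have eq: "v - combo ?e (B - {b}) = (v - combo e B) + scale (e b / c b) (combo c B)" by simp
      have "v - combo ?e (B - {b}) \<in> W"
        unfolding eq by (rule subspace_add[OF W e subspace_scale[OF W c]])
      then show "\<exists>c. v - combo c (B - {b}) \<in> W" by (rule exI[of _ ?e])
    qed
    then have "?P (card (B - {b}))" using B by blast
    then have "card B \<le> card (B - {b})" unfolding lst by (rule Least_le)
    then show False using b B(1) by (metis card_Diff1_less linorder_not_less)
  qed
  then show ?thesis using B unfolding fin_quot_def quot_basis_iff by blast
qed

lemma indep_mod_insert:
  assumes W: "subspace W" and B: "finite B" "indep_mod W B" and v: "\<nexists>c. v - combo c B \<in> W" "v \<notin> B"
  shows "indep_mod W (insert v B)"
  unfolding indep_mod_def
proof (intro allI impI)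
  fix c assume "combo c (insert v B) \<in> W"
  then have c: "scale (c v) v + combo c B \<in> W" using B v by simp
  have "c v = 0"
  proof (rule ccontr)
    assume cv: "c v \<noteq> 0"
    have "scale (1 / c v) (scale (c v) v + combo c B) = v - combo (\<lambda>x. - (c x / c v)) B"
      using cv by (simp add: scale_right_distrib scale_sum_right sum_negf)
    then have "v - combo (\<lambda>x. - (c x / c v)) B \<in> W" using subspace_scale[OF W c, of "1 / c v"] by simp
    moreover have "v - combo (\<lambda>x. - (c x / c v)) B \<notin> W"
      using v(1) by (rule contrapos_nn) (rule exI[of _ "\<lambda>x. - (c x / c v)"])
    ultimately show False by simp
  qed
  then show "\<forall>b\<in>insert v B. c b = 0" using c B(2) by (simp add: indep_mod_def)
qed

lemma fin_quot_sub:
  assumes W: "subspace W" and V: "V' \<subseteq> V" and f: "fin_quot V W"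
  shows "fin_quot V' W"
proof -
  obtain B where B: "finite B" "span_mod V W B" using f by (auto simp: fin_quot_def quot_basis_iff)
  let ?P = "\<lambda>n. \<exists>B'. finite B' \<and> B' \<subseteq> V' \<and> indep_mod W B' \<and> card B' = n"
  have bd: "n \<le> card B" if "?P n" for n
    using that indep_mod_card_le[OF W B] V by (meson order.trans)
  have "?P 0" by (intro exI[of _ "{}"]) (simp add: indep_mod_def)
  then have "?P (Greatest ?P)" using bd by (intro GreatestI_nat[of ?P 0 "card B"]) auto
  then obtain B' where B': "finite B'" "B' \<subseteq> V'" "indep_mod W B'" "card B' = Greatest ?P" by blast
  have "span_mod V' W B'"
    unfolding span_mod_def
  proof (rule ballI, rule ccontr)
    fix v assume v: "v \<in> V'" "\<nexists>c. v - combo c B' \<in> W"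
    have vB: "v \<notin> B'"
    proof
      assume "v \<in> B'"
      then have "combo (\<lambda>x. if x = v then 1 else 0) B' = v"
        using B'(1) by (subst sum.remove[of _ v]) auto
      then have "v - combo (\<lambda>x. if x = v then 1 else 0) B' \<in> W" using subspace_0[OF W] by simp
      moreover have "v - combo (\<lambda>x. if x = v then 1 else 0) B' \<notin> W"
        using v(2) by (rule contrapos_nn) (rule exI[of _ "\<lambda>x. if x = v then 1 else 0"])
      ultimately show False by simp
    qed
    then have "?P (card (insert v B'))" using indep_mod_insert[OF W B'(1,3) v(2) vB] B' v by blast
    then have "card (insert v B') \<le> Greatest ?P" using bd by (intro Greatest_le_nat[of ?P _ "card B"]) auto
    then show False using vB B' by simp
  qed
  then show ?thesis using B' unfolding fin_quot_def quot_basis_iff by blast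
qed

lemma fin_quot_mono:
  assumes "subspace W" "subspace W'" "W \<subseteq> W'" "fin_quot V W"
  shows "fin_quot V W'"
proof -
  obtain B where B: "finite B" "B \<subseteq> V" "span_mod V W B" using assms by (auto simp: fin_quot_def quot_basis_iff)
  then have "span_mod V W' B" using assms(3) unfolding span_mod_def by blast
  then show ?thesis using fin_quot_of_span_mod[OF assms(2) B(1,2)] by blast
qed

lemma quot_basis_chain:
  assumes W: "subspace W" and V': "subspace V'" and WV': "W \<subseteq> V'" and V'V: "V' \<subseteq> V"
    and B1: "quot_basis scale V V' B1" and B2: "quot_basis scale V' W B2"
  shows "quot_basis scale V W (B1 \<union> B2)" "B1 \<inter> B2 = {}"
proof -
  note 1 = B1[unfolded quot_basis_iff] and 2 = B2[unfolded quot_basis_iff]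
  show disj: "B1 \<inter> B2 = {}"
  proof (rule ccontr)
    assume "B1 \<inter> B2 \<noteq> {}"
    then obtain b where b: "b \<in> B1" "b \<in> V'" using 2 by blast
    let ?c = "\<lambda>x. if x = b then 1 else (0::complex)"
    have "combo ?c B1 = b"
      using b 1 by (subst sum.remove[of _ b]) auto
    then have "combo ?c B1 \<in> V'" using b by simp
    then have "?c b = 0" using indep_modD[of V' B1 ?c b] 1 b(1) by blast
    then show False by simp
  qed
  have split: "combo c (B1 \<union> B2) = combo c B1 + combo c B2" for c
    using 1 2 disj by (intro sum.union_disjoint) auto
  have in2: "combo c B2 \<in> V'" for c using combo_in[OF V'] 2 by blast
  show "quot_basis scale V W (B1 \<union> B2)"
    unfolding quot_basis_iff
  proof (intro conjI)
    show "finite (B1 \<union> B2)" "B1 \<union> B2 \<subseteq> V" using 1 2 V'V by auto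
    show "indep_mod W (B1 \<union> B2)"
      unfolding indep_mod_def
    proof (intro allI impI)
      fix c assume c: "combo c (B1 \<union> B2) \<in> W"
      have "combo c B1 = combo c (B1 \<union> B2) - combo c B2" by (simp add: split)
      then have "combo c B1 \<in> V'" using c WV' in2 subspace_diff[OF V'] by auto
      then have z1: "\<forall>b\<in>B1. c b = 0" using 1 by (auto dest: indep_modD)
      then have "combo c B2 \<in> W" using c by (simp add: split)
      then have "\<forall>b\<in>B2. c b = 0" using 2 by (auto dest: indep_modD)
      with z1 show "\<forall>b\<in>B1 \<union> B2. c b = 0" by blast
    qed
    show "span_mod V W (B1 \<union> B2)"
      unfolding span_mod_def
    proof
      fix v assume "v \<in> V"
      then obtain c1 where c1: "v - combo c1 B1 \<in> V'" using 1 unfolding span_mod_def by blast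
      then obtain c2 where c2: "v - combo c1 B1 - combo c2 B2 \<in> W" using 2 unfolding span_mod_def by blast
      let ?c = "\<lambda>b. if b \<in> B1 then c1 b else c2 b"
      have "combo ?c B1 = combo c1 B1" by (rule sum.cong) auto
      moreover have "combo ?c B2 = combo c2 B2" using disj by (intro sum.cong) auto
      ultimately have "v - combo ?c (B1 \<union> B2) \<in> W" using c2 by (simp only: split) (simp add: algebra_simps)
      then show "\<exists>c. v - combo c (B1 \<union> B2) \<in> W" by (rule exI[of _ ?c])
    qed
  qed
qed

lemma fin_quot_chain:
  assumes "subspace W" "subspace V'" "W \<subseteq> V'" "V' \<subseteq> V" "fin_quot V V'" "fin_quot V' W"
  shows "fin_quot V W"
  using quot_basis_chain(1)[OF assms(1-4)] assms(5,6) unfolding fin_quot_def by blast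

lemma quot_dim_chain:
  assumes "subspace W" "subspace V'" "W \<subseteq> V'" "V' \<subseteq> V" "fin_quot V W"
  shows "quot_dim scale V W = quot_dim scale V V' + quot_dim scale V' W"
proof -
  obtain B1 where B1: "quot_basis scale V V' B1"
    using fin_quot_mono[OF assms(1,2,3,5)] unfolding fin_quot_def by blast
  obtain B2 where B2: "quot_basis scale V' W B2"
    using fin_quot_sub[OF assms(1,4,5)] unfolding fin_quot_def by blast
  note * = quot_basis_chain[OF assms(1-4) B1 B2]
  show ?thesis
    using quot_dim_eq[OF assms(1) *(1)] quot_dim_eq[OF assms(2) B1] quot_dim_eq[OF assms(1) B2] *(2) B1 B2
    by (simp add: card_Un_disjoint quot_basis_iff)
qed

lemma quot_dim_0D:
  assumes "subspace W" "fin_quot V W" "quot_dim scale V W = 0"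
  shows "V \<subseteq> W"
proof -
  obtain B where B: "quot_basis scale V W B" using assms(2) unfolding fin_quot_def by blast
  then have "B = {}" using quot_dim_eq[OF assms(1) B] assms(3) by (simp add: quot_basis_iff)
  then show ?thesis using B by (auto simp: quot_basis_iff span_mod_def)
qed

lemma quot_dim_trivial:
  assumes "subspace W" "V \<subseteq> W"
  shows "fin_quot V W" "quot_dim scale V W = 0"
proof -
  have B: "quot_basis scale V W {}" using assms by (auto simp: quot_basis_iff indep_mod_def span_mod_def)
  then show "fin_quot V W" by (auto simp: fin_quot_def)
  show "quot_dim scale V W = 0" using quot_dim_eq[OF assms(1) B] by simp
qed

end

text \<open>A linear map inducing an isomorphism of \<open>V/W\<close> with \<open>V'/W'\<close>. Together with additivity along
  chains of subspaces this takes the place of exact sequences.\<close>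

lemma quot_dim_transport:
  assumes c1: "cvs s1" and c2: "cvs s2"
    and V: "module.subspace s1 V" and W: "module.subspace s1 W" and W': "module.subspace s2 W'"
    and add: "\<And>x y. T (x + y) = T x + T y"
    and scl: "\<And>c x. T (s1 c x) = s2 c (T x)"
    and TV: "\<And>v. v \<in> V \<Longrightarrow> T v \<in> V'"
    and TW: "\<And>v. v \<in> V \<Longrightarrow> T v \<in> W' \<longleftrightarrow> v \<in> W"
    and srj: "\<And>v'. v' \<in> V' \<Longrightarrow> \<exists>v\<in>V. T v - v' \<in> W'"
    and f: "cvs.fin_quot s1 V W"
  shows "cvs.fin_quot s2 V' W'" "quot_dim s2 V' W' = quot_dim s1 V W"
proof -
  interpret A: cvs s1 by fact
  interpret B: cvs s2 by fact
  have T0: "T 0 = 0" using add[of 0 0] by simp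
  have Tm: "T (- x) = - T x" for x using add[of x "- x"] T0 by (simp add: add_eq_0_iff)
  have Td: "T (x - y) = T x - T y" for x y using add[of x "- y"] by (simp add: Tm)
  have Ts: "T (\<Sum>x\<in>A. g x) = (\<Sum>x\<in>A. T (g x))" for A and g :: "'c \<Rightarrow> 'a"
    by (induction A rule: infinite_finite_induct) (auto simp: T0 add)
  obtain B where B: "finite B" "B \<subseteq> V" "A.indep_mod W B" "A.span_mod V W B"
    using f by (auto simp: A.fin_quot_def A.quot_basis_iff)
  have inj: "inj_on T B"
  proof (rule inj_onI)
    fix x y assume xy: "x \<in> B" "y \<in> B" "T x = T y"
    then have "T (x - y) \<in> W'" using B.subspace_0[OF W'] by (simp add: Td)
    moreover have "x - y \<in> V" using A.subspace_diff[OF V] B xy by blast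
    ultimately have "x - y \<in> W" using TW by blast
    then show "x = y" using A.indep_mod_distinct[OF B(3,1)] xy by blast
  qed
  have cmb: "T (A.combo (\<lambda>x. c (T x)) B) = B.combo c (T ` B)" for c
    by (simp add: Ts scl sum.reindex[OF inj])
  have qb: "quot_basis s2 V' W' (T ` B)"
    unfolding B.quot_basis_iff
  proof (intro conjI)
    show "finite (T ` B)" "T ` B \<subseteq> V'" using B TV by auto
    show "B.indep_mod W' (T ` B)"
      unfolding B.indep_mod_def
    proof (intro allI impI)
      fix c assume "B.combo c (T ` B) \<in> W'"
      then have "A.combo (\<lambda>x. c (T x)) B \<in> W"
        using TW[OF A.combo_in[OF V B(2), of "\<lambda>x. c (T x)"]] by (simp only: cmb)
      then show "\<forall>b\<in>T ` B. c b = 0" using A.indep_modD[OF B(3), of "\<lambda>x. c (T x)"] by blast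
    qed
    show "B.span_mod V' W' (T ` B)"
      unfolding B.span_mod_def
    proof
      fix v' assume "v' \<in> V'"
      then obtain v where v: "v \<in> V" "T v - v' \<in> W'" using srj by blast
      then obtain c where c: "v - A.combo c B \<in> W" using B(4) unfolding A.span_mod_def by blast
      let ?c = "\<lambda>y. c (inv_into B T y)"
      have e: "A.combo (\<lambda>x. ?c (T x)) B = A.combo c B"
        using inj by (intro sum.cong) auto
      have "v - A.combo c B \<in> V" by (rule A.subspace_diff[OF V v(1) A.combo_in[OF V B(2)]])
      from TW[OF this] c have "T (v - A.combo c B) \<in> W'" by simp
      moreover have "T (A.combo c B) = B.combo ?c (T ` B)" using cmb[of ?c] by (simp only: e)
      ultimately have "T v - B.combo ?c (T ` B) \<in> W'" by (simp only: Td)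
      have "v' - B.combo ?c (T ` B) = (T v - B.combo ?c (T ` B)) - (T v - v')" by simp
      also have "\<dots> \<in> W'" by (rule B.subspace_diff[OF W']) fact+
      finally show "\<exists>c. v' - B.combo c (T ` B) \<in> W'" by (rule exI[of _ ?c])
    qed
  qed
  then show "B.fin_quot V' W'" by (auto simp: B.fin_quot_def)
  have "quot_basis s1 V W B" using B by (simp add: A.quot_basis_iff)
  then show "quot_dim s2 V' W' = quot_dim s1 V W"
    using A.quot_dim_eq[OF W] B.quot_dim_eq[OF W' qb] card_image[OF inj] by simp
qed

text \<open>Finiteness also passes from the target to the source: lifts of representatives of a basis still
  span modulo \<open>W\<close>.\<close>

lemma fin_quot_pullback:
  assumes c1: "cvs s1" and c2: "cvs s2"
    and V: "module.subspace s1 V" and W: "module.subspace s1 W" and W': "module.subspace s2 W'"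
    and add: "\<And>x y. T (x + y) = T x + T y"
    and scl: "\<And>c x. T (s1 c x) = s2 c (T x)"
    and TV: "\<And>v. v \<in> V \<Longrightarrow> T v \<in> V'"
    and TW: "\<And>v. v \<in> V \<Longrightarrow> T v \<in> W' \<longleftrightarrow> v \<in> W"
    and srj: "\<And>v'. v' \<in> V' \<Longrightarrow> \<exists>v\<in>V. T v - v' \<in> W'"
    and f: "cvs.fin_quot s2 V' W'"
  shows "cvs.fin_quot s1 V W"
proof -
  interpret A: cvs s1 by fact
  interpret B: cvs s2 by fact
  have T0: "T 0 = 0" using add[of 0 0] by simp
  have Tm: "T (- x) = - T x" for x using add[of x "- x"] T0 by (simp add: add_eq_0_iff)
  have Td: "T (x - y) = T x - T y" for x y using add[of x "- y"] by (simp add: Tm)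
  have Ts: "T (\<Sum>x\<in>A. g x) = (\<Sum>x\<in>A. T (g x))" for A and g :: "'d \<Rightarrow> 'a"
    by (induction A rule: infinite_finite_induct) (auto simp: T0 add)
  obtain B where B: "finite B" "B \<subseteq> V'" "B.indep_mod W' B" "B.span_mod V' W' B"
    using f by (auto simp: B.fin_quot_def B.quot_basis_iff)
  have "\<forall>x. \<exists>v. x \<in> B \<longrightarrow> v \<in> V \<and> T v - x \<in> W'" using srj B(2) by blast
  then obtain g where g: "\<And>x. x \<in> B \<Longrightarrow> g x \<in> V" "\<And>x. x \<in> B \<Longrightarrow> T (g x) - x \<in> W'" by metis
  have inj: "inj_on g B"
  proof (rule inj_onI)
    fix x y assume xy: "x \<in> B" "y \<in> B" "g x = g y"
    have "x - y = (T (g y) - y) - (T (g x) - x)" using xy by simp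
    then have "x - y \<in> W'" using B.subspace_diff[OF W'] g(2) xy by metis
    then show "x = y" using B.indep_mod_distinct[OF B(3,1)] xy by blast
  qed
  have "A.span_mod V W (g ` B)"
    unfolding A.span_mod_def
  proof
    fix v assume v: "v \<in> V"
    obtain c where c: "T v - B.combo c B \<in> W'" using B(4) TV[OF v] unfolding B.span_mod_def by blast
    let ?c = "\<lambda>y. c (inv_into B g y)"
    have e: "A.combo ?c (g ` B) = (\<Sum>x\<in>B. s1 (c x) (g x))"
      unfolding sum.reindex[OF inj] using inj by (intro sum.cong) auto
    have gV: "(\<Sum>x\<in>B. s1 (c x) (g x)) \<in> V"
      by (intro A.subspace_sum[OF V] A.subspace_scale[OF V] g)
    have d: "(\<Sum>x\<in>B. s2 (c x) (T (g x) - x)) \<in> W'"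
      by (intro B.subspace_sum[OF W'] B.subspace_scale[OF W'] g)
    have "T (v - (\<Sum>x\<in>B. s1 (c x) (g x))) = (T v - B.combo c B) - (\<Sum>x\<in>B. s2 (c x) (T (g x) - x))"
      by (simp add: Td Ts scl B.scale_right_diff_distrib sum_subtractf)
    then have "T (v - (\<Sum>x\<in>B. s1 (c x) (g x))) \<in> W'" using B.subspace_diff[OF W' c d] by simp
    then have "v - (\<Sum>x\<in>B. s1 (c x) (g x)) \<in> W" using TW A.subspace_diff[OF V v gV] by blast
    then show "\<exists>c. v - A.combo c (g ` B) \<in> W" unfolding e[symmetric] by (rule exI[of _ ?c])
  qed
  then show ?thesis using g B by (intro A.fin_quot_of_span_mod[OF W, of "g ` B"]) auto
qed

context cvs
begin

text \<open>The Chinese remainder theorem for two subspaces.\<close>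

lemma quot_dim_Int:
  assumes V: "subspace V" and A: "subspace A" "A \<subseteq> V" and B: "subspace B" "B \<subseteq> V"
    and AB: "\<And>v. v \<in> V \<Longrightarrow> \<exists>a\<in>A. a - v \<in> B" and f: "fin_quot V (A \<inter> B)"
  shows "quot_dim scale V (A \<inter> B) = quot_dim scale V A + quot_dim scale V B"
proof -
  have I: "subspace (A \<inter> B)" by (rule subspace_inter[OF A(1) B(1)])
  have "quot_dim scale V (A \<inter> B) = quot_dim scale V A + quot_dim scale A (A \<inter> B)"
    by (rule quot_dim_chain[OF I A(1) _ A(2) f]) auto
  also have "quot_dim scale V B = quot_dim scale A (A \<inter> B)"
  proof (rule quot_dim_transport(2)[where T = "\<lambda>x. x"])
    show "fin_quot A (A \<inter> B)" by (rule fin_quot_sub[OF I A(2) f])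
  qed (use A B I AB cvs_axioms in auto)
  ultimately show ?thesis by simp
qed

end

subsection \<open>The vector spaces that occur\<close>

definition mscale :: "complex \<Rightarrow> 'n mpoly \<Rightarrow> 'n mpoly" where
  "mscale c p = const c * p"

interpretation mp: cvs "mscale :: complex \<Rightarrow> 'n mpoly \<Rightarrow> 'n mpoly"
  by unfold_locales (auto simp: mscale_def algebra_simps const.map_add const.map_mult)

interpretation up: cvs "smult :: complex \<Rightarrow> complex poly \<Rightarrow> complex poly"
  by unfold_locales (auto simp: smult_add_right smult_add_left)

definition mvscale :: "complex \<Rightarrow> 'n mpoly ^ 'k \<Rightarrow> 'n mpoly ^ 'k" where
  "mvscale c v = const c *s v"

interpretation mv: cvs "mvscale :: complex \<Rightarrow> 'n mpoly ^ 'k \<Rightarrow> 'n mpoly ^ 'k"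
  by unfold_locales (auto simp: mvscale_def vec_eq_iff algebra_simps const.map_add const.map_mult)

definition pvscale :: "complex \<Rightarrow> complex poly ^ 'k \<Rightarrow> complex poly ^ 'k" where
  "pvscale c v = [:c:] *s v"

interpretation pv: cvs "pvscale :: complex \<Rightarrow> complex poly ^ 'k \<Rightarrow> complex poly ^ 'k"
  by unfold_locales (auto simp: pvscale_def vec_eq_iff algebra_simps smult_add_right smult_add_left)

definition emb :: "'a::idom \<Rightarrow> 'a fract" where
  "emb a = Fract a 1"

lemma ring_map_emb: "ring_map (emb :: 'a::idom \<Rightarrow> 'a fract)"
  by unfold_locales (auto simp: emb_def One_fract_def)

interpretation emb: ring_map "emb :: 'a::idom \<Rightarrow> 'a fract"
  by (rule ring_map_emb)

lemma emb_eq_0_iff [simp]: "emb a = 0 \<longleftrightarrow> a = 0"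
  by (simp add: emb_def Zero_fract_def eq_fract)

lemma emb_eq_iff: "emb a = emb b \<longleftrightarrow> a = b"
  by (simp add: emb_def eq_fract)

lemma Fract_emb: "Fract a b = emb a / emb b"
  by (simp add: emb_def)

definition fscale :: "complex \<Rightarrow> 2 mpoly fract \<Rightarrow> 2 mpoly fract" where
  "fscale c x = Fract (const c) 1 * x"

lemma fscale_emb: "fscale c x = emb (const c) * x"
  by (simp add: fscale_def emb_def)

interpretation fv: cvs fscale
  by unfold_locales (auto simp: fscale_emb algebra_simps const.map_add const.map_mult emb.map_add emb.map_mult)

subsection \<open>Dimensions of spaces of forms\<close>

text \<open>Binary forms of degree \<open>k\<close>, dehomogenized.\<close>

definition bform :: "int \<Rightarrow> complex poly set" where
  "bform k = {p. p = 0 \<or> int (degree p) \<le> k}"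

lemma bform_iff: "p \<in> bform k \<longleftrightarrow> (\<forall>i. int i > k \<longrightarrow> coeff p i = 0)"
proof
  show "p \<in> bform k \<Longrightarrow> \<forall>i. int i > k \<longrightarrow> coeff p i = 0"
    by (cases "p = 0") (auto simp: bform_def intro!: coeff_eq_0)
  assume *: "\<forall>i. int i > k \<longrightarrow> coeff p i = 0"
  then have "p \<noteq> 0 \<Longrightarrow> int (degree p) \<le> k" using leading_coeff_0_iff[of p] by (meson not_le)
  then show "p \<in> bform k" by (auto simp: bform_def)
qed

lemma bform_subspace: "up.subspace (bform k)"
  by (auto simp: up.subspace_def bform_iff)

lemma quot_dim_bform: "up.fin_quot (bform k) {0}" "quot_dim smult (bform k) {0} = nat (k + 1)"
proof -
  let ?B = "(\<lambda>i. monom (1::complex) i) ` {i. int i \<le> k}"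
  have fin: "finite {i. int i \<le> k}" by (rule finite_subset[of _ "{..nat k}"]) auto
  have inj: "inj_on (\<lambda>i. monom (1::complex) i) A" for A
    by (auto intro!: inj_onI dest: arg_cong[of _ _ degree] simp: degree_monom_eq)
  have qb: "quot_basis smult (bform k) {0} ?B"
    unfolding up.quot_basis_iff
  proof (intro conjI)
    have cmb: "up.combo c ?B = (\<Sum>i | int i \<le> k. monom (c (monom 1 i)) i)" for c
      by (simp add: sum.reindex[OF inj] smult_monom)
    show "finite ?B" using fin by simp
    show "?B \<subseteq> bform k" by (auto simp: bform_def degree_monom_eq)
    show "up.indep_mod {0} ?B"
      unfolding up.indep_mod_def
    proof (intro allI impI)
      fix c assume "up.combo c ?B \<in> {0}"
      then have *: "coeff (\<Sum>i | int i \<le> k. monom (c (monom 1 i)) i) j = 0" for j by (simp add: cmb)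
      have "c (monom 1 j) = 0" if "int j \<le> k" for j using *[of j] fin that by (simp add: coeff_sum)
      then show "\<forall>b\<in>?B. c b = 0" by auto
    qed
    show "up.span_mod (bform k) {0} ?B"
      unfolding up.span_mod_def
    proof
      fix v assume v: "v \<in> bform k"
      have "v = up.combo (\<lambda>b. coeff v (degree b)) ?B"
        using v fin by (intro poly_eqI) (auto simp: cmb coeff_sum degree_monom_eq bform_iff)
      then show "\<exists>c. v - up.combo c ?B \<in> {0}" by auto
    qed
  qed
  then show "up.fin_quot (bform k) {0}" by (auto simp: up.fin_quot_def)
  have "card {i. int i \<le> k} = nat (k + 1)"
  proof (cases "k < 0")
    case False
    then have "{i. int i \<le> k} = {..nat k}" by auto
    then show ?thesis using False by simp
  qed auto
  then show "quot_dim smult (bform k) {0} = nat (k + 1)"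
    using up.quot_dim_eq[OF _ qb] card_image[OF inj] by (simp add: up.subspace_single_0)
qed

lemma homog_subspace: "mp.subspace (homog k)"
  by (auto simp: mp.subspace_def mscale_def intro: homog_add homog_cmult)

lemma homog_rest: "invertible w \<Longrightarrow> p \<in> homog k \<Longrightarrow> rest w p \<in> bform k"
proof (cases "k < 0")
  case False
  assume "invertible w" "p \<in> homog k"
  then show ?thesis using frame_decomp(1)[of w p "nat k"] False by (auto simp: bform_def)
qed (auto simp: bform_def dest: homog_neg)

lemma rest_onto: "invertible w \<Longrightarrow> q \<in> bform k \<Longrightarrow> \<exists>p\<in>homog k. rest w p = q"
proof (cases "q = 0")
  case False
  assume "invertible w" "q \<in> bform k"
  then show ?thesis using rest_surj[of w q "nat k"] False by (auto simp: bform_def)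
qed (auto intro: bexI[of _ 0])

text \<open>The Hilbert function of the polynomial ring in three variables, on all integers.\<close>

definition hdim :: "int \<Rightarrow> int" where
  "hdim k = (if k < 0 then 0 else (k + 1) * (k + 2) div 2)"

lemma hdim_rec: "hdim k = hdim (k - 1) + int (nat (k + 1))"
proof (cases "k < 0")
  case False
  have "(k + 1) * (k + 2) = k * (k + 1) + 2 * (k + 1)" by algebra
  then have *: "(k + 1) * (k + 2) div 2 = k * (k + 1) div 2 + (k + 1)" by simp
  show ?thesis
  proof (cases "k = 0")
    case False
    then have "hdim (k - 1) = k * (k + 1) div 2" using \<open>\<not> k < 0\<close> by (simp add: hdim_def add.commute)
    then show ?thesis using * \<open>\<not> k < 0\<close> by (simp add: hdim_def)
  qed (simp add: hdim_def)
qed (auto simp: hdim_def)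

lemma rest_ker_iff:
  assumes "invertible w" "p \<in> homog k"
  shows "rest w p = 0 \<longleftrightarrow> p \<in> (\<lambda>q. coord w 3 * q) ` homog (k - 1)"
  using rest_kernel[OF assms] by (auto simp: rest.hom_simps assms(1))

text \<open>Restriction to a line has the multiples of its equation as kernel, so the dimensions satisfy the
  recursion of \<open>hdim\<close>.\<close>

lemma quot_dim_homog:
  "mp.fin_quot (homog k) {0 :: 3 mpoly} \<and> int (quot_dim mscale (homog k) {0 :: 3 mpoly}) = hdim k"
proof (induction "nat (k + 1)" arbitrary: k)
  case 0
  then have "homog k \<subseteq> {0 :: 3 mpoly}" using homog_neg[of _ k] by auto
  then show ?case using mp.quot_dim_trivial[of "{0}" "homog k :: 3 mpoly set"] 0 by (auto simp: hdim_def mp.subspace_single_0)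
next
  case (Suc n)
  have k: "k \<ge> 0" using Suc.hyps by simp
  have w: "invertible (mat 1 :: complex ^ 3 ^ 3)" by (auto simp: invertible_def intro: exI[of _ "mat 1"])
  let ?w = "mat 1 :: complex ^ 3 ^ 3"
  let ?X = "(\<lambda>q. coord ?w 3 * q) ` homog (k - 1)"
  have IH: "mp.fin_quot (homog (k - 1)) {0 :: 3 mpoly}"
    "int (quot_dim mscale (homog (k - 1)) {0 :: 3 mpoly}) = hdim (k - 1)"
    using Suc.hyps(1)[of "k - 1"] Suc.hyps(2) by auto
  have X: "mp.subspace ?X"
    unfolding mp.subspace_def
  proof (intro conjI ballI allI)
    show "0 \<in> ?X" by (rule image_eqI[of _ _ 0]) auto
    show "x + y \<in> ?X" if "x \<in> ?X" "y \<in> ?X" for x y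
      using that by (auto simp: distrib_left[symmetric] intro!: homog_add)
    show "mscale c x \<in> ?X" if "x \<in> ?X" for c x
      using that by (auto simp: mscale_def mult.left_commute[of "const c"] intro!: homog_cmult)
  qed
  have Xk: "?X \<subseteq> homog k" using homog_mult[OF coord_homog, of _ "k - 1"] by auto
  have a: "mp.fin_quot ?X {0}" "quot_dim mscale ?X {0} = quot_dim mscale (homog (k - 1)) {0 :: 3 mpoly}"
    by (rule quot_dim_transport[of mscale mscale "homog (k - 1)" "{0}" "{0}" "\<lambda>q. coord ?w 3 * q"];
        use IH coord_nonzero[OF w] in \<open>auto simp: mp.cvs_axioms homog_subspace X mp.subspace_single_0 mscale_def algebra_simps\<close>)+
  have fkX: "mp.fin_quot (homog k) ?X"
  proof (rule fin_quot_pullback[of mscale smult "homog k" ?X "{0}" "rest ?w"])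
    show "\<And>v. v \<in> homog k \<Longrightarrow> (rest ?w v \<in> {0}) = (v \<in> ?X)" using rest_ker_iff[OF w] by blast
    show "\<And>v'. v' \<in> bform k \<Longrightarrow> \<exists>v\<in>homog k. rest ?w v - v' \<in> {0}" using rest_onto[OF w] by fastforce
  qed (use X quot_dim_bform in \<open>auto simp: mp.cvs_axioms up.cvs_axioms homog_subspace rest.hom_simps homog_rest[OF w] mscale_def up.subspace_single_0\<close>)
  have b: "quot_dim smult (bform k) {0} = quot_dim mscale (homog k) ?X"
  proof (rule quot_dim_transport(2)[of mscale smult "homog k" ?X "{0}" "rest ?w"])
    show "\<And>v. v \<in> homog k \<Longrightarrow> (rest ?w v \<in> {0}) = (v \<in> ?X)" using rest_ker_iff[OF w] by blast
    show "\<And>v'. v' \<in> bform k \<Longrightarrow> \<exists>v\<in>homog k. rest ?w v - v' \<in> {0}" using rest_onto[OF w] by fastforce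
  qed (use fkX X in \<open>auto simp: mp.cvs_axioms up.cvs_axioms homog_subspace rest.hom_simps homog_rest[OF w] mscale_def up.subspace_single_0\<close>)
  have f: "mp.fin_quot (homog k) {0 :: 3 mpoly}"
    by (rule mp.fin_quot_chain[OF _ X _ Xk fkX a(1)]) (auto simp: mp.subspace_single_0 intro: mp.subspace_0[OF X])
  have "quot_dim mscale (homog k) {0 :: 3 mpoly} = quot_dim mscale (homog k) ?X + quot_dim mscale ?X {0}"
    by (rule mp.quot_dim_chain[OF _ X _ Xk f]) (auto simp: mp.subspace_single_0 intro: mp.subspace_0[OF X])
  then have "int (quot_dim mscale (homog k) {0 :: 3 mpoly}) = int (nat (k + 1)) + hdim (k - 1)"
    using a(2) b quot_dim_bform(2)[of k] IH(2) by simp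
  then show ?case using f hdim_rec[of k] by simp
qed

section \<open>Ideals of binary forms without common zeros\<close>

text \<open>By division with remainder, an element of least degree generates the ideal; as the elements of
  the ideal have no common zero, this generator has no root and is constant.\<close>

lemma poly_ideal_one:
  fixes U :: "complex poly set"
  assumes diff: "\<And>p q. p \<in> U \<Longrightarrow> q \<in> U \<Longrightarrow> p - q \<in> U" and mult: "\<And>p q. p \<in> U \<Longrightarrow> q * p \<in> U"
    and nz: "\<And>t. \<exists>p\<in>U. poly p t \<noteq> 0"
  shows "1 \<in> U"
proof -
  obtain p0 where "p0 \<in> U" "p0 \<noteq> 0" using nz[of 0] by fastforce
  then have "\<exists>n. \<exists>h\<in>U. h \<noteq> 0 \<and> degree h = n" by blast
  then have "\<exists>h\<in>U. h \<noteq> 0 \<and> degree h = (LEAST n. \<exists>h\<in>U. h \<noteq> 0 \<and> degree h = n)"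
    by (rule LeastI_ex)
  then obtain h where h: "h \<in> U" "h \<noteq> 0" and hmin: "\<And>q. q \<in> U \<Longrightarrow> q \<noteq> 0 \<Longrightarrow> degree h \<le> degree q"
    by (metis (mono_tags, lifting) Least_le)
  have dv: "h dvd q" if "q \<in> U" for q
  proof -
    have "q mod h = q - (q div h) * h" by (simp add: minus_div_mult_eq_mod)
    then have "q mod h \<in> U" using diff[OF that mult[OF h(1), of "q div h"]] by simp
    then have "q mod h = 0" using hmin[of "q mod h"] degree_mod_less[OF h(2), of q] by fastforce
    then show ?thesis by (simp add: dvd_eq_mod_eq_0)
  qed
  have "degree h = 0"
  proof (rule ccontr)
    assume "degree h \<noteq> 0"
    then obtain t where "poly h t = 0"
      using fundamental_theorem_of_algebra[of h] constant_degree[of h] by auto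
    then have "poly q t = 0" if "q \<in> U" for q using dv[OF that] by (auto elim!: dvdE)
    then show False using nz[of t] by blast
  qed
  then obtain c where c: "h = [:c:]" by (rule degree_eq_zeroE)
  then have "[:1/c:] * h = 1" using h(2) by simp
  then show ?thesis using mult[OF h(1), of "[:1/c:]"] by simp
qed

text \<open>On the projective line an ideal of forms without common zeros contains all forms of large
  degree. Forms are dehomogenized, so that multiplication by the coordinate vanishing at infinity
  becomes the inclusion of \<open>g m\<close> in \<open>g (Suc m)\<close>; a form does not vanish at infinity iff its
  dehomogenization has full degree.\<close>

lemma binary_ideal_eventually_all:
  fixes g :: "nat \<Rightarrow> complex poly set"
  assumes sub: "\<And>m. up.subspace (g m)"
    and inc: "\<And>m. g m \<subseteq> g (Suc m)"
    and tm: "\<And>m p. p \<in> g m \<Longrightarrow> [:0, 1:] * p \<in> g (Suc m)"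
    and fin: "\<And>t. \<exists>m. \<exists>p\<in>g m. poly p t \<noteq> 0"
    and inf: "\<exists>m. \<exists>p\<in>g m. p \<noteq> 0 \<and> degree p = m"
  shows "\<exists>m0. \<forall>m\<ge>m0. \<forall>q. degree q \<le> m \<longrightarrow> q \<in> g m"
proof -
  have mono: "p \<in> g n" if "p \<in> g m" "m \<le> n" for p m n
    using lift_Suc_mono_le[of g, OF inc that(2)] that(1) by blast
  have pw: "monom c i * p \<in> g (m + i)" if "p \<in> g m" for c i p m
  proof (induction i)
    case 0
    then show ?case using up.subspace_scale[OF sub that, of c] by (simp add: monom_0)
  next
    case (Suc i)
    have "monom c (Suc i) * p = [:0, 1:] * (monom c i * p)" by (simp add: monom_Suc)
    then show ?case using tm[OF Suc] by simp
  qed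
  have mul: "q * p \<in> g n" if "p \<in> g m" "m + degree q \<le> n" for p q m n
  proof -
    have "q * p = (\<Sum>i\<le>degree q. monom (coeff q i) i * p)"
      unfolding sum_distrib_right[symmetric] by (simp add: poly_as_sum_of_monoms)
    moreover have "monom (coeff q i) i * p \<in> g n" if "i \<le> degree q" for i
      using mono[OF pw[OF \<open>p \<in> g m\<close>, of "coeff q i" i], of n] that \<open>m + degree q \<le> n\<close> by simp
    ultimately show ?thesis using up.subspace_sum[OF sub, of "{..degree q}"] by simp
  qed
  let ?U = "\<Union>m. g m"
  have Umul: "q * p \<in> ?U" if "p \<in> ?U" for p q using that mul by blast
  have Udiff: "p - q \<in> ?U" if "p \<in> ?U" "q \<in> ?U" for p q
  proof -
    obtain m n where "p \<in> g m" "q \<in> g n" using \<open>p \<in> ?U\<close> \<open>q \<in> ?U\<close> by blast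
    then have "p \<in> g (m + n)" "q \<in> g (m + n)" using mono by auto
    then show ?thesis using up.subspace_diff[OF sub] by blast
  qed
  have "1 \<in> ?U" by (rule poly_ideal_one[OF Udiff Umul]) (use fin in blast)+
  then obtain m1 where m1: "1 \<in> g m1" by blast
  obtain m2 p where p: "p \<in> g m2" "p \<noteq> 0" "degree p = m2" using inf by blast
  have "q \<in> g m" if "m \<ge> m1 + m2" "degree q \<le> m" for m q
    using that(2)
  proof (induction "degree q" arbitrary: q rule: less_induct)
    case less
    show ?case
    proof (cases "m1 + degree q \<le> m")
      case True
      then show ?thesis using mul[OF m1, of q m] by simp
    next
      case False
      let ?e = "degree q"
      have e: "m2 \<le> ?e" "0 < ?e" using False that(1) less.prems by auto
      let ?a = "monom (lead_coeff q / lead_coeff p) (?e - m2)"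
      have ap: "?a * p \<in> g m"
        using mono[OF pw[OF p(1), of _ "?e - m2"], of m] e less.prems by simp
      have q0: "q \<noteq> 0" using e by auto
      have "lead_coeff q / lead_coeff p \<noteq> 0" using p(2) q0 by simp
      then have da: "degree (?a * p) = ?e"
        using p e by (simp add: degree_mult_eq degree_monom_eq monom_eq_0_iff del: divide_eq_0_iff)
      have lc: "coeff (?a * p) ?e = lead_coeff q"
      proof -
        have "coeff p m2 \<noteq> 0" using p(2,3) by auto
        moreover have "\<not> ?e < ?e - m2" "?e - (?e - m2) = m2" using e by auto
        ultimately show ?thesis by (simp add: coeff_monom_mult p(3))
      qed
      have "degree (q - ?a * p) < ?e"
        using lc da e by (intro degree_lessI) (auto simp: coeff_eq_0 le_less)
      then have "q - ?a * p \<in> g m" using less.hyps less.prems by simp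
      then show ?thesis using up.subspace_add[OF sub _ ap] by fastforce
    qed
  qed
  then show ?thesis by blast
qed

section \<open>A line missing the singular points\<close>

text \<open>The following elementary substitute for resultants works in \<open>\<complex>[y][z]\<close>: an element of least
  degree in \<open>z\<close> of the ideal of \<open>F\<close> and \<open>G\<close> divides both up to factors from \<open>\<complex>[y]\<close>, by
  pseudo-division.\<close>

lemma common_factor_or_elimination:
  fixes F G :: "complex poly poly"
  assumes F: "F \<noteq> 0"
  shows "(\<exists>a b r. r \<noteq> 0 \<and> a * F + b * G = [:r:]) \<or>
    (\<exists>p. prime_elem p \<and> degree p > 0 \<and> p dvd F \<and> p dvd G)"
proof -
  define I where "I = {a * F + b * G | a b. True}"
  have FI: "F \<in> I" unfolding I_def by (rule CollectI) (metis add.right_neutral mult_1 mult_zero_left)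
  have GI: "G \<in> I" unfolding I_def by (rule CollectI) (metis add_0 mult_1 mult_zero_left)
  have Id: "c * x - q * y \<in> I" if xy: "x \<in> I" "y \<in> I" for x y c q
  proof -
    obtain a b where "x = a * F + b * G" using xy(1) by (auto simp: I_def)
    moreover obtain a' b' where "y = a' * F + b' * G" using xy(2) by (auto simp: I_def)
    ultimately have "c * x - q * y = (c * a - q * a') * F + (c * b - q * b') * G" by (simp add: algebra_simps)
    then show ?thesis unfolding I_def by blast
  qed
  have "\<exists>n. \<exists>h\<in>I. h \<noteq> 0 \<and> degree h = n" using FI F by blast
  then have "\<exists>h\<in>I. h \<noteq> 0 \<and> degree h = (LEAST n. \<exists>h\<in>I. h \<noteq> 0 \<and> degree h = n)"
    by (rule LeastI_ex)
  then obtain h where h: "h \<in> I" "h \<noteq> 0" and hmin: "\<And>q. q \<in> I \<Longrightarrow> q \<noteq> 0 \<Longrightarrow> degree h \<le> degree q"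
    by (metis (mono_tags, lifting) Least_le)
  have dv: "\<exists>c. c \<noteq> 0 \<and> h dvd [:c:] * x" if "x \<in> I" for x
  proof -
    obtain c q where cq: "c \<noteq> 0" "smult c x = h * q + pseudo_mod x h" using pseudo_mod(1)[OF h(2)] by blast
    then have "pseudo_mod x h = [:c:] * x - q * h" by (simp add: algebra_simps)
    then have "pseudo_mod x h \<in> I" using Id[OF that h(1)] by (simp only:)
    then have "pseudo_mod x h = 0" using hmin[of "pseudo_mod x h"] pseudo_mod(2)[OF h(2), of x] by fastforce
    then show ?thesis using cq by (intro exI[of _ c]) (auto simp: dvd_def)
  qed
  show ?thesis
  proof (cases "degree h = 0")
    case True
    then obtain r where r: "h = [:r:]" by (rule degree_eq_zeroE)
    obtain a b where "h = a * F + b * G" using h(1) by (auto simp: I_def)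
    then show ?thesis using h(2) r by (intro disjI1 exI[of _ a] exI[of _ b] exI[of _ r]) auto
  next
    case False
    obtain A where A: "\<And>x. x \<in># A \<Longrightarrow> prime_elem x" "normalize (prod_mset A) = normalize h"
      using prime_factorization_exists[OF h(2)] by blast
    have dA: "prod_mset A dvd h" "h dvd prod_mset A" using A(2) by (auto simp: associated_iff_dvd)
    have A0: "prod_mset A \<noteq> 0" using dA h(2) by auto
    have "\<exists>p\<in>#A. degree p > 0"
    proof (rule ccontr)
      assume neg: "\<not> (\<exists>p\<in>#A. degree p > 0)"
      have "degree (prod_mset B) = 0" if "\<forall>p\<in>#B. degree p = 0" for B :: "complex poly poly multiset"
        using that
      proof (induction B)
        case (add x B)
        then show ?case using degree_mult_le[of x "prod_mset B"] by simp
      qed simp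
      then have "degree (prod_mset A) = 0" using neg by simp
      then show False using dvd_imp_degree_le[OF dA(2) A0] False by simp
    qed
    then obtain p where p: "p \<in># A" "degree p > 0" by blast
    have pr: "prime_elem p" and ph: "p dvd h" using A(1)[OF p(1)] dvd_trans[OF dvd_prod_mset[OF p(1)] dA(1)] by auto
    have "p dvd x" if xI: "x \<in> I" for x
    proof -
      obtain c where c: "c \<noteq> 0" "h dvd [:c:] * x" using dv[OF xI] by blast
      then have "p dvd [:c:] \<or> p dvd x" using prime_elem_dvd_mult_iff[OF pr] dvd_trans[OF ph] by blast
      moreover have "\<not> p dvd [:c:]" using dvd_imp_degree_le[of p "[:c:]"] c(1) p(2) by auto
      ultimately show ?thesis by blast
    qed
    then show ?thesis using pr p(2) FI GI by blast
  qed
qed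

text \<open>Dehomogenization by \<open>coord w 1 = 1\<close>, as a polynomial in \<open>z\<close> over \<open>\<complex>[y]\<close>, to which pseudo-division
  with respect to \<open>z\<close> applies.\<close>

definition bidehom :: "complex ^ 3 ^ 3 \<Rightarrow> 3 mpoly \<Rightarrow> complex poly poly" where
  "bidehom w p = subst (\<lambda>c. [:[:c:]:]) (\<lambda>i. [:[:w $ 1 $ i, w $ 2 $ i:], [:w $ 3 $ i:]:]) p"

lemma ring_map_ppconst: "ring_map (\<lambda>c. [:[:c:]:])"
  by unfold_locales (auto simp: algebra_simps one_pCons)

interpretation bi: ring_map "bidehom w" for w
  unfolding bidehom_def by (rule ring_map_subst(1)[OF ring_map_ppconst])

lemma bidehom_const [simp]: "bidehom w (const c) = [:[:c:]:]"
  unfolding bidehom_def by (rule ring_map_subst(2)[OF ring_map_ppconst])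

lemma bidehom_var: "bidehom w (var i) = [:[:w $ 1 $ i, w $ 2 $ i:], [:w $ 3 $ i:]:]"
  unfolding bidehom_def by (rule ring_map_subst(3)[OF ring_map_ppconst])

lemma bidehom_coord:
  assumes "invertible w"
  shows "bidehom w (coord w 1) = 1" "bidehom w (coord w 2) = [:[:0, 1:]:]" "bidehom w (coord w 3) = [:0, 1:]"
proof -
  have "bidehom w (coord w j) = (if j = 1 then 1 else if j = 2 then [:[:0, 1:]:] else [:0, 1:])" for j
    unfolding bidehom_def by (rule subst_coord[OF assms ring_map_ppconst]) (simp add: sum_3 one_pCons)
  then show "bidehom w (coord w 1) = 1" "bidehom w (coord w 2) = [:[:0, 1:]:]" "bidehom w (coord w 3) = [:0, 1:]"
    by auto
qed

lemma poly_bidehom: "poly (poly (bidehom w p) [:z:]) y = eval p (w $ 1 + y *s w $ 2 + z *s w $ 3)"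
proof -
  have "ring_map (\<lambda>p. poly (poly (bidehom w p) [:z:]) y)"
    by unfold_locales (auto simp: bi.hom_simps)
  from this eval.ring_map_axioms show ?thesis
    by (rule ring_map_eqI[of "\<lambda>p. poly (poly (bidehom w p) [:z:]) y"]) (auto simp: bidehom_var algebra_simps)
qed

lemma bidehom_inj:
  assumes w: "invertible w" and p: "p \<in> homog k" "bidehom w p = 0"
  shows "p = 0"
proof (rule dehom_inj[OF w bi.ring_map_axioms _ _ _ p])
  show s: "ring_map (\<lambda>P. poly P 0 :: complex poly)" by unfold_locales auto
  show "poly (bidehom w p) 0 = rest w p" for p
    by (rule ring_map_eqI[of "\<lambda>p. poly (bidehom w p) 0" "rest w"])
       (auto simp: ring_map_comp[OF s bi.ring_map_axioms] rest.ring_map_axioms bidehom_var rest_var)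
  show "bidehom w (coord w 3) \<noteq> 0" by (simp add: bidehom_coord[OF w])
qed

lemma bidehom_surj:
  assumes w: "invertible w"
  shows "\<exists>k. \<exists>G\<in>homog (int k). bidehom w G = P"
proof -
  note ad = dehom_add[OF bi.ring_map_axioms bidehom_coord(1)[OF w]]
  note mu = dehom_mult[OF bi.ring_map_axioms, of w]
  have base: "\<exists>k. \<exists>G\<in>homog (int k). bidehom w G = [:q:]" for q
  proof (induction q rule: pCons_induct)
    case 0
    then show ?case using dehom_const[of "bidehom w" 0] by simp
  next
    case (pCons a q)
    have "[:pCons a q:] = bidehom w (const a) + bidehom w (coord w 2) * [:q:]"
      by (simp add: bidehom_coord[OF w])
    then show ?case using ad[OF dehom_const mu[OF dehom_coord pCons(2)]] by metis
  qed
  show ?thesis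
  proof (induction P rule: pCons_induct)
    case 0
    then show ?case using dehom_const[of "bidehom w" 0] by simp
  next
    case (pCons q P)
    have "pCons q P = [:q:] + bidehom w (coord w 3) * P"
      by (simp add: bidehom_coord[OF w])
    then show ?case using ad[OF base mu[OF dehom_coord pCons(2)]] by metis
  qed
qed

lemma pderiv_bidehom:
  "pderiv (bidehom w p) = (\<Sum>i\<in>UNIV. [:[:w $ 3 $ i:]:] * bidehom w (pdiff i p))"
proof (induction p rule: mpoly_induct)
  case (const c)
  show ?case by (simp add: pderiv_pCons)
next
  case (var i)
  have "(\<Sum>j\<in>UNIV. [:[:w $ 3 $ j:]:] * bidehom w (pdiff j (var i))) =
        (\<Sum>j\<in>UNIV. if j = i then [:[:w $ 3 $ j:]:] else 0)"
    by (intro sum.cong) (auto simp: pdiff_var)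
  then show ?case by (simp add: bidehom_var pderiv_pCons)
next
  case (add p q)
  then show ?case by (simp add: bi.map_add pdiff_add pderiv_add distrib_left sum.distrib)
next
  case (mult p q)
  have "pderiv (bidehom w (p * q)) = bidehom w p * pderiv (bidehom w q) + bidehom w q * pderiv (bidehom w p)"
    by (simp add: bi.map_mult pderiv_mult)
  then show ?case unfolding mult
    by (simp add: bi.map_mult bi.map_add pdiff_mult distrib_left sum.distrib sum_distrib_left algebra_simps
      del: mult_pCons_left mult_pCons_right)
qed

text \<open>The transposition exchanging the first and the last vector of a frame turns statements on
  \<open>coord w 3\<close> into statements on \<open>coord w 1\<close>.\<close>

lemma exchange_first_last:
  assumes w: "invertible w"
  obtains w' where "invertible w'" "coord w' 3 = coord w 1"
proof
  let ?\<sigma> = "\<lambda>i::3. if i = 1 then 3 else if i = 3 then 1 else i"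
  have i: "inj ?\<sigma>" by (auto simp: inj_def split: if_splits)
  show "invertible (permute ?\<sigma> w)" "coord (permute ?\<sigma> w) 3 = coord w 1"
    using invertible_permute[OF w i] coord_permute[OF w i, of 3] by auto
qed

text \<open>The multiples of a linear form are the kernel of the restriction to its line, whose target is a
  domain.\<close>

lemma coord1_prime:
  assumes w: "invertible w" and "a \<in> homog k" "b \<in> homog l" "coord w 1 dvd a * b"
  shows "coord w 1 dvd a \<or> coord w 1 dvd b"
proof -
  obtain w' where w': "invertible w'" "coord w' 3 = coord w 1" using exchange_first_last[OF w] .
  show ?thesis
    using assms(4) coord_dvd_iff[OF w'(1) homog_mult[OF assms(2,3)]] coord_dvd_iff[OF w'(1) assms(2)]
      coord_dvd_iff[OF w'(1) assms(3)] by (simp add: w'(2) rest.map_mult)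
qed

lemma coord1_quotient:
  assumes w: "invertible w" and "a \<in> homog k" "coord w 1 dvd a"
  shows "\<exists>b\<in>homog (k - 1). a = coord w 1 * b"
proof -
  obtain w' where w': "invertible w'" "coord w' 3 = coord w 1" using exchange_first_last[OF w] .
  show ?thesis
    using assms(3) coord_dvd_iff[OF w'(1) assms(2)] rest_kernel[OF w'(1) assms(2)] by (simp add: w'(2))
qed

text \<open>A homogenization of least degree cannot be divisible by the form that becomes \<open>1\<close>, as that factor
  could be cancelled.\<close>

lemma minimal_homogenization:
  assumes w: "invertible w" and P: "P \<noteq> 0"
  shows "\<exists>k. \<exists>G\<in>homog (int k). bidehom w G = P \<and> \<not> coord w 1 dvd G"
proof -
  define e where "e = (LEAST k. \<exists>G\<in>homog (int k). bidehom w G = P)"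
  obtain G where G: "G \<in> homog (int e)" "bidehom w G = P"
    using LeastI_ex[OF bidehom_surj[OF w, of P]] unfolding e_def by blast
  have "\<not> coord w 1 dvd G"
  proof
    assume "coord w 1 dvd G"
    then obtain H where H: "H \<in> homog (int e - 1)" "G = coord w 1 * H" using coord1_quotient[OF w G(1)] by blast
    then have HP: "bidehom w H = P" using G(2) by (simp add: bi.map_mult bidehom_coord[OF w])
    have "e \<noteq> 0"
    proof
      assume "e = 0"
      then have "H = 0" using homog_neg[OF H(1)] by simp
      then show False using HP P by simp
    qed
    then have "H \<in> homog (int (e - 1))" using H(1) by (simp add: of_nat_diff)
    then have "e \<le> e - 1" unfolding e_def using HP by (intro Least_le) blast
    then show False using \<open>e \<noteq> 0\<close> by simp
  qed
  then show ?thesis using G by blast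
qed

text \<open>Homogenize \<open>p\<close> and \<open>q\<close> minimally, to \<open>A\<close> and \<open>B\<close>. As \<open>coord w 1\<close> is prime, it does not divide
  \<open>A\<^sup>2 B\<close>, so \<open>f\<close> is \<open>A\<^sup>2 B\<close> times a power of \<open>coord w 1\<close>, and \<open>A\<^sup>2\<close> divides \<open>f\<close>.\<close>

lemma squarefree_bidehom:
  assumes w: "invertible w" and f: "f \<in> homog (int d)" "squarefree f" and pq: "bidehom w f = p * p * q"
  shows "p dvd 1"
proof -
  have f0: "f \<noteq> 0" using f(2) by auto
  then have F0: "bidehom w f \<noteq> 0" using bidehom_inj[OF w f(1)] by blast
  then have "p \<noteq> 0" "q \<noteq> 0" using pq by auto
  then obtain a b A B where A: "A \<in> homog (int a)" "bidehom w A = p" "\<not> coord w 1 dvd A"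
    and B: "B \<in> homog (int b)" "bidehom w B = q" "\<not> coord w 1 dvd B"
    using minimal_homogenization[OF w] by meson
  let ?G = "A * A * B"
  have G: "?G \<in> homog (int (a + a + b))" using homog_mult[OF homog_mult[OF A(1) A(1)] B(1)] by simp
  have ndvd: "\<not> coord w 1 dvd ?G"
    using coord1_prime[OF w homog_mult[OF A(1) A(1)] B(1)] coord1_prime[OF w A(1) A(1)] A(3) B(3) by blast
  have Gf: "bidehom w ?G = bidehom w f" by (simp add: bi.map_mult A(2) B(2) pq)
  have le: "a + a + b \<le> d"
  proof (rule ccontr)
    assume nle: "\<not> ?thesis"
    let ?n = "a + a + b - d"
    have "coord w 1 ^ ?n * f \<in> homog (int (a + a + b))"
      using homog_mult[OF homog_power1[OF coord_homog[of w 1]] f(1), of ?n] nle by simp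
    from homog_diff[OF G this] have "?G - coord w 1 ^ ?n * f = 0"
    proof (rule bidehom_inj[OF w])
      show "bidehom w (?G - coord w 1 ^ ?n * f) = 0"
        unfolding bi.map_diff Gf by (simp add: bi.hom_simps bidehom_coord[OF w])
    qed
    moreover have "coord w 1 dvd coord w 1 ^ ?n * f" using nle by (intro dvd_mult2 dvd_power) auto
    ultimately show False using ndvd by simp
  qed
  let ?n = "d - (a + a + b)"
  have "coord w 1 ^ ?n * ?G \<in> homog (int d)"
    using homog_mult[OF homog_power1[OF coord_homog[of w 1]] G, of ?n] le by simp
  from homog_diff[OF f(1) this] have "f - coord w 1 ^ ?n * ?G = 0"
  proof (rule bidehom_inj[OF w])
    show "bidehom w (f - coord w 1 ^ ?n * ?G) = 0"
      unfolding bi.map_diff Gf[symmetric] by (simp add: bi.hom_simps bidehom_coord[OF w])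
  qed
  then have "f = A ^ 2 * (B * coord w 1 ^ ?n)" by (simp add: power2_eq_square algebra_simps)
  then have "A ^ 2 dvd f" by (rule dvdI)
  then have "A dvd 1" using f(2) by (simp add: squarefree_def)
  then obtain C where "1 = A * C" by (auto elim: dvdE)
  then have "1 = p * bidehom w C" using bi.map_mult[of w A C] A(2) by simp
  then show ?thesis by (rule dvdI)
qed

lemma homog_nonvanishing:
  assumes "p \<in> homog k" "p \<noteq> (0 :: 3 mpoly)"
  shows "\<exists>v. eval p v \<noteq> 0"
proof -
  have w: "invertible (mat 1 :: complex ^ 3 ^ 3)" by (auto simp: invertible_def intro: exI[of _ "mat 1"])
  have "bidehom (mat 1) p \<noteq> 0" using bidehom_inj[OF w assms(1)] assms(2) by blast
  then have fin: "finite {x. poly (bidehom (mat 1) p) x = 0}" by (rule poly_roots_finite)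
  have "\<not> finite (range (\<lambda>z::complex. [:z:]))"
    using infinite_UNIV_char_0 by (auto simp: finite_image_iff inj_def)
  then obtain z where "poly (bidehom (mat 1) p) [:z:] \<noteq> 0"
    using finite_subset[OF _ fin, of "range (\<lambda>z. [:z:])"] by blast
  then have "finite {x. poly (poly (bidehom (mat 1) p) [:z:]) x = 0}" by (rule poly_roots_finite)
  then have "\<exists>y. poly (poly (bidehom (mat 1) p) [:z:]) y \<noteq> 0"
    using infinite_UNIV_char_0[where ?'a = complex] by (metis (mono_tags, lifting) UNIV_eq_I mem_Collect_eq)
  then show ?thesis unfolding poly_bidehom by blast
qed

lemma singular_imp_on_curve:
  assumes f: "f \<in> homog (int d)" and "d \<ge> 1" and sing: "\<And>i. eval (pdiff i f) v = 0"
  shows "eval f v = 0"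
proof -
  have "eval (\<Sum>i\<in>UNIV. var i * pdiff i f) v = 0"
    by (simp add: eval.hom_simps sing)
  then show ?thesis using \<open>d \<ge> 1\<close> by (simp add: euler_identity[OF f] eval.map_mult)
qed

text \<open>Project the curve from a point \<open>v3\<close> outside it. In suitable coordinates the curve is \<open>F(y, z) = 0\<close>
  and the lines through \<open>v3\<close> are \<open>y = const\<close>. As \<open>F\<close> is squarefree, some combination of \<open>F\<close> and
  \<open>\<partial>F/\<partial>z\<close> is a nonzero polynomial \<open>r(y)\<close>; on a line \<open>y = const\<close> with \<open>r(y) \<noteq> 0\<close> there is no
  singular point.\<close>

theorem line_missing_singularities:
  assumes f: "f \<in> homog (int d)" and d: "d \<ge> 1" and sqf: "squarefree f"
  shows "\<exists>w. invertible w \<and> (\<forall>v. v \<noteq> 0 \<longrightarrow> eval (coord w 3) v = 0 \<longrightarrow> (\<exists>i. eval (pdiff i f) v \<noteq> 0))"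
proof -
  have f0: "f \<noteq> 0" using sqf by auto
  obtain v3 where v3: "eval f v3 \<noteq> 0" using homog_nonvanishing[OF f f0] by blast
  have "v3 \<noteq> 0" using v3 eval_scale[OF f, of 0 v3] d by (auto simp: power_0_left)
  then obtain w1 :: "complex ^ 3 ^ 3" where w1: "invertible w1" "w1 $ 1 = v3" using frame_through by blast
  let ?\<sigma> = "\<lambda>i::3. if i = 1 then 3 else if i = 3 then 1 else i"
  have i: "inj ?\<sigma>" by (auto simp: inj_def split: if_splits)
  define w where "w = permute ?\<sigma> w1"
  have w: "invertible w" "w $ 3 = v3" using invertible_permute[OF w1(1) i] w1(2) by (auto simp: w_def)
  let ?F = "bidehom w f"
  have F0: "?F \<noteq> 0" using bidehom_inj[OF w(1) f] f0 by blast
  have "\<nexists>p. prime_elem p \<and> degree p > 0 \<and> p dvd ?F \<and> p dvd pderiv ?F"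
  proof
    assume "\<exists>p. prime_elem p \<and> degree p > 0 \<and> p dvd ?F \<and> p dvd pderiv ?F"
    then obtain p q where p: "prime_elem p" "degree p > 0" "?F = p * q" "p dvd pderiv ?F"
      by (auto elim!: dvdE)
    \<comment> \<open>A common prime factor of \<open>F\<close> and its derivative is a double factor, as \<open>\<partial>p/\<partial>z\<close> is nonzero of
      smaller degree in characteristic zero.\<close>
    have "pderiv ?F = p * pderiv q + q * pderiv p" using p(3) by (simp add: pderiv_mult)
    then have "p dvd q * pderiv p" using p(4) by (simp add: dvd_add_right_iff)
    moreover have "\<not> p dvd pderiv p"
      using dvd_imp_degree_le[of p "pderiv p"] p(2) by (auto simp: degree_pderiv pderiv_eq_0_iff)
    ultimately have "p dvd q" using prime_elem_dvd_mult_iff[OF p(1)] by blast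
    then obtain r where "q = p * r" by (auto elim: dvdE)
    then have "p dvd 1" using squarefree_bidehom[OF w(1) f sqf, of p r] p(3) by (simp add: mult.assoc)
    then show False using p(1) by (auto simp: prime_elem_def)
  qed
  then obtain a b r where r: "r \<noteq> 0" "a * ?F + b * pderiv ?F = [:r:]"
    using common_factor_or_elimination[OF F0, of "pderiv ?F"] by blast
  have "finite {y. poly r y = 0}" using r(1) by (rule poly_roots_finite)
  then obtain y where y: "poly r y \<noteq> 0"
    using infinite_UNIV_char_0[where ?'a = complex] by (metis (mono_tags, lifting) UNIV_eq_I mem_Collect_eq)
  \<comment> \<open>The third coordinate of this frame vanishes on the chosen line through \<open>v3 = w $ 3\<close>.\<close>
  define u :: "complex ^ 3 ^ 3" where "u = vector [w $ 1 + y *s w $ 2, w $ 3, w $ 2]"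
  have "det u = - det w" by (simp add: u_def det_3 algebra_simps)
  then have u: "invertible u" using w(1) by (simp add: invertible_det_nz)
  have "\<exists>i. eval (pdiff i f) v \<noteq> 0" if v: "v \<noteq> 0" "eval (coord u 3) v = 0" for v
  proof (rule ccontr)
    assume "\<not> ?thesis"
    then have sing: "\<And>i. eval (pdiff i f) v = 0" by blast
    obtain \<alpha> \<beta> where v_eq: "v = \<alpha> *s u $ 1 + \<beta> *s u $ 2"
      using vec_as_rows[OF u, of v] v(2) by (auto simp: sum_3)
    show False
    proof (cases "\<alpha> = 0")
      case True
      then have "\<beta> \<noteq> 0" using v_eq v(1) by auto
      moreover have "v = \<beta> *s v3" using v_eq True w(2) by (simp add: u_def)
      ultimately show False
        using singular_imp_on_curve[OF f d, of v, OF sing] eval_scale[OF f, of \<beta> v3] v3 by simp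
    next
      case False
      define x where "x = w $ 1 + y *s w $ 2 + (\<beta> / \<alpha>) *s w $ 3"
      have vx: "v = \<alpha> *s x"
        using False by (simp add: v_eq x_def u_def vec_eq_iff algebra_simps)
      have pd: "pdiff i f \<in> homog (int (d - 1))" for i using pdiff_homog[OF f, of i] d by (simp add: of_nat_diff)
      have sx: "eval (pdiff i f) x = 0" for i
        using sing[of i] eval_scale[OF pd[of i], of \<alpha> x] False vx by simp
      have fx: "eval f x = 0" by (rule singular_imp_on_curve[OF f d sx])
      have "poly (poly ?F [:\<beta> / \<alpha>:]) y = 0" using fx by (simp add: poly_bidehom x_def)
      moreover have "poly (poly (pderiv ?F) [:\<beta> / \<alpha>:]) y = 0"
        using sx by (simp add: pderiv_bidehom poly_sum poly_bidehom x_def del: mult_pCons_left)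
      moreover have "poly (poly (a * ?F + b * pderiv ?F) [:\<beta> / \<alpha>:]) y = poly r y" by (simp add: r(2))
      ultimately show False using y by simp
    qed
  qed
  then show ?thesis using u by blast
qed

section \<open>The Hilbert function of the Jacobian algebra\<close>

text \<open>The part of degree \<open>m\<close> of the Jacobian ideal of a form \<open>f\<close> of degree \<open>d\<close>.\<close>

definition jac :: "3 mpoly \<Rightarrow> int \<Rightarrow> int \<Rightarrow> 3 mpoly set" where
  "jac f d m = {(\<Sum>i\<in>UNIV. a i * pdiff i f) | a. \<forall>i. a i \<in> homog (m - (d - 1))}"

lemma jacI: "(\<And>i. a i \<in> homog (m - (d - 1))) \<Longrightarrow> (\<Sum>i\<in>UNIV. a i * pdiff i f) \<in> jac f d m"
  by (auto simp: jac_def)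

lemma jac_homog: "f \<in> homog d \<Longrightarrow> jac f d m \<subseteq> homog m"
proof
  fix p assume f: "f \<in> homog d" and "p \<in> jac f d m"
  then obtain a where a: "\<And>i. a i \<in> homog (m - (d - 1))" "p = (\<Sum>i\<in>UNIV. a i * pdiff i f)"
    by (auto simp: jac_def)
  have "a i * pdiff i f \<in> homog m" for i using homog_mult[OF a(1) pdiff_homog[OF f]] by simp
  then show "p \<in> homog m" unfolding a(2) by (intro homog_sum)
qed

lemma jac_subspace: "mp.subspace (jac f d m)"
  unfolding mp.subspace_def
proof (intro conjI ballI allI)
  show "0 \<in> jac f d m" using jacI[of "\<lambda>_. 0" m d f] by simp
next
  fix x y assume "x \<in> jac f d m" "y \<in> jac f d m"
  then obtain a b where "\<And>i. a i \<in> homog (m - (d - 1))" "x = (\<Sum>i\<in>UNIV. a i * pdiff i f)"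
    "\<And>i. b i \<in> homog (m - (d - 1))" "y = (\<Sum>i\<in>UNIV. b i * pdiff i f)"
    unfolding jac_def by blast
  then show "x + y \<in> jac f d m"
    using jacI[of "\<lambda>i. a i + b i" m d f] by (simp add: homog_add distrib_right sum.distrib)
next
  fix c x assume "x \<in> jac f d m"
  then obtain a where "\<And>i. a i \<in> homog (m - (d - 1))" "x = (\<Sum>i\<in>UNIV. a i * pdiff i f)"
    unfolding jac_def by blast
  then show "mscale c x \<in> jac f d m"
    using jacI[of "\<lambda>i. const c * a i" m d f] by (simp add: mscale_def homog_cmult sum_distrib_left mult.assoc)
qed

lemma jac_mult:
  assumes "p \<in> homog k" "x \<in> jac f d m"
  shows "p * x \<in> jac f d (m + k)"
proof -
  obtain a where a: "\<And>i. a i \<in> homog (m - (d - 1))" "x = (\<Sum>i\<in>UNIV. a i * pdiff i f)"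
    using assms(2) unfolding jac_def by blast
  have "p * a i \<in> homog (m + k - (d - 1))" for i
    using homog_mult[OF assms(1) a(1)[of i]] by (simp add: algebra_simps)
  then show ?thesis
    using jacI[of "\<lambda>i. p * a i" "m + k" d f] by (simp add: a(2) sum_distrib_left mult.assoc)
qed

lemma pdiff_in_jac: "pdiff i f \<in> jac f d (d - 1)"
proof -
  have "(\<Sum>j\<in>UNIV. (if j = i then 1 else 0) * pdiff j f) = (\<Sum>j\<in>UNIV. if j = i then pdiff j f else 0)"
    by (intro sum.cong) auto
  also have "\<dots> = pdiff i f" by simp
  finally show ?thesis
    using jacI[of "\<lambda>j. if j = i then 1 else 0" "d - 1" d f] by (auto simp: homog_1)
qed

text \<open>If the line \<open>coord w 3 = 0\<close> misses the singular points, then the partial derivatives have no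
  common zero on it, hence every form of large degree agrees on the line with an element of the
  Jacobian ideal.\<close>

lemma jac_line_surj:
  assumes f: "f \<in> homog (int d)" and d: "d \<ge> 1" and w: "invertible w"
    and miss: "\<And>v. v \<noteq> 0 \<Longrightarrow> eval (coord w 3) v = 0 \<Longrightarrow> \<exists>i. eval (pdiff i f) v \<noteq> 0"
  shows "\<exists>m0. \<forall>m\<ge>m0. \<forall>h\<in>homog (int (Suc m)). \<exists>h'\<in>homog (int m). coord w 3 * h' - h \<in> jac f (int d) (int (Suc m))"
proof -
  let ?J = "\<lambda>m::nat. jac f (int d) (int m)"
  have pd: "pdiff i f \<in> homog (int (d - 1))" for i using pdiff_homog[OF f, of i] d by (simp add: of_nat_diff)
  have pJ: "pdiff i f \<in> ?J (d - 1)" for i using pdiff_in_jac[of i f "int d"] d by (simp add: of_nat_diff)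
  have "\<exists>m0. \<forall>m\<ge>m0. \<forall>q. degree q \<le> m \<longrightarrow> q \<in> rest w ` ?J m"
  proof (rule binary_ideal_eventually_all)
    fix m
    show "up.subspace (rest w ` ?J m)"
      unfolding up.subspace_def
    proof (intro conjI ballI allI)
      note J = jac_subspace[of f "int d" "int m"]
      show "0 \<in> rest w ` ?J m" using mp.subspace_0[OF J] by (intro image_eqI[of _ _ 0]) auto
      show "x + y \<in> rest w ` ?J m" if "x \<in> rest w ` ?J m" "y \<in> rest w ` ?J m" for x y
        using that mp.subspace_add[OF J] by (auto simp: rest.map_add[symmetric])
      show "smult c x \<in> rest w ` ?J m" if x: "x \<in> rest w ` ?J m" for c x
      proof -
        obtain y where y: "y \<in> ?J m" "x = rest w y" using x by blast
        then have "smult c x = rest w (mscale c y)" by (simp add: mscale_def rest.map_mult)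
        then show ?thesis using mp.subspace_scale[OF J y(1)] by blast
      qed
    qed
    have X: "coord w j * x \<in> ?J (Suc m)" if "x \<in> ?J m" for j x
      using jac_mult[OF coord_homog that, of w j] by (simp add: add.commute)
    show "rest w ` ?J m \<subseteq> rest w ` ?J (Suc m)"
    proof
      fix x assume "x \<in> rest w ` ?J m"
      then obtain y where y: "y \<in> ?J m" "x = rest w y" by blast
      then have "x = rest w (coord w 1 * y)" by (simp add: rest.map_mult w)
      then show "x \<in> rest w ` ?J (Suc m)" using X[OF y(1)] by blast
    qed
    show "[:0, 1:] * p \<in> rest w ` ?J (Suc m)" if p: "p \<in> rest w ` ?J m" for p
    proof -
      obtain y where y: "y \<in> ?J m" "p = rest w y" using p by blast
      then have "[:0, 1:] * p = rest w (coord w 2 * y)" by (simp add: rest.map_mult w)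
      then show ?thesis using X[OF y(1)] by blast
    qed
  next
    fix t
    let ?v = "w $ 1 + t *s w $ 2"
    have "eval (coord w 1) ?v = 1" "eval (coord w 3) ?v = 0"
      using eval_coord[OF w, of _ "\<lambda>k. if k = 1 then 1 else if k = 2 then t else 0"] by (auto simp: sum_3)
    moreover from this(1) have "?v \<noteq> 0"
      using eval_scale[of "coord w 1" 1 0 0] coord_homog[of w 1] by auto
    ultimately obtain i where "eval (pdiff i f) ?v \<noteq> 0" using miss by blast
    then show "\<exists>m. \<exists>p\<in>rest w ` ?J m. poly p t \<noteq> 0"
      using pJ[of i] by (intro exI[of _ "d - 1"] bexI[of _ "rest w (pdiff i f)"]) (auto simp: poly_rest)
  next
    have e: "eval (coord w 3) (w $ 2) = 0" "eval (coord w 2) (w $ 2) = 1" using eval_coord_row[OF w] by auto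
    from e(2) have "w $ 2 \<noteq> 0"
      using eval_scale[of "coord w 2" 1 0 0] coord_homog[of w 2] by auto
    then obtain i where "eval (pdiff i f) (w $ 2) \<noteq> 0" using miss e(1) by blast
    then have c: "coeff (rest w (pdiff i f)) (d - 1) \<noteq> 0" unfolding coeff_rest_infinity[OF w pd] .
    moreover from this have "degree (rest w (pdiff i f)) = d - 1"
      using frame_decomp(1)[OF w pd, of i] le_degree[OF c] by simp
    ultimately show "\<exists>m. \<exists>p\<in>rest w ` ?J m. p \<noteq> 0 \<and> degree p = m"
      using pJ[of i] by (intro exI[of _ "d - 1"] bexI[of _ "rest w (pdiff i f)"]) auto
  qed
  then obtain m0 where m0: "\<And>m q. m \<ge> m0 \<Longrightarrow> degree q \<le> m \<Longrightarrow> q \<in> rest w ` ?J m" by blast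
  show ?thesis
  proof (intro exI[of _ m0] allI impI ballI)
    fix m and h :: "3 mpoly" assume m: "m0 \<le> m" and h: "h \<in> homog (int (Suc m))"
    obtain x where x: "x \<in> ?J (Suc m)" "rest w h = rest w x"
      using m0[of "Suc m" "rest w h"] m frame_decomp(1)[OF w h] by auto
    have "h - x \<in> homog (int (Suc m))" using h x(1) jac_homog[OF f] by (blast intro: homog_diff)
    from rest_kernel[OF w this] x(2) obtain h' where "h' \<in> homog (int m)" "h - x = coord w 3 * h'"
      by (auto simp: rest.map_diff)
    moreover from this have "coord w 3 * h' - h = mscale (-1) x" by (simp add: mscale_def const.map_uminus algebra_simps)
    ultimately show "\<exists>h'\<in>homog (int m). coord w 3 * h' - h \<in> ?J (Suc m)"
      using mp.subspace_scale[OF jac_subspace x(1)] by metis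
  qed
qed

lemma antitone_nat_stabilizes:
  fixes \<mu> :: "nat \<Rightarrow> nat"
  assumes "\<And>m. m \<ge> m0 \<Longrightarrow> \<mu> (Suc m) \<le> \<mu> m"
  shows "\<exists>m1\<ge>m0. \<forall>m\<ge>m1. \<mu> m = \<mu> m1"
proof -
  have anti: "\<mu> n \<le> \<mu> m" if "m0 \<le> m" "m \<le> n" for m n
    using that(2) by (induction n rule: dec_induct) (use assms that(1) in \<open>auto intro: order.trans\<close>)
  have "\<exists>n. \<exists>m\<ge>m0. \<mu> m = n" by blast
  then have "\<exists>m\<ge>m0. \<mu> m = (LEAST n. \<exists>m\<ge>m0. \<mu> m = n)" by (rule LeastI_ex)
  then obtain m1 where m1: "m1 \<ge> m0" "\<mu> m1 = (LEAST n. \<exists>m\<ge>m0. \<mu> m = n)" by blast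
  have "\<mu> m1 \<le> \<mu> m" if "m \<ge> m1" for m
    unfolding m1(2) using order.trans[OF m1(1) that] by (intro Least_le) blast
  then show ?thesis using anti m1(1) by (intro exI[of _ m1]) (auto intro!: le_antisym)
qed

text \<open>Multiplication by the form defining such a line is onto in large degrees. Hence the Hilbert
  function is eventually nonincreasing, so eventually constant, and then multiplication is also
  injective.\<close>

lemma jac_stabilization:
  assumes f: "f \<in> homog (int d)" and d: "d \<ge> 1" and w: "invertible w"
    and miss: "\<And>v. v \<noteq> 0 \<Longrightarrow> eval (coord w 3) v = 0 \<Longrightarrow> \<exists>i. eval (pdiff i f) v \<noteq> 0"
  shows "\<exists>m1. \<forall>m\<ge>m1.
    quot_dim mscale (homog (int m)) (jac f (int d) (int m)) = quot_dim mscale (homog (int m1)) (jac f (int d) (int m1)) \<and>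
    (\<forall>h\<in>homog (int m). coord w 3 * h \<in> jac f (int d) (int (Suc m)) \<longrightarrow> h \<in> jac f (int d) (int m)) \<and>
    (\<forall>h\<in>homog (int (Suc m)). \<exists>h'\<in>homog (int m). coord w 3 * h' - h \<in> jac f (int d) (int (Suc m)))"
proof -
  let ?J = "\<lambda>m::nat. jac f (int d) (int m)"
  let ?S = "\<lambda>m::nat. homog (int m) :: 3 mpoly set"
  let ?X = "coord w 3"
  define \<mu> where "\<mu> m = quot_dim mscale (?S m) (?J m)" for m
  obtain m0 where m0: "\<And>m h. m \<ge> m0 \<Longrightarrow> h \<in> ?S (Suc m) \<Longrightarrow> \<exists>h'\<in>?S m. ?X * h' - h \<in> ?J (Suc m)"
    using jac_line_surj[OF assms] by blast
  \<comment> \<open>\<open>K m\<close> modulo \<open>J m\<close> is the kernel of the multiplication map.\<close>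
  define K where "K m = {h \<in> ?S m. ?X * h \<in> ?J (Suc m)}" for m
  have K: "mp.subspace (K m)" for m
    unfolding mp.subspace_def K_def
    using mp.subspace_0[OF homog_subspace, of "int m"] mp.subspace_add[OF homog_subspace, of _ "int m"]
      mp.subspace_scale[OF homog_subspace, of _ "int m"] mp.subspace_0[OF jac_subspace, of f d "Suc m"]
      mp.subspace_add[OF jac_subspace, of _ f d "Suc m"] mp.subspace_scale[OF jac_subspace, of _ f d "Suc m"]
    by (auto simp: distrib_left mscale_def mult.left_commute[of _ "const _"])
  have JK: "?J m \<subseteq> K m" for m
    using jac_mult[OF coord_homog, of _ f "int d" "int m" w 3] jac_homog[OF f, of "int m"]
    by (auto simp: K_def add.commute)
  have fin: "mp.fin_quot (?S m) (?J m)" for m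
    using mp.fin_quot_mono[OF _ jac_subspace, of "{0}"] mp.subspace_0[OF jac_subspace] quot_dim_homog
    by (auto simp: mp.subspace_single_0)
  have finK: "mp.fin_quot (?S m) (K m)" for m by (rule mp.fin_quot_mono[OF jac_subspace K JK fin])
  have step: "\<mu> (Suc m) = quot_dim mscale (?S m) (K m)" if m: "m \<ge> m0" for m
    unfolding \<mu>_def
  proof (rule quot_dim_transport(2)[where T = "\<lambda>h. ?X * h"])
    show "?X * v \<in> ?S (Suc m)" if "v \<in> ?S m" for v using homog_mult[OF coord_homog that, of w 3] by simp
    show "(?X * v \<in> ?J (Suc m)) = (v \<in> K m)" if "v \<in> ?S m" for v using that by (simp add: K_def)
    show "\<exists>v\<in>?S m. ?X * v - v' \<in> ?J (Suc m)" if "v' \<in> ?S (Suc m)" for v' using m0[OF m that] .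
  qed (auto simp: mp.cvs_axioms homog_subspace K jac_subspace finK mscale_def algebra_simps)
  have chain: "\<mu> m = quot_dim mscale (?S m) (K m) + quot_dim mscale (K m) (?J m)" for m
    unfolding \<mu>_def by (rule mp.quot_dim_chain[OF jac_subspace K JK _ fin]) (auto simp: K_def)
  obtain m1 where m1: "m1 \<ge> m0" "\<And>m. m \<ge> m1 \<Longrightarrow> \<mu> m = \<mu> m1"
    using antitone_nat_stabilizes[of m0 \<mu>] step chain by (metis le_add1)
  have "K m \<subseteq> ?J m" if "m \<ge> m1" for m
  proof (rule mp.quot_dim_0D[OF jac_subspace])
    show "mp.fin_quot (K m) (?J m)" by (rule mp.fin_quot_sub[OF jac_subspace _ fin]) (auto simp: K_def)
    show "quot_dim mscale (K m) (?J m) = 0"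
      using m1(2)[OF that] m1(2)[of "Suc m"] step[of m] chain[of m] that m1(1) by simp
  qed
  note KJ = this
  show ?thesis
  proof (intro exI[of _ m1] allI impI conjI ballI)
    fix m assume m: "m1 \<le> m"
    show "quot_dim mscale (?S m) (?J m) = quot_dim mscale (?S m1) (?J m1)"
      using m1(2)[OF m] unfolding \<mu>_def .
    show "h \<in> ?J m" if "h \<in> ?S m" "?X * h \<in> ?J (Suc m)" for h
      using KJ[OF m] that unfolding K_def by blast
    show "\<exists>h'\<in>?S m. ?X * h' - h \<in> ?J (Suc m)" if "h \<in> ?S (Suc m)" for h
      using m0[OF order.trans[OF m1(1) m] that] .
  qed
qed

section \<open>The affine chart containing the singular points\<close>

definition ideal_gen :: "(3 \<Rightarrow> 'r::comm_ring_1) \<Rightarrow> 'r set" where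
  "ideal_gen F = {(\<Sum>i\<in>UNIV. a i * F i) | a. True}"

definition is_ideal :: "'r::comm_ring_1 set \<Rightarrow> bool" where
  "is_ideal A \<longleftrightarrow> 0 \<in> A \<and> (\<forall>x\<in>A. \<forall>y\<in>A. x + y \<in> A) \<and> (\<forall>x\<in>A. \<forall>c. c * x \<in> A)"

lemma ideal_0: "is_ideal A \<Longrightarrow> 0 \<in> A"
  and ideal_add: "is_ideal A \<Longrightarrow> x \<in> A \<Longrightarrow> y \<in> A \<Longrightarrow> x + y \<in> A"
  and ideal_mult: "is_ideal A \<Longrightarrow> x \<in> A \<Longrightarrow> c * x \<in> A"
  by (auto simp: is_ideal_def)

lemma ideal_mult2: "is_ideal A \<Longrightarrow> x \<in> A \<Longrightarrow> x * c \<in> A"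
  using ideal_mult[of A x c] by (simp add: mult.commute)

lemma ideal_diff: "is_ideal A \<Longrightarrow> x \<in> A \<Longrightarrow> y \<in> A \<Longrightarrow> x - y \<in> A"
  using ideal_add[of A x "(-1) * y"] ideal_mult[of A y "-1"] by simp

lemma ideal_subspace: "is_ideal (A :: 'n mpoly set) \<Longrightarrow> mp.subspace A"
  by (auto simp: mp.subspace_def mscale_def ideal_0 ideal_add ideal_mult)

lemma ideal_gen_ideal: "is_ideal (ideal_gen F)"
  unfolding is_ideal_def
proof (intro conjI ballI allI)
  show "0 \<in> ideal_gen F" unfolding ideal_gen_def by (rule CollectI, rule exI[of _ "\<lambda>_. 0"]) simp
  fix x assume x: "x \<in> ideal_gen F"
  then obtain a where a: "x = (\<Sum>i\<in>UNIV. a i * F i)" by (auto simp: ideal_gen_def)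
  show "c * x \<in> ideal_gen F" for c
    unfolding ideal_gen_def a by (rule CollectI, rule exI[of _ "\<lambda>i. c * a i"]) (simp add: sum_distrib_left mult.assoc)
  fix y assume "y \<in> ideal_gen F"
  then obtain b where b: "y = (\<Sum>i\<in>UNIV. b i * F i)" by (auto simp: ideal_gen_def)
  show "x + y \<in> ideal_gen F"
    unfolding ideal_gen_def a b
    by (rule CollectI, rule exI[of _ "\<lambda>i. a i + b i"]) (simp add: distrib_right sum.distrib)
qed

lemma ideal_genI: "(\<Sum>i\<in>UNIV. a i * F i) \<in> ideal_gen F"
  by (auto simp: ideal_gen_def)

lemma ideal_gen_base: "F i \<in> ideal_gen F"
proof -
  have "(\<Sum>j\<in>UNIV. (if j = i then 1 else 0) * F j) = (\<Sum>j\<in>UNIV. if j = i then F j else 0)"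
    by (intro sum.cong) auto
  also have "\<dots> = F i" by simp
  finally show ?thesis using ideal_genI[of "\<lambda>j. if j = i then 1 else 0" F] by simp
qed

text \<open>In the chart \<open>coord u 1 \<noteq> 0\<close> the Jacobian ideal becomes the ideal of the dehomogenized
  partial derivatives. By the stabilization its codimension is the eventual value of the Hilbert
  function.\<close>

lemma chart_codim:
  assumes f: "f \<in> homog (int d)" and d: "d \<ge> 1" and u: "invertible u"
    and inj: "\<And>m h. m \<ge> m1 \<Longrightarrow> h \<in> homog (int m) \<Longrightarrow> coord u 1 * h \<in> jac f (int d) (int (Suc m)) \<Longrightarrow> h \<in> jac f (int d) (int m)"
    and srj: "\<And>m h. m \<ge> m1 \<Longrightarrow> h \<in> homog (int (Suc m)) \<Longrightarrow> \<exists>h'\<in>homog (int m). coord u 1 * h' - h \<in> jac f (int d) (int (Suc m))"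
  defines "I \<equiv> ideal_gen (\<lambda>i. local_eq (pdiff i f) u)"
  shows "mp.fin_quot UNIV I" "quot_dim mscale UNIV I = quot_dim mscale (homog (int m1)) (jac f (int d) (int m1))"
proof -
  let ?J = "\<lambda>m::nat. jac f (int d) (int m)"
  let ?S = "\<lambda>m::nat. homog (int m) :: 3 mpoly set"
  let ?X = "coord u 1"
  have I: "is_ideal I" unfolding I_def by (rule ideal_gen_ideal)
  have JI: "local_eq x u \<in> I" if x: "x \<in> jac f (int d) m" for x m
  proof -
    obtain a where "x = (\<Sum>i\<in>UNIV. a i * pdiff i f)" using x by (auto simp: jac_def)
    then have "local_eq x u = (\<Sum>i\<in>UNIV. local_eq (a i) u * local_eq (pdiff i f) u)"
      by (simp add: loc.hom_simps)
    then show ?thesis unfolding I_def using ideal_genI[of "\<lambda>i. local_eq (a i) u"] by simp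
  qed
  have inj': "h \<in> ?J m" if "m \<ge> m1" "h \<in> ?S m" "?X ^ n * h \<in> ?J (m + n)" for m n h
    using that(3)
  proof (induction n)
    case (Suc n)
    have "?X ^ n * h \<in> ?S (m + n)"
      using homog_mult[OF homog_power1[OF coord_homog[of u 1], of n] that(2)] by (simp add: add.commute)
    moreover have "?X * (?X ^ n * h) \<in> ?J (Suc (m + n))" using Suc.prems by (simp add: mult.assoc)
    ultimately have "?X ^ n * h \<in> ?J (m + n)" using inj[of "m + n"] that(1) by simp
    then show ?case by (rule Suc.IH)
  qed simp
  have srj': "\<exists>h'\<in>?S m1. local_eq h' u - local_eq h u \<in> I" if "h \<in> ?S (m1 + n)" for n h
    using that
  proof (induction n arbitrary: h)
    case 0
    then show ?case using ideal_0[OF I] by (intro bexI[of _ h]) auto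
  next
    case (Suc n)
    obtain h1 where h1: "h1 \<in> ?S (m1 + n)" "?X * h1 - h \<in> ?J (Suc (m1 + n))"
      using srj[of "m1 + n" h] Suc.prems by auto
    obtain h' where h': "h' \<in> ?S m1" "local_eq h' u - local_eq h1 u \<in> I" using Suc.IH[OF h1(1)] by blast
    have "local_eq h1 u - local_eq h u \<in> I"
      using JI[OF h1(2)] by (simp add: loc.hom_simps local_eq_coord[OF u])
    from ideal_add[OF I h'(2) this] show ?case using h'(1) by auto
  qed
  note ra = dehom_raise[OF ring_map_local_eq local_eq_coord(1)[OF u]]
  \<comment> \<open>Homogenizing the coefficients of an element of \<open>I\<close> puts a multiple by a power of \<open>coord u 1\<close>
    into the Jacobian ideal; injectivity removes the power.\<close>
  have TW: "h \<in> ?J m1" if h: "h \<in> ?S m1" "local_eq h u \<in> I" for h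
  proof -
    obtain a where a: "local_eq h u = (\<Sum>i\<in>UNIV. a i * local_eq (pdiff i f) u)"
      using h(2) by (auto simp: I_def ideal_gen_def)
    have "\<forall>i. \<exists>k. \<exists>G\<in>homog (int k). local_eq G u = a i" using local_eq_surj[OF u] by blast
    then obtain k where k: "\<And>i. \<exists>G\<in>homog (int (k i)). local_eq G u = a i" by metis
    define N where "N = m1 + Max (range k)"
    have "\<exists>G\<in>homog (int N). local_eq G u = a i" for i
    proof -
      obtain G where G: "G \<in> homog (int (k i))" "local_eq G u = a i" using k by blast
      have "k i \<le> N" unfolding N_def by (intro trans_le_add2 Max_ge) auto
      then show ?thesis by (rule ra[OF G])
    qed
    then obtain A where A: "\<And>i. A i \<in> homog (int N)" "\<And>i. local_eq (A i) u = a i" by metis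
    let ?H = "\<Sum>i\<in>UNIV. A i * pdiff i f"
    let ?M = "N + d - 1"
    have HJ: "?H \<in> ?J ?M" using A(1) d by (intro jacI) (simp add: of_nat_diff)
    have "m1 \<le> ?M" using d by (simp add: N_def)
    have "int (?M - m1) + int m1 = int ?M" using \<open>m1 \<le> ?M\<close> by simp
    then have hM: "?X ^ (?M - m1) * h \<in> ?S ?M"
      using homog_mult[OF homog_power1[OF coord_homog[of u 1], of "?M - m1"] h(1)] by (simp only:)
    have "local_eq (?X ^ (?M - m1) * h - ?H) u = 0"
      by (simp add: loc.hom_simps local_eq_coord[OF u] a A(2))
    then have "?X ^ (?M - m1) * h - ?H = 0"
      using local_eq_inj[OF u homog_diff[OF hM]] jac_homog[OF f] HJ by blast
    moreover have "m1 + (?M - m1) = ?M" using \<open>m1 \<le> ?M\<close> by simp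
    ultimately have "?X ^ (?M - m1) * h \<in> ?J (m1 + (?M - m1))" using HJ by (simp only: right_minus_eq)
    then show ?thesis using inj'[OF _ h(1)] by blast
  qed
  have fin: "mp.fin_quot (?S m1) (?J m1)"
    using mp.fin_quot_mono[OF _ jac_subspace, of "{0}"] mp.subspace_0[OF jac_subspace] quot_dim_homog
    by (auto simp: mp.subspace_single_0)
  have sj: "\<exists>v\<in>?S m1. local_eq v u - p \<in> I" for p
  proof -
    obtain k G where "G \<in> homog (int k)" "local_eq G u = p" using local_eq_surj[OF u] by blast
    then obtain G where "G \<in> ?S (m1 + k)" "local_eq G u = p" using ra[of G k p "m1 + k"] by auto
    then show ?thesis using srj' by blast
  qed
  have *: "mp.fin_quot UNIV I \<and> quot_dim mscale UNIV I = quot_dim mscale (?S m1) (?J m1)"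
    by (intro conjI; rule quot_dim_transport[OF mp.cvs_axioms mp.cvs_axioms homog_subspace jac_subspace ideal_subspace[OF I],
         where T = "\<lambda>h. local_eq h u" and V' = UNIV])
       (use TW JI sj fin in \<open>auto simp: loc.hom_simps mscale_def\<close>)
  then show "mp.fin_quot UNIV I" "quot_dim mscale UNIV I = quot_dim mscale (?S m1) (?J m1)" by auto
qed

section \<open>Ideals of finite codimension in the polynomial ring of the chart\<close>

text \<open>The univariate polynomial \<open>p\<close> in the variable \<open>var i\<close>.\<close>

definition usub :: "2 \<Rightarrow> complex poly \<Rightarrow> 2 mpoly" where
  "usub i p = poly (map_poly const p) (var i)"

interpretation usub: ring_map "usub i" for i
proof
  have add: "map_poly const (p + q) = map_poly const p + (map_poly const q :: 2 mpoly poly)" for p q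
    by (rule poly_eqI) (simp add: coeff_map_poly const.map_add)
  have mult: "map_poly const (p * q) = map_poly const p * (map_poly const q :: 2 mpoly poly)" for p q
    by (rule poly_eqI) (simp add: coeff_map_poly coeff_mult const.map_sum const.map_mult)
  show "usub i 1 = 1" by (simp add: usub_def map_poly_1')
  show "usub i (p + q) = usub i p + usub i q" "usub i (p * q) = usub i p * usub i q" for p q
    by (simp_all add: usub_def add mult)
qed

lemma usub_pCons: "usub i (pCons a p) = const a + var i * usub i p"
  by (simp add: usub_def map_poly_pCons)

lemma usub_monom: "usub i (monom c k) = const c * var i ^ k"
  by (simp add: usub_def map_poly_monom poly_monom)

lemma eval_usub: "eval (usub i p) v = poly p (v $ i)"
  by (induction p rule: pCons_induct) (auto simp: usub_pCons eval.hom_simps)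

text \<open>The powers of a variable are linearly dependent modulo the ideal.\<close>

lemma finite_codim_univariate:
  assumes I: "is_ideal (I :: 2 mpoly set)" and f: "mp.fin_quot UNIV I"
  shows "\<exists>\<rho>. \<rho> \<noteq> 0 \<and> usub i \<rho> \<in> I"
proof -
  obtain B where B: "finite B" "mp.span_mod UNIV I B" using f by (auto simp: mp.fin_quot_def mp.quot_basis_iff)
  have inj: "inj (\<lambda>k. var i ^ k)"
  proof (rule injI)
    fix j k :: nat assume "var i ^ j = (var i ^ k :: 2 mpoly)"
    then have "eval (var i ^ j) (\<chi> i. 2) = eval (var i ^ k) (\<chi> i. 2)" by simp
    then have "(2::complex) ^ j = 2 ^ k" by (simp add: eval.map_power)
    then have "norm ((2::complex) ^ j) = norm ((2::complex) ^ k)" by simp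
    then show "j = k" by (simp add: norm_power)
  qed
  let ?B = "(\<lambda>k. var i ^ k) ` {..card B} :: 2 mpoly set"
  have "card ?B = Suc (card B)" by (subst card_image) (auto intro: inj_on_subset[OF inj])
  then have "\<not> mp.indep_mod I ?B"
    using mp.indep_mod_card_le[OF ideal_subspace[OF I] B, of ?B] by auto
  then obtain c k where c: "mp.combo c ?B \<in> I" "k \<le> card B" "c (var i ^ k) \<noteq> 0"
    by (auto simp: mp.indep_mod_def)
  let ?\<rho> = "\<Sum>k\<le>card B. monom (c (var i ^ k)) k"
  have "usub i ?\<rho> = mp.combo c ?B"
    by (simp add: usub.map_sum usub_monom sum.reindex[OF inj_on_subset[OF inj]] mscale_def)
  moreover have "coeff ?\<rho> k \<noteq> 0" using c by (simp add: coeff_sum)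
  then have "?\<rho> \<noteq> 0" by (metis coeff_0)
  ultimately show ?thesis using c(1) by metis
qed

definition adjoin :: "'r::comm_ring_1 set \<Rightarrow> 'r \<Rightarrow> 'r set" where
  "adjoin A x = {s + c * x | s c. s \<in> A}"

lemma adjoin_ideal: "is_ideal A \<Longrightarrow> is_ideal (adjoin A x)"
  unfolding is_ideal_def[of "adjoin A x"]
proof (intro conjI ballI allI)
  assume A: "is_ideal A"
  show "0 \<in> adjoin A x" unfolding adjoin_def
    by (rule CollectI, rule exI[of _ 0], rule exI[of _ 0]) (simp add: ideal_0[OF A])
  fix y assume "y \<in> adjoin A x"
  then obtain s c where y: "y = s + c * x" "s \<in> A" by (auto simp: adjoin_def)
  show "a * y \<in> adjoin A x" for a
    unfolding adjoin_def by (rule CollectI, rule exI[of _ "a * s"], rule exI[of _ "a * c"])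
      (simp add: y ideal_mult[OF A] algebra_simps)
  fix z assume "z \<in> adjoin A x"
  then obtain t e where z: "z = t + e * x" "t \<in> A" by (auto simp: adjoin_def)
  show "y + z \<in> adjoin A x"
    unfolding adjoin_def by (rule CollectI, rule exI[of _ "s + t"], rule exI[of _ "c + e"])
      (simp add: y z ideal_add[OF A] algebra_simps)
qed

lemma adjoin_sub: "A \<subseteq> adjoin A x"
proof
  fix s assume "s \<in> A"
  then have "s = s + 0 * x \<and> s \<in> A" by simp
  then show "s \<in> adjoin A x" unfolding adjoin_def by blast
qed

lemma adjoin_elem: "is_ideal A \<Longrightarrow> x \<in> adjoin A x"
  unfolding adjoin_def by (rule CollectI, rule exI[of _ 0], rule exI[of _ 1]) (simp add: ideal_0)

text \<open>The polynomial \<open>\<rho>\<close> splits into linear factors. If each of them generated the unit ideal together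
  with \<open>A\<close>, then so would their product, which lies in \<open>A\<close>.\<close>

lemma adjoin_root:
  assumes A: "is_ideal A" and A1: "1 \<notin> A" and c: "\<rho> \<noteq> 0" "usub i \<rho> \<in> A"
  shows "\<exists>a. 1 \<notin> adjoin A (var i - const a)"
  using c
proof (induction "degree \<rho>" arbitrary: \<rho> rule: less_induct)
  case less
  show ?case
  proof (cases "degree \<rho> = 0")
    case True
    then obtain c where c: "\<rho> = [:c:]" by (rule degree_eq_zeroE)
    then have "const c \<in> A" using less.prems(2) by (simp add: usub_pCons)
    then have "const (1 / c) * const c \<in> A" by (rule ideal_mult[OF A])
    then have "1 \<in> A" using less.prems(1) c by (simp add: const.map_mult[symmetric])
    then show ?thesis using A1 by simp
  next
    case False
    then obtain a where "poly \<rho> a = 0"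
      using fundamental_theorem_of_algebra[of \<rho>] constant_degree[of \<rho>] by auto
    then obtain \<psi> where psi: "\<rho> = [:-a, 1:] * \<psi>" by (auto simp: poly_eq_0_iff_dvd elim: dvdE)
    have psi0: "\<psi> \<noteq> 0" using psi less.prems(1) by auto
    have us: "usub i [:-a, 1:] = var i - const a" by (simp add: usub_pCons const.map_uminus)
    show ?thesis
    proof (cases "1 \<in> adjoin A (var i - const a)")
      case True
      then obtain s g where s: "1 = s + g * (var i - const a)" "s \<in> A" by (auto simp: adjoin_def)
      have "usub i \<psi> = usub i \<psi> * (s + g * (var i - const a))" using s(1) by simp
      also have "\<dots> = usub i \<psi> * s + g * usub i \<rho>"
        unfolding psi usub.map_mult us by (simp add: algebra_simps)
      also have "\<dots> \<in> A" by (intro ideal_add[OF A] ideal_mult[OF A] s less.prems)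
      finally have "usub i \<psi> \<in> A" .
      moreover have "degree \<psi> < degree \<rho>" using psi0 unfolding psi by (subst degree_mult_eq) auto
      ultimately show ?thesis using less.hyps psi0 by blast
    qed blast
  qed
qed

lemma taylor_at_point:
  "\<exists>a b. h = const (eval h v) + a * (var 1 - const (v $ 1)) + b * (var 2 - const (v $ 2 :: complex))"
  for h :: "2 mpoly"
proof (induction h rule: mpoly_induct)
  case (const c)
  show ?case by (rule exI[of _ 0], rule exI[of _ 0]) simp
next
  case (var i)
  have "i = 1 \<or> i = 2" using exhaust_2 by auto
  then show ?case
  proof
    assume "i = 1" then show ?thesis by (intro exI[of _ 1] exI[of _ 0]) simp
  next
    assume "i = 2" then show ?thesis by (intro exI[of _ 0] exI[of _ 1]) simp
  qed
next
  case (add p q)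
  then obtain a b a' b' where
    1: "p = const (eval p v) + a * (var 1 - const (v $ 1)) + b * (var 2 - const (v $ 2))" and
    2: "q = const (eval q v) + a' * (var 1 - const (v $ 1)) + b' * (var 2 - const (v $ 2))" by blast
  show ?case
    by (rule exI[of _ "a + a'"], rule exI[of _ "b + b'"], subst (1) 1, subst (1) 2)
       (simp add: eval.map_add const.map_add algebra_simps)
next
  case (mult p q)
  then obtain a b a' b' where
    1: "p = const (eval p v) + a * (var 1 - const (v $ 1)) + b * (var 2 - const (v $ 2))" and
    2: "q = const (eval q v) + a' * (var 1 - const (v $ 1)) + b' * (var 2 - const (v $ 2))" by blast
  have "p * q = p * (q - const (eval q v)) + const (eval q v) * (p - const (eval p v)) + const (eval (p * q) v)"
    by (simp add: eval.map_mult const.map_mult algebra_simps)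
  also have "q - const (eval q v) = a' * (var 1 - const (v $ 1)) + b' * (var 2 - const (v $ 2))"
    using 2 by (simp add: algebra_simps)
  also have "p - const (eval p v) = a * (var 1 - const (v $ 1)) + b * (var 2 - const (v $ 2))"
    using 1 by (simp add: algebra_simps)
  finally show ?case
    by (intro exI[of _ "p * a' + const (eval q v) * a"] exI[of _ "p * b' + const (eval q v) * b"])
       (simp add: algebra_simps)
qed

text \<open>The weak Nullstellensatz, for ideals of finite codimension: such an ideal contains nonzero
  polynomials in each variable, so that one of their roots can be adjoined to a proper ideal,
  until it is the ideal of a point.\<close>

lemma weak_nullstellensatz:
  assumes A: "is_ideal A" and I: "is_ideal I" "mp.fin_quot UNIV I" "I \<subseteq> A"
    and nz: "\<And>v. \<exists>h\<in>A. eval h v \<noteq> 0"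
  shows "(1 :: 2 mpoly) \<in> A"
proof (rule ccontr)
  assume A1: "1 \<notin> A"
  obtain \<rho> where "\<rho> \<noteq> 0" "usub 1 \<rho> \<in> A" using finite_codim_univariate[OF I(1,2)] I(3) by blast
  then obtain a where a: "1 \<notin> adjoin A (var 1 - const a)" using adjoin_root[OF A A1] by blast
  let ?A = "adjoin A (var 1 - const a)"
  note A' = adjoin_ideal[OF A, of "var 1 - const a"]
  obtain \<omega> where "\<omega> \<noteq> 0" "usub 2 \<omega> \<in> ?A"
    using finite_codim_univariate[OF I(1,2), of 2] I(3) adjoin_sub by blast
  then obtain b where b: "1 \<notin> adjoin ?A (var 2 - const b)" using adjoin_root[OF A' a] by blast
  let ?B = "adjoin ?A (var 2 - const b)"
  note B = adjoin_ideal[OF A', of "var 2 - const b"]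
  have x: "var 1 - const a \<in> ?B" "var 2 - const b \<in> ?B"
    using adjoin_elem[OF A] adjoin_elem[OF A'] adjoin_sub by blast+
  define v :: "complex ^ 2" where "v = vector [a, b]"
  obtain h where h: "h \<in> A" "eval h v \<noteq> 0" using nz by blast
  obtain \<alpha> \<beta> where "h = const (eval h v) + \<alpha> * (var 1 - const (v $ 1)) + \<beta> * (var 2 - const (v $ 2))"
    using taylor_at_point by blast
  then have e: "const (eval h v) = h - \<alpha> * (var 1 - const a) - \<beta> * (var 2 - const b)"
    by (simp add: v_def algebra_simps)
  have "h \<in> ?B" using h(1) adjoin_sub by blast
  then have "const (eval h v) \<in> ?B"
    unfolding e by (intro ideal_diff[OF B] ideal_mult[OF B] x)
  then have "const (1 / eval h v) * const (eval h v) \<in> ?B" by (rule ideal_mult[OF B])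
  then show False using b h(2) by (simp add: const.map_mult[symmetric])
qed

text \<open>The kernel of the localization of \<open>\<complex>[u, v]/I\<close> at the point \<open>p\<close>: the \<open>p\<close>-primary component
  of \<open>I\<close>.\<close>

definition loc_ker :: "2 mpoly set \<Rightarrow> complex ^ 2 \<Rightarrow> 2 mpoly set" where
  "loc_ker I p = {h. \<exists>b. eval b p \<noteq> 0 \<and> b * h \<in> I}"

lemma loc_ker_ideal: "is_ideal I \<Longrightarrow> is_ideal (loc_ker I p)"
  unfolding is_ideal_def[of "loc_ker I p"]
proof (intro conjI ballI allI)
  assume I: "is_ideal I"
  show "0 \<in> loc_ker I p" unfolding loc_ker_def by (rule CollectI, rule exI[of _ 1]) (simp add: ideal_0[OF I])
  fix x assume "x \<in> loc_ker I p"
  then obtain b where b: "eval b p \<noteq> 0" "b * x \<in> I" by (auto simp: loc_ker_def)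
  show "c * x \<in> loc_ker I p" for c
    using b ideal_mult[OF I b(2), of c] unfolding loc_ker_def
    by (intro CollectI exI[of _ b]) (simp add: algebra_simps)
  fix y assume "y \<in> loc_ker I p"
  then obtain e where e: "eval e p \<noteq> 0" "e * y \<in> I" by (auto simp: loc_ker_def)
  show "x + y \<in> loc_ker I p"
    using b e ideal_add[OF I ideal_mult[OF I b(2), of e] ideal_mult[OF I e(2), of b]] unfolding loc_ker_def
    by (intro CollectI exI[of _ "b * e"]) (simp add: eval.map_mult algebra_simps)
qed

lemma loc_ker_sup: "is_ideal I \<Longrightarrow> I \<subseteq> loc_ker I p"
  unfolding loc_ker_def by (auto intro!: exI[of _ 1])

text \<open>In a coordinate separating the points, \<open>I\<close> contains a univariate polynomial. Its cofactor prime to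
  \<open>p\<close> is invertible at \<open>p\<close>, so a power of the linear factor at \<open>p\<close> lies in the primary component.\<close>

lemma loc_ker_separates:
  assumes I: "is_ideal I" "mp.fin_quot UNIV I" and pr: "p \<noteq> r"
  shows "\<exists>h\<in>loc_ker I p. eval h r \<noteq> 0"
proof -
  obtain i where i: "p $ i \<noteq> r $ i" using pr by (auto simp: vec_eq_iff)
  obtain \<rho> where chi: "\<rho> \<noteq> 0" "usub i \<rho> \<in> I" using finite_codim_univariate[OF I] by blast
  define n where "n = order (p $ i) \<rho>"
  obtain \<psi> where psi: "\<rho> = [:- (p $ i), 1:] ^ n * \<psi>" "\<not> [:- (p $ i), 1:] dvd \<psi>"
    using order_decomp[OF chi(1), of "p $ i"] unfolding n_def by blast
  let ?h = "usub i ([:- (p $ i), 1:] ^ n)"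
  have "usub i \<psi> * ?h \<in> I" using chi(2) psi(1) by (simp add: usub.map_mult mult.commute)
  moreover have "eval (usub i \<psi>) p \<noteq> 0" using psi(2) by (simp add: eval_usub poly_eq_0_iff_dvd)
  ultimately have "?h \<in> loc_ker I p" unfolding loc_ker_def by blast
  moreover have "eval ?h r \<noteq> 0" using i by (simp add: eval_usub)
  ultimately show ?thesis by blast
qed

text \<open>The primary component at \<open>p\<close> and a polynomial not vanishing at \<open>p\<close> have no common zero.\<close>

lemma loc_ker_unit:
  assumes I: "is_ideal I" "mp.fin_quot UNIV I" and b: "eval b p \<noteq> 0"
  shows "\<exists>c. c * b - 1 \<in> loc_ker I p"
proof -
  note K = loc_ker_ideal[OF I(1), of p]
  have "1 \<in> adjoin (loc_ker I p) b"
  proof (rule weak_nullstellensatz[OF adjoin_ideal[OF K] I])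
    show "I \<subseteq> adjoin (loc_ker I p) b" using loc_ker_sup[OF I(1)] adjoin_sub by blast
    show "\<exists>h\<in>adjoin (loc_ker I p) b. eval h v \<noteq> 0" for v
    proof (cases "v = p")
      case True
      then show ?thesis using b adjoin_elem[OF K] by blast
    next
      case False
      then show ?thesis using loc_ker_separates[OF I, of p v] adjoin_sub[of "loc_ker I p" b] by blast
    qed
  qed
  then obtain s c where "1 = s + c * b" "s \<in> loc_ker I p" by (auto simp: adjoin_def)
  moreover from this have "c * b - 1 = (-1) * s" by (simp add: algebra_simps)
  ultimately show ?thesis using ideal_mult[OF K] by metis
qed

lemma is_ideal_Inter: "(\<And>K. K \<in> \<K> \<Longrightarrow> is_ideal K) \<Longrightarrow> is_ideal (\<Inter>\<K>)"
  unfolding is_ideal_def by blast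

text \<open>By the weak Nullstellensatz each primary component is comaximal with the intersection of the
  others, as these ideals have no common zero; so the Chinese remainder theorem applies.\<close>

lemma codim_sum:
  assumes I: "is_ideal I" "mp.fin_quot UNIV I" and Z: "finite Z"
  shows "quot_dim mscale UNIV (\<Inter>p\<in>Z. loc_ker I p) = (\<Sum>p\<in>Z. quot_dim mscale UNIV (loc_ker I p))"
  using Z
proof (induction Z rule: finite_induct)
  case empty
  then show ?case using mp.quot_dim_trivial[of UNIV UNIV] by (simp add: mp.subspace_UNIV)
next
  case (insert p Z)
  let ?A = "\<Inter>q\<in>Z. loc_ker I q" and ?B = "loc_ker I p"
  have A: "is_ideal ?A" by (rule is_ideal_Inter) (auto intro: loc_ker_ideal[OF I(1)])
  have B: "is_ideal ?B" by (rule loc_ker_ideal[OF I(1)])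
  have AB: "is_ideal (?A \<inter> ?B)" using is_ideal_Inter[of "{?A, ?B}"] A B by auto
  have IA: "I \<subseteq> ?A" "I \<subseteq> ?B" using loc_ker_sup[OF I(1)] by blast+
  have AB1: "\<exists>a\<in>?A. a - 1 \<in> ?B"
  proof -
    let ?C = "{a + b | a b. a \<in> ?A \<and> b \<in> ?B}"
    have C: "is_ideal ?C"
      unfolding is_ideal_def
    proof (intro conjI ballI allI)
      show "0 \<in> ?C" using ideal_0[OF A] ideal_0[OF B] by force
      fix x assume "x \<in> ?C"
      then obtain a b where x: "x = a + b" "a \<in> ?A" "b \<in> ?B" by blast
      show "c * x \<in> ?C" for c
        using ideal_mult[OF A x(2), of c] ideal_mult[OF B x(3), of c] x(1) by (auto simp: distrib_left)
      fix y assume "y \<in> ?C"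
      then obtain a' b' where y: "y = a' + b'" "a' \<in> ?A" "b' \<in> ?B" by blast
      have "x + y = (a + a') + (b + b')" by (simp add: x y)
      then show "x + y \<in> ?C" using ideal_add[OF A x(2) y(2)] ideal_add[OF B x(3) y(3)] by blast
    qed
    have AC: "?A \<subseteq> ?C" using ideal_0[OF B] by force
    have BC: "?B \<subseteq> ?C" using ideal_0[OF A] by force
    have "1 \<in> ?C"
    proof (rule weak_nullstellensatz[OF C I])
      show "I \<subseteq> ?C" by (rule order.trans[OF IA(1) AC])
      show "\<exists>h\<in>?C. eval h v \<noteq> 0" for v
      proof (cases "v = p")
        case False
        then obtain h where h: "h \<in> ?B" "eval h v \<noteq> 0" using loc_ker_separates[OF I, of p v] by blast
        from h(2) subsetD[OF BC h(1)] show ?thesis by (rule bexI)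
      next
        case True
        have "\<exists>h\<in>loc_ker I q. eval h v \<noteq> 0" if "q \<in> Z" for q
          using loc_ker_separates[OF I, of q v] True that insert.hyps by blast
        \<comment> \<open>A product of elements of the other components that do not vanish at \<open>p\<close>.\<close>
        then obtain h where h: "\<And>q. q \<in> Z \<Longrightarrow> h q \<in> loc_ker I q" "\<And>q. q \<in> Z \<Longrightarrow> eval (h q) v \<noteq> 0" by metis
        have P: "(\<Prod>q\<in>Z. h q) \<in> ?A"
        proof
          fix q assume q: "q \<in> Z"
          have "(\<Prod>q\<in>Z. h q) = h q * (\<Prod>q\<in>Z - {q}. h q)" using insert.hyps q by (simp add: prod.remove)
          then show "(\<Prod>q\<in>Z. h q) \<in> loc_ker I q"
            using ideal_mult2[OF loc_ker_ideal[OF I(1)] h(1)[OF q]] by simp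
        qed
        have "eval (\<Prod>q\<in>Z. h q) v \<noteq> 0" using h(2) insert.hyps by (simp add: eval.map_prod)
        then show ?thesis by (rule bexI) (rule subsetD[OF AC P])
      qed
    qed
    then obtain a b where "1 = a + b" "a \<in> ?A" "b \<in> ?B" by blast
    moreover from this have "a - 1 = (-1) * b" by (simp add: algebra_simps)
    ultimately show ?thesis using ideal_mult[OF B] by metis
  qed
  have "quot_dim mscale UNIV (?A \<inter> ?B) = quot_dim mscale UNIV ?A + quot_dim mscale UNIV ?B"
  proof (rule mp.quot_dim_Int)
    show "mp.fin_quot UNIV (?A \<inter> ?B)"
      using mp.fin_quot_mono[OF ideal_subspace[OF I(1)] ideal_subspace[OF AB] _ I(2)] IA by blast
    obtain a where a: "a \<in> ?A" "a - 1 \<in> ?B" using AB1 by blast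
    show "\<exists>a\<in>?A. a - v \<in> ?B" for v
      using ideal_mult[OF A a(1), of v] ideal_mult[OF B a(2), of v]
      by (intro bexI[of _ "v * a"]) (auto simp: algebra_simps)
  qed (auto simp: ideal_subspace A B mp.subspace_UNIV simp del: INT_iff)
  then show ?case using insert by (simp add: Int_commute)
qed

text \<open>If \<open>h\<close> lies in all primary components, then the ideal quotient of \<open>I\<close> by \<open>h\<close> has no zeros.\<close>

lemma Inter_loc_ker:
  assumes I: "is_ideal I" "mp.fin_quot UNIV I"
  shows "(\<Inter>p\<in>{p. \<forall>h\<in>I. eval h p = 0}. loc_ker I p) = I"
proof
  show "I \<subseteq> (\<Inter>p\<in>{p. \<forall>h\<in>I. eval h p = 0}. loc_ker I p)" using loc_ker_sup[OF I(1)] by blast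
  show "(\<Inter>p\<in>{p. \<forall>h\<in>I. eval h p = 0}. loc_ker I p) \<subseteq> I"
  proof
    fix h assume h: "h \<in> (\<Inter>p\<in>{p. \<forall>h\<in>I. eval h p = 0}. loc_ker I p)"
    let ?A = "{b. b * h \<in> I}"
    have A: "is_ideal ?A"
      using ideal_0[OF I(1)] ideal_add[OF I(1)] ideal_mult[OF I(1)]
      by (auto simp: is_ideal_def distrib_right mult.assoc)
    have "1 \<in> ?A"
    proof (rule weak_nullstellensatz[OF A I])
      show IA: "I \<subseteq> ?A" using ideal_mult2[OF I(1)] by blast
      show "\<exists>b\<in>?A. eval b v \<noteq> 0" for v
      proof (cases "\<forall>h\<in>I. eval h v = 0")
        case True
        then show ?thesis using h by (auto simp: loc_ker_def)
      next
        case False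
        then show ?thesis using IA by blast
      qed
    qed
    then show "h \<in> I" by simp
  qed
qed

text \<open>The zeros lie in the grid formed by the roots of two univariate polynomials in \<open>I\<close>.\<close>

lemma finite_zeros:
  assumes I: "is_ideal I" "mp.fin_quot UNIV I"
  shows "finite {p :: complex ^ 2. \<forall>h\<in>I. eval h p = 0}"
proof -
  obtain \<rho> where chi: "\<And>i. \<rho> i \<noteq> 0" "\<And>i. usub i (\<rho> i) \<in> I"
    using finite_codim_univariate[OF I] by metis
  have sub: "{p :: complex ^ 2. \<forall>h\<in>I. eval h p = 0} \<subseteq>
    (\<lambda>x. vector [fst x, snd x]) ` ({t. poly (\<rho> 1) t = 0} \<times> {t. poly (\<rho> 2) t = 0})"
  proof
    fix p :: "complex ^ 2" assume "p \<in> {p. \<forall>h\<in>I. eval h p = 0}"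
    then have "poly (\<rho> i) (p $ i) = 0" for i using chi(2)[of i] by (auto simp flip: eval_usub)
    moreover have "p = vector [p $ 1, p $ 2]" by (simp add: vec_eq_iff forall_2)
    ultimately show "p \<in> (\<lambda>x. vector [fst x, snd x]) ` ({t. poly (\<rho> 1) t = 0} \<times> {t. poly (\<rho> 2) t = 0})"
      by (intro image_eqI[of _ _ "(p $ 1, p $ 2)"]) auto
  qed
  show ?thesis by (rule finite_subset[OF sub]) (intro finite_imageI finite_cartesian_product poly_roots_finite chi)
qed

section \<open>Tjurina numbers as local codimensions\<close>

lemma local_ring_emb: "local_ring = {emb a / emb b | a b. eval b 0 \<noteq> 0}"
  by (simp add: local_ring_def Fract_emb)

lemma local_ringI: "eval b 0 \<noteq> 0 \<Longrightarrow> emb a / emb b \<in> local_ring"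
  unfolding local_ring_emb by blast

lemma emb_local_ring: "emb a \<in> local_ring"
  using local_ringI[of 1 a] by simp

lemma emb_inverse_local_ring: "eval b 0 \<noteq> 0 \<Longrightarrow> 1 / emb b \<in> local_ring"
  using local_ringI[of b 1] by simp

lemma local_ring_add: "x \<in> local_ring \<Longrightarrow> y \<in> local_ring \<Longrightarrow> x + y \<in> local_ring"
proof -
  assume "x \<in> local_ring" "y \<in> local_ring"
  then obtain a b a' b' where *: "x = emb a / emb b" "y = emb a' / emb b'" "eval b 0 \<noteq> 0" "eval b' 0 \<noteq> 0"
    unfolding local_ring_emb by blast
  then have "b \<noteq> 0" "b' \<noteq> 0" by auto
  then have "x + y = emb (a * b' + a' * b) / emb (b * b')"
    by (simp add: * emb.hom_simps add_frac_eq)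
  then show ?thesis using * by (simp add: local_ringI eval.map_mult)
qed

lemma local_ring_mult: "x \<in> local_ring \<Longrightarrow> y \<in> local_ring \<Longrightarrow> x * y \<in> local_ring"
proof -
  assume "x \<in> local_ring" "y \<in> local_ring"
  then obtain a b a' b' where *: "x = emb a / emb b" "y = emb a' / emb b'" "eval b 0 \<noteq> 0" "eval b' 0 \<noteq> 0"
    unfolding local_ring_emb by blast
  then have "x * y = emb (a * a') / emb (b * b')" by (simp add: emb.hom_simps)
  then show ?thesis using * by (simp add: local_ringI eval.map_mult)
qed

lemma local_ring_0: "0 \<in> local_ring" using emb_local_ring[of 0] by simp

lemma local_ring_sum: "(\<And>i. i \<in> A \<Longrightarrow> g i \<in> local_ring) \<Longrightarrow> sum g A \<in> local_ring"
  by (induction A rule: infinite_finite_induct) (auto intro: local_ring_add local_ring_0)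

lemma local_ring_power: "x \<in> local_ring \<Longrightarrow> x ^ n \<in> local_ring"
  using emb_local_ring[of 1] by (induction n) (auto intro: local_ring_mult)

lemma pdiff_local_eq:
  "pdiff 1 (local_eq f w) = (\<Sum>i\<in>UNIV. const (w $ 2 $ i) * local_eq (pdiff i f) w)"
  "pdiff 2 (local_eq f w) = (\<Sum>i\<in>UNIV. const (w $ 3 $ i) * local_eq (pdiff i f) w)"
  unfolding local_eq_def by (auto simp: chain_rule pdiff_add pdiff_mult pdiff_var mult.commute intro!: sum.cong)

lemma euler_local_eq:
  assumes "f \<in> homog (int d)"
  shows "const (of_nat d) * local_eq f w = (\<Sum>i\<in>UNIV. const (w $ 1 $ i) * local_eq (pdiff i f) w)
     + var 1 * pdiff 1 (local_eq f w) + var 2 * pdiff 2 (local_eq f w)"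
proof -
  have "const (of_nat d) * local_eq f w = local_eq (\<Sum>i\<in>UNIV. var i * pdiff i f) w"
    unfolding euler_identity[OF assms] by (simp add: loc.hom_simps)
  also have "\<dots> = (\<Sum>i\<in>UNIV. (const (w $ 1 $ i) + const (w $ 2 $ i) * var 1 + const (w $ 3 $ i) * var 2) * local_eq (pdiff i f) w)"
    by (simp add: loc.hom_simps local_eq_var)
  finally show ?thesis
    unfolding pdiff_local_eq by (simp add: sum_distrib_left distrib_right sum.distrib mult.assoc mult.left_commute)
qed

definition local_span :: "(3 \<Rightarrow> 2 mpoly fract) \<Rightarrow> 2 mpoly fract set" where
  "local_span F = {(\<Sum>i\<in>UNIV. r i * F i) | r. \<forall>i. r i \<in> local_ring}"

lemma local_spanI:
  assumes "\<And>i. r i \<in> local_ring" "t = (\<Sum>i\<in>UNIV. r i * F i)"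
  shows "t \<in> local_span F"
  unfolding local_span_def assms(2) using assms(1) by (intro CollectI exI[of _ r]) simp

lemma local_spanE:
  assumes "t \<in> local_span F"
  obtains r where "t = (\<Sum>i\<in>UNIV. r i * F i)" "\<And>i. r i \<in> local_ring"
  using assms unfolding local_span_def by blast

text \<open>By Euler's relation and the chain rule, \<open>g\<close>, \<open>g_u\<close>, \<open>g_v\<close> are combinations of the
  dehomogenizations of the three partial derivatives of \<open>f\<close>; as the frame is invertible, these
  relations can be solved for the latter.\<close>

lemma tjurina_ideal_partials:
  assumes f: "f \<in> homog (int d)" and d: "d \<ge> 1" and w: "invertible w"
  shows "tjurina_ideal (local_eq f w) = local_span (\<lambda>i. emb (local_eq (pdiff i f) w))" (is "?L = ?R")
proof
  let ?f = "\<lambda>i. local_eq (pdiff i f) w"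
  let ?g = "local_eq f w"
  let ?gu = "pdiff 1 ?g" and ?gv = "pdiff 2 ?g"
  let ?x = "\<lambda>i. const (w $ 1 $ i) + const (w $ 2 $ i) * var 1 + const (w $ 3 $ i) * var 2 :: 2 mpoly"
  have L: "?L = {a * emb ?g + b * emb ?gu + c * emb ?gv | a b c. a \<in> local_ring \<and> b \<in> local_ring \<and> c \<in> local_ring}"
    by (simp add: tjurina_ideal_def emb_def)
  have dx: "const (of_nat d) * ?g = (\<Sum>i\<in>UNIV. ?x i * ?f i)"
    unfolding euler_local_eq[OF f] pdiff_local_eq
    by (simp add: sum_distrib_left distrib_right sum.distrib mult.assoc mult.left_commute)
  have "const (1 / of_nat d) * (const (of_nat d) * ?g) = ?g"
    using d by (simp add: mult.assoc[symmetric] const.map_mult[symmetric])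
  then have g: "?g = (\<Sum>i\<in>UNIV. const (1 / of_nat d) * ?x i * ?f i)"
    unfolding dx by (simp add: sum_distrib_left mult.assoc)
  show "?L \<subseteq> ?R"
  proof
    fix t assume "t \<in> ?L"
    then obtain a b c where t: "t = a * emb ?g + b * emb ?gu + c * emb ?gv"
      and abc: "a \<in> local_ring" "b \<in> local_ring" "c \<in> local_ring" unfolding L by blast
    let ?r = "\<lambda>i. a * emb (const (1 / of_nat d) * ?x i) + b * emb (const (w $ 2 $ i)) + c * emb (const (w $ 3 $ i))"
    have "emb ?g = (\<Sum>i\<in>UNIV. emb (const (1 / of_nat d) * ?x i) * emb (?f i))"
      by (subst g) (simp add: emb.map_sum emb.map_mult)
    moreover have "emb ?gu = (\<Sum>i\<in>UNIV. emb (const (w $ 2 $ i)) * emb (?f i))"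
      "emb ?gv = (\<Sum>i\<in>UNIV. emb (const (w $ 3 $ i)) * emb (?f i))"
      unfolding pdiff_local_eq by (simp_all add: emb.map_sum emb.map_mult)
    ultimately have "t = (\<Sum>i\<in>UNIV. ?r i * emb (?f i))"
      unfolding t by (simp only: sum_distrib_left distrib_right sum.distrib mult.assoc)
    moreover have "?r i \<in> local_ring" for i
      by (intro local_ring_add local_ring_mult abc emb_local_ring)
    ultimately show "t \<in> ?R" by (rule local_spanI[of ?r, rotated])
  qed
  define H where "H k = (\<Sum>i\<in>UNIV. const (w $ k $ i) * ?f i)" for k
  have H: "H 1 = const (of_nat d) * ?g - var 1 * ?gu - var 2 * ?gv" "H 2 = ?gu" "H 3 = ?gv"
    using euler_local_eq[OF f, of w] by (simp_all add: H_def pdiff_local_eq)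
  have fi: "?f i = (\<Sum>k\<in>UNIV. const (matrix_inv w $ i $ k) * H k)" for i
  proof -
    have "(\<Sum>k\<in>UNIV. const (matrix_inv w $ i $ k) * H k) =
      (\<Sum>j\<in>UNIV. \<Sum>k\<in>UNIV. const (matrix_inv w $ i $ k) * (const (w $ k $ j) * ?f j))"
      unfolding H_def sum_distrib_left by (rule sum.swap)
    also have "\<dots> = (\<Sum>j\<in>UNIV. const (\<Sum>k\<in>UNIV. matrix_inv w $ i $ k * w $ k $ j) * ?f j)"
      by (simp add: const.map_sum const.map_mult sum_distrib_right mult.assoc)
    also have "\<dots> = (\<Sum>j\<in>UNIV. if j = i then ?f j else 0)"
      using matrix_inv_props(2)[OF w]
      by (intro sum.cong) (auto simp: vec_eq_iff matrix_matrix_mult_def mat_def)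
    finally show ?thesis by simp
  qed
  show "?R \<subseteq> ?L"
  proof
    fix t assume "t \<in> ?R"
    then obtain r where t: "t = (\<Sum>i\<in>UNIV. r i * emb (?f i))" and r: "\<And>i. r i \<in> local_ring"
      unfolding local_span_def by blast
    define q where "q k = (\<Sum>i\<in>UNIV. r i * emb (const (matrix_inv w $ i $ k)))" for k
    have q: "q k \<in> local_ring" for k
      unfolding q_def by (intro local_ring_sum local_ring_mult r emb_local_ring)
    have "t = (\<Sum>i\<in>UNIV. \<Sum>k\<in>UNIV. r i * (emb (const (matrix_inv w $ i $ k)) * emb (H k)))"
      unfolding t by (subst fi) (simp add: emb.map_sum emb.map_mult sum_distrib_left)
    also have "\<dots> = (\<Sum>k\<in>UNIV. q k * emb (H k))"
      unfolding q_def sum_distrib_right mult.assoc by (rule sum.swap)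
    also have "\<dots> = (q 1 * emb (const (of_nat d))) * emb ?g + (q 2 - q 1 * emb (var 1)) * emb ?gu
        + (q 3 - q 1 * emb (var 2)) * emb ?gv"
      by (simp add: sum_3 H emb.map_diff emb.map_add emb.map_mult algebra_simps)
    finally have "t = (q 1 * emb (const (of_nat d))) * emb ?g + (q 2 + q 1 * emb (- var 1)) * emb ?gu
        + (q 3 + q 1 * emb (- var 2)) * emb ?gv" by (simp add: emb.map_uminus)
    moreover have "q 1 * emb (const (of_nat d)) \<in> local_ring" "q 2 + q 1 * emb (- var 1) \<in> local_ring"
      "q 3 + q 1 * emb (- var 2) \<in> local_ring"
      by (intro local_ring_add local_ring_mult q emb_local_ring)+
    ultimately show "t \<in> ?L" unfolding L by blast
  qed
qed

lemma tjurina_ideal_subspace: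
  assumes "f \<in> homog (int d)" "d \<ge> 1" "invertible w"
  shows "fv.subspace (tjurina_ideal (local_eq f w))"
    and "\<And>x y. x \<in> local_ring \<Longrightarrow> y \<in> tjurina_ideal (local_eq f w) \<Longrightarrow> x * y \<in> tjurina_ideal (local_eq f w)"
    and "tjurina_ideal (local_eq f w) \<subseteq> local_ring"
proof -
  note T = tjurina_ideal_partials[OF assms]
  let ?T = "tjurina_ideal (local_eq f w)"
  show mul: "x * y \<in> ?T" if x: "x \<in> local_ring" and y: "y \<in> ?T" for x y
  proof -
    obtain r where r: "y = (\<Sum>i\<in>UNIV. r i * emb (local_eq (pdiff i f) w))" "\<And>i. r i \<in> local_ring"
      using y unfolding T local_span_def by blast
    have "x * y = (\<Sum>i\<in>UNIV. (x * r i) * emb (local_eq (pdiff i f) w))"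
      by (simp add: r(1) sum_distrib_left mult.assoc)
    then show ?thesis unfolding T by (rule local_spanI[rotated]) (rule local_ring_mult[OF x r(2)])
  qed
  show "?T \<subseteq> local_ring"
    unfolding T by (auto elim!: local_spanE intro!: local_ring_sum local_ring_mult emb_local_ring)
  show "fv.subspace ?T"
    unfolding fv.subspace_def
  proof (intro conjI ballI allI)
    show "0 \<in> ?T" unfolding T by (rule local_spanI[of "\<lambda>_. 0"]) (auto simp: local_ring_0)
    fix x assume x: "x \<in> ?T"
    show "fscale c x \<in> ?T" for c unfolding fscale_emb by (rule mul[OF emb_local_ring x])
    fix y assume y: "y \<in> ?T"
    obtain r where r: "x = (\<Sum>i\<in>UNIV. r i * emb (local_eq (pdiff i f) w))" "\<And>i. r i \<in> local_ring"
      using x unfolding T local_span_def by blast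
    obtain q where q: "y = (\<Sum>i\<in>UNIV. q i * emb (local_eq (pdiff i f) w))" "\<And>i. q i \<in> local_ring"
      using y unfolding T local_span_def by blast
    have "x + y = (\<Sum>i\<in>UNIV. (r i + q i) * emb (local_eq (pdiff i f) w))"
      by (simp add: r(1) q(1) distrib_right sum.distrib)
    then show "x + y \<in> ?T"
      unfolding T by (rule local_spanI[rotated]) (rule local_ring_add[OF r(2) q(2)])
  qed
qed

text \<open>The change of coordinates from the chart of the frame \<open>u\<close> to the one of \<open>w\<close>.\<close>

definition chart_map :: "complex ^ 3 ^ 3 \<Rightarrow> complex ^ 3 ^ 3 \<Rightarrow> 2 mpoly \<Rightarrow> 2 mpoly fract" where
  "chart_map u w = subst (\<lambda>c. emb (const c))
     (\<lambda>i. emb (local_eq (coord u (if i = 1 then 2 else 3)) w) / emb (local_eq (coord u 1) w))"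

lemma ring_map_emb_const: "ring_map (\<lambda>c. emb (const c :: 2 mpoly))"
  by (rule ring_map_comp[OF emb.ring_map_axioms ring_map_const])

interpretation chart: ring_map "chart_map u w" for u w
  unfolding chart_map_def by (rule ring_map_subst(1)[OF ring_map_emb_const])

lemma chart_map_const [simp]: "chart_map u w (const c) = emb (const c)"
  unfolding chart_map_def by (rule ring_map_subst(2)[OF ring_map_emb_const])

context
  fixes u w :: "complex ^ 3 ^ 3" and p :: "complex ^ 2"
  assumes u: "invertible u" and w: "invertible w" and l0: "eval (coord u 1) (w $ 1) \<noteq> 0"
    and p: "w $ 1 = eval (coord u 1) (w $ 1) *s (u $ 1 + p $ 1 *s u $ 2 + p $ 2 *s u $ 3)"
begin

private abbreviation (input) "L \<equiv> emb (local_eq (coord u 1) w)"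

lemma L_nonzero: "L \<noteq> 0"
proof
  assume "L = 0"
  then have "eval (local_eq (coord u 1) w) 0 = 0" by simp
  then show False using l0 by (simp add: eval_local_eq)
qed

text \<open>The function \<open>L\<close> is the transition function between the charts: a form of degree \<open>k\<close> changes by
  the factor \<open>L ^ k\<close>, a unit at the point considered.\<close>

lemma chart_map_homog:
  "G \<in> homog (int k) \<Longrightarrow> chart_map u w (local_eq G u) * L ^ k = emb (local_eq G w)"
proof (induction k arbitrary: G)
  case 0
  then obtain c where "G = const c" using homog_deg0[of G] by auto
  then show ?case by simp
next
  case (Suc k)
  have v: "chart_map u w (var i) * L = emb (local_eq (coord u (if i = 1 then 2 else 3)) w)" for i
    unfolding chart_map_def using L_nonzero by (simp add: ring_map_subst(3)[OF ring_map_emb_const])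
  have X: "chart_map u w (local_eq (coord u j) u) * L = emb (local_eq (coord u j) w)" for j
    using v[of 1] v[of 2] exhaust_3[of j] by (auto simp: local_eq_coord[OF u])
  obtain q where q: "\<And>i. q i \<in> homog (int k)" "G = (\<Sum>i\<in>UNIV. coord u i * q i)"
    using frame_step[of G "int k" u] Suc.prems u by (auto simp: add.commute)
  have "chart_map u w (local_eq G u) * L ^ Suc k =
    (\<Sum>i\<in>UNIV. (chart_map u w (local_eq (coord u i) u) * L) * (chart_map u w (local_eq (q i) u) * L ^ k))"
    unfolding q(2) by (simp add: loc.hom_simps chart.hom_simps sum_distrib_right sum_distrib_left algebra_simps)
  also have "\<dots> = emb (local_eq G w)"
    unfolding q(2) by (simp add: X Suc.IH[OF q(1)] loc.hom_simps emb.hom_simps)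
  finally show ?case .
qed

lemma chart_map_eq: "G \<in> homog (int k) \<Longrightarrow> chart_map u w (local_eq G u) = emb (local_eq G w) / L ^ k"
  using chart_map_homog[of G k] L_nonzero by (simp add: field_simps)

lemma eval_chart_point:
  assumes "G \<in> homog (int k)"
  shows "eval (local_eq G w) 0 = eval (coord u 1) (w $ 1) ^ k * eval (local_eq G u) p"
proof -
  have "eval (local_eq G w) 0 = eval G (w $ 1)" by (simp add: eval_local_eq)
  also have "\<dots> = eval (coord u 1) (w $ 1) ^ k * eval G (u $ 1 + p $ 1 *s u $ 2 + p $ 2 *s u $ 3)"
    by (subst p) (rule eval_scale[OF assms])
  finally show ?thesis by (simp add: eval_local_eq)
qed

lemma chart_map_inj: "chart_map u w h = 0 \<Longrightarrow> h = 0"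
proof -
  assume h: "chart_map u w h = 0"
  obtain k G where G: "G \<in> homog (int k)" "local_eq G u = h" using local_eq_surj[OF u] by blast
  then have "local_eq G w = 0" using chart_map_homog[OF G(1)] h by simp
  then have "G = 0" using local_eq_inj[OF w G(1)] by blast
  then show "h = 0" using G(2) by simp
qed

lemma L_unit: "1 / L ^ k \<in> local_ring"
  using emb_inverse_local_ring[of "local_eq (coord u 1) w ^ k"] l0
  by (simp add: emb.map_power eval.map_power eval_local_eq)

lemma chart_map_local_ring: "chart_map u w h \<in> local_ring"
proof -
  obtain k G where G: "G \<in> homog (int k)" "local_eq G u = h" using local_eq_surj[OF u] by blast
  show ?thesis
    using local_ring_mult[OF emb_local_ring[of "local_eq G w"] L_unit[of k]] chart_map_eq[OF G(1)] G(2) by simp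
qed

lemma chart_map_unit: "eval b p \<noteq> 0 \<Longrightarrow> 1 / chart_map u w b \<in> local_ring"
proof -
  assume b: "eval b p \<noteq> 0"
  obtain k G where G: "G \<in> homog (int k)" "local_eq G u = b" using local_eq_surj[OF u] by blast
  have "eval (local_eq G w) 0 \<noteq> 0" using eval_chart_point[OF G(1)] G(2) b l0 by simp
  then have "emb (local_eq (coord u 1) w ^ k) / emb (local_eq G w) \<in> local_ring" by (rule local_ringI)
  then show ?thesis using chart_map_eq[OF G(1)] G(2) by (simp add: emb.map_power)
qed

lemma local_ring_fraction:
  assumes "r \<in> local_ring"
  shows "\<exists>a b. eval b p \<noteq> 0 \<and> chart_map u w b * r = chart_map u w a"
proof -
  obtain a b where ab: "r = emb a / emb b" "eval b 0 \<noteq> 0" using assms unfolding local_ring_emb by blast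
  obtain k A where A: "A \<in> homog (int k)" "local_eq A w = a" using local_eq_surj[OF w] by blast
  obtain l B where B: "B \<in> homog (int l)" "local_eq B w = b" using local_eq_surj[OF w] by blast
  note ra = dehom_raise[OF ring_map_local_eq local_eq_coord(1)[OF w]]
  obtain A' where A': "A' \<in> homog (int (k + l))" "local_eq A' w = a" using ra[OF A, of "k + l"] by auto
  obtain B' where B': "B' \<in> homog (int (k + l))" "local_eq B' w = b" using ra[OF B, of "k + l"] by auto
  have "eval (local_eq B' u) p \<noteq> 0" using eval_chart_point[OF B'(1)] B'(2) ab(2) l0 by simp
  moreover have "emb b \<noteq> 0" using ab(2) by auto
  then have "chart_map u w (local_eq B' u) * r = chart_map u w (local_eq A' u)"
    unfolding chart_map_eq[OF A'(1)] chart_map_eq[OF B'(1)] A'(2) B'(2) ab(1) by simp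
  ultimately show ?thesis by blast
qed

context
  fixes f :: "3 mpoly" and d :: nat
  assumes f: "f \<in> homog (int d)" and d: "d \<ge> 1"
begin

private abbreviation (input) "I \<equiv> ideal_gen (\<lambda>i. local_eq (pdiff i f) u)"
private abbreviation (input) "T \<equiv> tjurina_ideal (local_eq f w)"

lemma partial_chart_map:
  "emb (local_eq (pdiff i f) w) = chart_map u w (local_eq (pdiff i f) u) * L ^ (d - 1)"
  using chart_map_homog[of "pdiff i f" "d - 1"] pdiff_homog[OF f, of i] d by (simp add: of_nat_diff)

text \<open>Clearing denominators turns a combination of the partial derivatives with coefficients in the
  local ring into one with polynomial coefficients, and back.\<close>

lemma chart_map_tjurina_iff: "chart_map u w h \<in> T \<longleftrightarrow> h \<in> loc_ker I p"
proof
  note T = tjurina_ideal_partials[OF f d w]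
  assume "h \<in> loc_ker I p"
  then obtain b a where b: "eval b p \<noteq> 0" and a: "b * h = (\<Sum>i\<in>UNIV. a i * local_eq (pdiff i f) u)"
    unfolding loc_ker_def ideal_gen_def by blast
  have b0: "chart_map u w b \<noteq> 0" using b chart_map_inj[of b] by auto
  let ?r = "\<lambda>i. chart_map u w (a i) * (1 / L ^ (d - 1)) * (1 / chart_map u w b)"
  have "chart_map u w b * chart_map u w h = (\<Sum>i\<in>UNIV. chart_map u w (a i) * chart_map u w (local_eq (pdiff i f) u))"
    using arg_cong[OF a, of "chart_map u w"] by (simp add: chart.hom_simps)
  also have "\<dots> = (\<Sum>i\<in>UNIV. chart_map u w b * (?r i * emb (local_eq (pdiff i f) w)))"
    unfolding partial_chart_map using b0 L_nonzero by (intro sum.cong) auto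
  finally have "chart_map u w h = (\<Sum>i\<in>UNIV. ?r i * emb (local_eq (pdiff i f) w))"
    using b0 unfolding sum_distrib_left[symmetric] by simp
  moreover have "?r i \<in> local_ring" for i
    by (intro local_ring_mult chart_map_local_ring L_unit chart_map_unit b)
  ultimately show "chart_map u w h \<in> T" unfolding T by (rule local_spanI[of ?r, rotated])
next
  note T = tjurina_ideal_partials[OF f d w]
  assume "chart_map u w h \<in> T"
  then obtain r where r: "chart_map u w h = (\<Sum>i\<in>UNIV. r i * emb (local_eq (pdiff i f) w))" "\<And>i. r i \<in> local_ring"
    unfolding T local_span_def by blast
  have "\<forall>i. \<exists>a b. eval b p \<noteq> 0 \<and> chart_map u w b * (r i * L ^ (d - 1)) = chart_map u w a"
    by (intro allI local_ring_fraction local_ring_mult r local_ring_power emb_local_ring)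
  then obtain a b where ab: "\<And>i. eval (b i) p \<noteq> 0"
    "\<And>i. chart_map u w (b i) * (r i * L ^ (d - 1)) = chart_map u w (a i)" by metis
  let ?b = "\<Prod>i\<in>UNIV. b i"
  let ?c = "\<lambda>i. \<Prod>j\<in>UNIV - {i}. b j"
  have "chart_map u w (?b * h) = (\<Sum>i\<in>UNIV. chart_map u w ?b * (r i * L ^ (d - 1)) * chart_map u w (local_eq (pdiff i f) u))"
    unfolding chart.map_mult r(1) partial_chart_map by (simp add: sum_distrib_left mult.assoc mult.commute mult.left_commute)
  also have "\<dots> = (\<Sum>i\<in>UNIV. chart_map u w (?c i * a i * local_eq (pdiff i f) u))"
  proof (intro sum.cong refl)
    fix i
    have "?b = b i * ?c i" by (rule prod.remove) auto
    then have "chart_map u w ?b = chart_map u w (?c i) * chart_map u w (b i)"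
      by (simp only: chart.map_mult mult.commute)
    then have "chart_map u w ?b * (r i * L ^ (d - 1)) = chart_map u w (?c i) * chart_map u w (a i)"
      by (simp only: mult.assoc ab(2))
    then show "chart_map u w ?b * (r i * L ^ (d - 1)) * chart_map u w (local_eq (pdiff i f) u) =
        chart_map u w (?c i * a i * local_eq (pdiff i f) u)"
      by (simp only: chart.map_mult)
  qed
  finally have "chart_map u w (?b * h - (\<Sum>i\<in>UNIV. ?c i * a i * local_eq (pdiff i f) u)) = 0"
    unfolding chart.map_diff chart.map_sum by simp
  then have "?b * h = (\<Sum>i\<in>UNIV. (?c i * a i) * local_eq (pdiff i f) u)"
    by (rule iffD1[OF right_minus_eq, OF chart_map_inj])
  then have "?b * h \<in> I" by (simp only: ideal_genI)
  moreover have "eval ?b p \<noteq> 0" using ab(1) by (simp add: eval.map_prod)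
  ultimately show "h \<in> loc_ker I p" unfolding loc_ker_def by blast
qed

text \<open>The polynomials already represent the whole local ring modulo the ideal, since denominators are
  invertible modulo the primary component.\<close>

lemma local_dimension:
  assumes fin: "mp.fin_quot UNIV I"
  shows "quot_dim fscale local_ring T = quot_dim mscale UNIV (loc_ker I p)"
proof (rule quot_dim_transport(2)[where T = "chart_map u w"])
  note I = ideal_gen_ideal[of "\<lambda>i. local_eq (pdiff i f) u"]
  note K = loc_ker_ideal[OF I, of p]
  show "mp.fin_quot UNIV (loc_ker I p)"
    by (rule mp.fin_quot_mono[OF ideal_subspace[OF I] ideal_subspace[OF K] loc_ker_sup[OF I] fin])
  show "module.subspace mscale (loc_ker I p)" by (rule ideal_subspace[OF K])
  show "module.subspace fscale T" by (rule tjurina_ideal_subspace[OF f d w])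
  show "chart_map u w (mscale c x) = fscale c (chart_map u w x)" for c x
    by (simp add: mscale_def fscale_emb chart.map_mult)
  show "chart_map u w v \<in> T \<longleftrightarrow> v \<in> loc_ker I p" for v by (rule chart_map_tjurina_iff)
  show "\<exists>v\<in>UNIV. chart_map u w v - r \<in> T" if r: "r \<in> local_ring" for r
  proof -
    obtain a b where ab: "eval b p \<noteq> 0" "chart_map u w b * r = chart_map u w a" using local_ring_fraction[OF r] by blast
    obtain c where "c * b - 1 \<in> loc_ker I p" using loc_ker_unit[OF I fin ab(1)] by blast
    then have "chart_map u w (c * b - 1) \<in> T" by (simp only: chart_map_tjurina_iff)
    then have "r * chart_map u w (c * b - 1) \<in> T" using tjurina_ideal_subspace(2)[OF f d w r] by blast
    also have "r * chart_map u w (c * b - 1) = chart_map u w c * (chart_map u w b * r) - r"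
      by (simp add: chart.hom_simps algebra_simps)
    finally show ?thesis unfolding ab(2) chart.map_mult[symmetric] by blast
  qed
qed (auto simp: mp.cvs_axioms fv.cvs_axioms mp.subspace_UNIV chart.map_add chart_map_local_ring)

end

end

lemma fscale_eq: "(\<lambda>c x. Fract (const c) 1 * x) = fscale"
  by (intro ext) (simp add: fscale_def)

text \<open>What is known of the frame chosen in the definition of the local Tjurina number.\<close>

lemma some_frame:
  assumes "v \<noteq> 0"
  obtains c where "c \<noteq> 0" "invertible (SOME w. frame_at (vec.span {v}) w)"
    "(SOME w. frame_at (vec.span {v}) w) $ 1 = c *s v"
proof -
  let ?w = "SOME w. frame_at (vec.span {v}) w"
  obtain w0 :: "complex ^ 3 ^ 3" where "invertible w0" "w0 $ 1 = v" using frame_through[OF assms] by blast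
  then have "frame_at (vec.span {v}) w0" by (simp add: frame_at_def vec.span_base)
  then have "frame_at (vec.span {v}) ?w" by (rule someI)
  then have w: "?w $ 1 \<in> vec.span {v}" "invertible ?w" by (auto simp: frame_at_def)
  then obtain c where c: "?w $ 1 = c *s v" by (auto simp: vec.span_singleton)
  have "c \<noteq> 0"
  proof
    assume "c = 0"
    then have "eval (coord ?w 1) (?w $ 1) = 0" using c eval_scale[of "coord ?w 1" 1 0 0] coord_homog[of ?w 1] by simp
    then show False using eval_coord_row[OF w(2), of 1 1] by simp
  qed
  then show ?thesis using that w(2) c by blast
qed

lemma tjurina_at_smooth:
  assumes f: "f \<in> homog (int d)" and d: "d \<ge> 1" and v: "v \<noteq> 0" and i: "eval (pdiff i f) v \<noteq> 0"
  shows "tjurina_at f (vec.span {v}) = 0"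
proof -
  let ?w = "SOME w. frame_at (vec.span {v}) w"
  obtain c where c: "c \<noteq> 0" "invertible ?w" "?w $ 1 = c *s v" using some_frame[OF v] .
  have pd: "pdiff i f \<in> homog (int (d - 1))" using pdiff_homog[OF f, of i] d by (simp add: of_nat_diff)
  have e0: "eval (local_eq (pdiff i f) ?w) 0 \<noteq> 0"
    using i c(1) by (simp add: eval_local_eq c(3) eval_scale[OF pd])
  let ?T = "tjurina_ideal (local_eq f ?w)"
  note T = tjurina_ideal_partials[OF f d c(2)]
  have "(\<Sum>j\<in>UNIV. (if j = i then 1 else 0) * emb (local_eq (pdiff j f) ?w)) = (\<Sum>j\<in>UNIV. if j = i then emb (local_eq (pdiff j f) ?w) else 0)"
    by (intro sum.cong) auto
  then have "emb (local_eq (pdiff i f) ?w) = (\<Sum>j\<in>UNIV. (if j = i then 1 else 0) * emb (local_eq (pdiff j f) ?w))" by simp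
  moreover have "(if j = i then 1 else 0) \<in> local_ring" for j using emb_local_ring[of 1] local_ring_0 by auto
  ultimately have "emb (local_eq (pdiff i f) ?w) \<in> ?T"
    unfolding T by (rule local_spanI[of "\<lambda>j. if j = i then 1 else 0", rotated])
  then have "1 / emb (local_eq (pdiff i f) ?w) * emb (local_eq (pdiff i f) ?w) \<in> ?T"
    by (rule tjurina_ideal_subspace(2)[OF f d c(2) emb_inverse_local_ring[OF e0]])
  moreover have "local_eq (pdiff i f) ?w \<noteq> 0" using e0 by auto
  ultimately have "1 \<in> ?T" by simp
  then have "local_ring \<subseteq> ?T" using tjurina_ideal_subspace(2)[OF f d c(2), of _ 1] by auto
  then show ?thesis
    unfolding tjurina_at_def fscale_eq using fv.quot_dim_trivial(2)[OF tjurina_ideal_subspace(1)[OF f d c(2)]] by blast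
qed

text \<open>Take the chart complementary to a line missing the singular points. In large degrees the graded
  pieces of the Jacobian algebra are the algebra \<open>\<complex>[u, v]/I\<close> of this chart, whose dimension is the
  sum of the dimensions of its localizations, and these are the Tjurina algebras.\<close>

theorem hilbert_function_jacobian:
  assumes f: "f \<in> homog (int d)" and d: "d \<ge> 1" and sqf: "squarefree f"
  shows "\<exists>m1. \<forall>m\<ge>m1. quot_dim mscale (homog (int m)) (jac f (int d) (int m)) = tjurina f"
proof -
  obtain w0 where w0: "invertible w0"
    and miss: "\<And>v. v \<noteq> 0 \<Longrightarrow> eval (coord w0 3) v = 0 \<Longrightarrow> \<exists>i. eval (pdiff i f) v \<noteq> 0"
    using line_missing_singularities[OF f d sqf] by blast
  let ?\<sigma> = "\<lambda>i::3. if i = 1 then 3 else if i = 2 then 1 else 2 :: 3"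
  have i\<sigma>: "inj ?\<sigma>"
  proof (rule injI)
    fix x y :: 3 assume "?\<sigma> x = ?\<sigma> y"
    then show "x = y" using exhaust_3[of x] exhaust_3[of y] by auto
  qed
  \<comment> \<open>The cyclic permutation makes the line the line at infinity of the chart of \<open>u\<close>.\<close>
  define u where "u = permute ?\<sigma> w0"
  have u: "invertible u" "coord u 1 = coord w0 3"
    using invertible_permute[OF w0 i\<sigma>] coord_permute[OF w0 i\<sigma>, of 1] by (auto simp: u_def)
  obtain m1 where m1: "\<And>m. m \<ge> m1 \<Longrightarrow> quot_dim mscale (homog (int m)) (jac f (int d) (int m)) =
      quot_dim mscale (homog (int m1)) (jac f (int d) (int m1))"
    "\<And>m h. m \<ge> m1 \<Longrightarrow> h \<in> homog (int m) \<Longrightarrow> coord u 1 * h \<in> jac f (int d) (int (Suc m)) \<Longrightarrow> h \<in> jac f (int d) (int m)"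
    "\<And>m h. m \<ge> m1 \<Longrightarrow> h \<in> homog (int (Suc m)) \<Longrightarrow> \<exists>h'\<in>homog (int m). coord u 1 * h' - h \<in> jac f (int d) (int (Suc m))"
    using jac_stabilization[OF f d w0 miss] unfolding u(2) by blast
  define I where "I = ideal_gen (\<lambda>i. local_eq (pdiff i f) u)"
  have fin: "mp.fin_quot UNIV I"
    and codim: "quot_dim mscale UNIV I = quot_dim mscale (homog (int m1)) (jac f (int d) (int m1))"
    using chart_codim[OF f d u(1) m1(2,3)] unfolding I_def by auto
  have I: "is_ideal I" unfolding I_def by (rule ideal_gen_ideal)
  define pt where "pt p = u $ 1 + p $ 1 *s u $ 2 + p $ 2 *s u $ 3" for p :: "complex ^ 2"
  have pt_coord: "eval (coord u 1) (pt p) = 1" "eval (coord u 2) (pt p) = p $ 1" "eval (coord u 3) (pt p) = p $ 2" for p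
    using eval_coord[OF u(1), of _ "\<lambda>k. if k = 1 then 1 else if k = 2 then p $ 1 else p $ 2"]
    by (auto simp: sum_3 pt_def)
  have pt0: "pt p \<noteq> 0" for p
  proof
    assume "pt p = 0"
    then show False using pt_coord(1)[of p] eval_scale[of "coord u 1" 1 0 0] coord_homog[of u 1] by simp
  qed
  define Z where "Z = {p. \<forall>h\<in>I. eval h p = 0}"
  have finZ: "finite Z" unfolding Z_def by (rule finite_zeros[OF I fin])
  have Z_iff: "p \<in> Z \<longleftrightarrow> (\<forall>i. eval (pdiff i f) (pt p) = 0)" for p
  proof
    assume "p \<in> Z"
    then have "eval (local_eq (pdiff i f) u) p = 0" for i
      using ideal_gen_base[of "\<lambda>i. local_eq (pdiff i f) u" i] unfolding Z_def I_def by blast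
    then show "\<forall>i. eval (pdiff i f) (pt p) = 0" by (simp add: eval_local_eq pt_def)
  next
    assume "\<forall>i. eval (pdiff i f) (pt p) = 0"
    then have *: "eval (local_eq (pdiff i f) u) p = 0" for i by (simp add: eval_local_eq pt_def)
    show "p \<in> Z"
      unfolding Z_def
    proof (intro CollectI ballI)
      fix h assume "h \<in> I"
      then obtain a where "h = (\<Sum>i\<in>UNIV. a i * local_eq (pdiff i f) u)" by (auto simp: I_def ideal_gen_def)
      then show "eval h p = 0" by (simp add: eval.hom_simps *)
    qed
  qed
  define \<Phi> where "\<Phi> p = vec.span {pt p}" for p
  have inj: "inj \<Phi>"
  proof (rule injI)
    fix p q assume "\<Phi> p = \<Phi> q"
    then have "pt q \<in> vec.span {pt p}" using vec.span_base[of "pt q" "{pt q}"] by (simp add: \<Phi>_def)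
    then obtain c where c: "pt q = c *s pt p" by (auto simp: vec.span_singleton)
    have e: "eval (coord u j) (pt q) = c * eval (coord u j) (pt p)" for j
      unfolding c using eval_scale[of "coord u j" 1 c] coord_homog[of u j] by simp
    have "c = 1" using e[of 1] unfolding pt_coord by simp
    moreover have "q $ 1 = c * p $ 1" using e[of 2] unfolding pt_coord .
    moreover have "q $ 2 = c * p $ 2" using e[of 3] unfolding pt_coord .
    ultimately show "p = q" by (simp add: vec_eq_iff forall_2)
  qed
  have loc: "tjurina_at f (\<Phi> p) = quot_dim mscale UNIV (loc_ker I p)" for p
  proof -
    let ?w = "SOME w. frame_at (vec.span {pt p}) w"
    obtain c where c: "c \<noteq> 0" "invertible ?w" "?w $ 1 = c *s pt p" using some_frame[OF pt0] .
    have e: "eval (coord u 1) (?w $ 1) = c"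
      unfolding c(3) using eval_scale[of "coord u 1" 1 c "pt p"] coord_homog[of u 1] pt_coord(1)[of p] by simp
    show ?thesis
      unfolding tjurina_at_def fscale_eq \<Phi>_def I_def
    proof (rule local_dimension[OF u(1) c(2) _ _ f d fin[unfolded I_def]])
      show "eval (coord u 1) (?w $ 1) \<noteq> 0" using e c(1) by simp
      show "?w $ 1 = eval (coord u 1) (?w $ 1) *s (u $ 1 + p $ 1 *s u $ 2 + p $ 2 *s u $ 3)"
        unfolding e using c(3) unfolding pt_def .
    qed
  qed
  have sub: "\<Phi> ` Z \<subseteq> curve f"
  proof
    fix P assume "P \<in> \<Phi> ` Z"
    then obtain p where p: "p \<in> Z" "P = vec.span {pt p}" by (auto simp: \<Phi>_def)
    have "eval f (pt p) = 0" using singular_imp_on_curve[OF f d] p(1) Z_iff by blast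
    then have "vanishes f P"
      by (auto simp: vanishes_def p(2) vec.span_singleton eval_scale[OF f])
    then show "P \<in> curve f" unfolding curve_def proj_plane_def p(2) using pt0 by blast
  qed
  have zero: "tjurina_at f P = 0" if P: "P \<in> curve f" "P \<notin> \<Phi> ` Z" for P
  proof -
    obtain v where v: "P = vec.span {v}" "v \<noteq> 0" using P(1) by (auto simp: curve_def proj_plane_def)
    have "\<exists>i. eval (pdiff i f) v \<noteq> 0"
    proof (rule ccontr)
      assume "\<not> ?thesis"
      then have sing: "\<And>i. eval (pdiff i f) v = 0" by blast
      define c where "c = eval (coord u 1) v"
      have c: "c \<noteq> 0" using miss[OF v(2)] sing unfolding c_def u(2) by blast
      define p :: "complex ^ 2" where "p = vector [eval (coord u 2) v / c, eval (coord u 3) v / c]"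
      have vp: "v = c *s pt p"
      proof -
        have "v = c *s u $ 1 + eval (coord u 2) v *s u $ 2 + eval (coord u 3) v *s u $ 3"
          using vec_as_rows[OF u(1), of v] by (simp add: sum_3 c_def)
        also have "\<dots> = c *s pt p" using c by (simp add: pt_def p_def vec_eq_iff algebra_simps)
        finally show ?thesis .
      qed
      have pd: "pdiff i f \<in> homog (int (d - 1))" for i using pdiff_homog[OF f, of i] d by (simp add: of_nat_diff)
      have "eval (pdiff i f) (pt p) = 0" for i
        using sing[of i] eval_scale[OF pd[of i], of c "pt p"] c vp by simp
      then have "p \<in> Z" using Z_iff by blast
      moreover have "P = \<Phi> p"
        unfolding v(1) \<Phi>_def
      proof (rule vec.span_eq[THEN iffD2], intro conjI subsetI)
        show "x \<in> vec.span {pt p}" if "x \<in> {v}" for x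
          using that vp by (auto simp: vec.span_singleton)
        have "pt p = (1 / c) *s v" using c by (simp add: vp)
        then show "x \<in> vec.span {v}" if "x \<in> {pt p}" for x
          using that by (auto simp: vec.span_singleton)
      qed
      ultimately show False using P(2) by blast
    qed
    then show ?thesis unfolding v(1) using tjurina_at_smooth[OF f d v(2)] by blast
  qed
  have "tjurina f = (\<Sum>P\<in>\<Phi> ` Z. tjurina_at f P)"
    unfolding tjurina_def
  proof (rule sum.mono_neutral_left)
    show "{P \<in> curve f. tjurina_at f P \<noteq> 0} \<subseteq> \<Phi> ` Z"
    proof (rule subsetI, rule ccontr)
      fix P assume P: "P \<in> {P \<in> curve f. tjurina_at f P \<noteq> 0}" "P \<notin> \<Phi> ` Z"
      then have "tjurina_at f P = 0" by (intro zero) auto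
      then show False using P(1) by simp
    qed
  qed (use finZ sub in auto)
  also have "\<dots> = (\<Sum>p\<in>Z. quot_dim mscale UNIV (loc_ker I p))"
    by (subst sum.reindex) (auto intro: inj_on_subset[OF inj] simp: loc)
  also have "\<dots> = quot_dim mscale UNIV (\<Inter>p\<in>Z. loc_ker I p)" by (rule codim_sum[OF I fin finZ, symmetric])
  also have "(\<Inter>p\<in>Z. loc_ker I p) = I" unfolding Z_def by (rule Inter_loc_ker[OF I fin])
  finally have t: "tjurina f = quot_dim mscale UNIV I" .
  show ?thesis
  proof (intro exI[of _ m1] allI impI)
    fix m assume "m1 \<le> m"
    from m1(1)[OF this] show "quot_dim mscale (homog (int m)) (jac f (int d) (int m)) = tjurina f"
      unfolding t codim .
  qed
qed

section \<open>The points of a line\<close>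

definition aff_pt :: "complex ^ 3 ^ 3 \<Rightarrow> complex \<Rightarrow> point" where
  "aff_pt w t = vec.span {w $ 1 + t *s w $ 2}"

definition inf_pt :: "complex ^ 3 ^ 3 \<Rightarrow> point" where
  "inf_pt w = vec.span {w $ 2}"

lemma nonvanishing_span:
  assumes "v \<noteq> 0" "g \<in> homog k"
  shows "nonvanishing g (vec.span {v}) \<longleftrightarrow> eval g v \<noteq> 0"
proof (cases "k < 0")
  case True
  then have "g = 0" using homog_neg assms(2) by blast
  then show ?thesis using assms(1) vec.span_base[of v "{v}"] by (auto simp: nonvanishing_def)
next
  case False
  then have g: "g \<in> homog (int (nat k))" using assms(2) by simp
  show ?thesis
  proof
    show "nonvanishing g (vec.span {v}) \<Longrightarrow> eval g v \<noteq> 0"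
      using assms(1) vec.span_base[of v "{v}"] by (auto simp: nonvanishing_def)
    show "eval g v \<noteq> 0 \<Longrightarrow> nonvanishing g (vec.span {v})"
      by (auto simp: nonvanishing_def vec.span_singleton eval_scale[OF g])
  qed
qed

lemma vanishes_span:
  assumes "v \<noteq> 0" "g \<in> homog k"
  shows "vanishes g (vec.span {v}) \<longleftrightarrow> eval g v = 0"
proof (cases "k < 0")
  case True
  then have "g = 0" using homog_neg assms(2) by blast
  then show ?thesis by (auto simp: vanishes_def)
next
  case False
  then have g: "g \<in> homog (int (nat k))" using assms(2) by simp
  show ?thesis
  proof
    show "vanishes g (vec.span {v}) \<Longrightarrow> eval g v = 0"
      using assms(1) vec.span_base[of v "{v}"] by (auto simp: vanishes_def)
    show "eval g v = 0 \<Longrightarrow> vanishes g (vec.span {v})"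
      by (auto simp: vanishes_def vec.span_singleton eval_scale[OF g])
  qed
qed

lemma eval_coord_zero: "eval (coord w j) 0 = 0"
  using eval_scale[of "coord w j" 1 0 0] coord_homog[of w j] by simp

lemma eval_coord_aff:
  assumes "invertible w"
  shows "eval (coord w 1) (w $ 1 + t *s w $ 2) = 1" "eval (coord w 2) (w $ 1 + t *s w $ 2) = t"
    "eval (coord w 3) (w $ 1 + t *s w $ 2) = 0"
  using eval_coord[OF assms, of _ "\<lambda>k. if k = 1 then 1 else if k = 2 then t else 0"] by (auto simp: sum_3)

lemma aff_nonzero: "invertible (w :: complex ^ 3 ^ 3) \<Longrightarrow> w $ 1 + t *s w $ 2 \<noteq> 0"
  using eval_coord_aff(1)[of w t] eval_coord_zero[of w 1] by auto

lemma inf_nonzero: "invertible (w :: complex ^ 3 ^ 3) \<Longrightarrow> w $ 2 \<noteq> 0"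
  using eval_coord_row[of w 2 2] eval_coord_zero[of w 2] by auto

lemma nonvanishing_aff:
  "invertible w \<Longrightarrow> g \<in> homog k \<Longrightarrow> nonvanishing g (aff_pt w t) \<longleftrightarrow> poly (rest w g) t \<noteq> 0"
  unfolding aff_pt_def by (simp add: nonvanishing_span[OF aff_nonzero] poly_rest)

lemma nonvanishing_inf:
  assumes "invertible w" "g \<in> homog (int k)"
  shows "nonvanishing g (inf_pt w) \<longleftrightarrow> coeff (rest w g) k \<noteq> 0"
  unfolding inf_pt_def using nonvanishing_span[OF inf_nonzero[OF assms(1)] assms(2)]
  by (simp add: coeff_rest_infinity[OF assms])

lemma line_points:
  assumes w: "invertible w"
  shows "P \<in> curve (coord w 3) \<longleftrightarrow> (\<exists>t. P = aff_pt w t) \<or> P = inf_pt w"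
proof
  assume "P \<in> curve (coord w 3)"
  then obtain v where v: "P = vec.span {v}" "v \<noteq> 0" "vanishes (coord w 3) P"
    by (auto simp: curve_def proj_plane_def)
  then have "eval (coord w 3) v = 0" using vanishes_span[OF v(2) coord_homog] by simp
  then obtain a b where ve: "v = a *s w $ 1 + b *s w $ 2"
    using vec_as_rows[OF w, of v] by (auto simp: sum_3)
  have span_scale: "vec.span {c *s x} = vec.span {x}" if "c \<noteq> 0" for c :: complex and x :: "complex ^ 3"
  proof (rule vec.span_eq[THEN iffD2], intro conjI subsetI)
    show "y \<in> vec.span {x}" if "y \<in> {c *s x}" for y using that by (auto simp: vec.span_singleton)
    have "x = (1 / c) *s (c *s x)" using \<open>c \<noteq> 0\<close> by simp
    then show "y \<in> vec.span {c *s x}" if "y \<in> {x}" for y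
      using that unfolding vec.span_singleton by blast
  qed
  show "(\<exists>t. P = aff_pt w t) \<or> P = inf_pt w"
  proof (cases "a = 0")
    case True
    then have "b \<noteq> 0" "v = b *s w $ 2" using ve v(2) by auto
    then have "P = inf_pt w" unfolding v(1) inf_pt_def by (simp only: span_scale not_False_eq_True)
    then show ?thesis by blast
  next
    case False
    have "v = a *s (w $ 1 + (b / a) *s w $ 2)"
      unfolding ve using False by (simp add: vec_eq_iff algebra_simps)
    then have "P = aff_pt w (b / a)"
      unfolding v(1) aff_pt_def by (simp only: span_scale[OF False])
    then show ?thesis by blast
  qed
next
  have "aff_pt w t \<in> curve (coord w 3)" for t
    unfolding curve_def proj_plane_def aff_pt_def
    using aff_nonzero[OF w, of t] vanishes_span[OF aff_nonzero[OF w, of t] coord_homog, of w 3] eval_coord_aff(3)[OF w]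
    by blast
  moreover have "inf_pt w \<in> curve (coord w 3)"
    unfolding curve_def proj_plane_def inf_pt_def
    using inf_nonzero[OF w] vanishes_span[OF inf_nonzero[OF w] coord_homog, of w 3] eval_coord_row[OF w, of 3 2]
    by auto
  ultimately show "(\<exists>t. P = aff_pt w t) \<or> P = inf_pt w \<Longrightarrow> P \<in> curve (coord w 3)" by auto
qed

lemma nonvanishing_imp_rest:
  assumes w: "invertible w" and P: "P \<in> curve (coord w 3)" and g: "g \<in> homog k" "nonvanishing g P"
  shows "rest w g \<noteq> 0" "k \<ge> 0"
proof -
  obtain v where v: "P = vec.span {v}" "v \<noteq> 0" using P by (auto simp: curve_def proj_plane_def)
  have "eval g v \<noteq> 0" using nonvanishing_span[OF v(2) g(1)] g(2) v(1) by simp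
  then have "g \<noteq> 0" by auto
  then show k: "k \<ge> 0" using homog_neg[OF g(1)] by force
  show "rest w g \<noteq> 0"
  proof
    assume "rest w g = 0"
    then have "\<not> nonvanishing g (aff_pt w t)" "\<not> nonvanishing g (inf_pt w)" for t
      using nonvanishing_aff[OF w g(1)] nonvanishing_inf[OF w, of g "nat k"] g(1) k by auto
    then show False using g(2) P unfolding line_points[OF w] by blast
  qed
qed

lemma nonvanishing_mult:
  "nonvanishing (g * h) P \<longleftrightarrow> nonvanishing g P \<and> nonvanishing h P"
  by (auto simp: nonvanishing_def eval.map_mult)

lemma open_in_restrict:
  assumes "open_in L V" "g \<in> homog k"
  shows "open_in L {P \<in> V. nonvanishing g P}"
proof -
  obtain G where G: "G \<subseteq> (\<Union>k. homog k)" "V = {P \<in> proj_plane. \<exists>g\<in>G. nonvanishing g P} \<inter> L"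
    using assms(1) by (auto simp: open_in_def zariski_open_def)
  let ?G = "(\<lambda>h. h * g) ` G"
  have "?G \<subseteq> (\<Union>k. homog k)" using G(1) assms(2) homog_mult by fastforce
  moreover have "{P \<in> V. nonvanishing g P} = {P \<in> proj_plane. \<exists>g\<in>?G. nonvanishing g P} \<inter> L"
    using G(2) by (auto simp: nonvanishing_mult)
  ultimately show ?thesis unfolding open_in_def zariski_open_def by blast
qed

lemma open_in_basic: "g \<in> homog k \<Longrightarrow> L \<subseteq> proj_plane \<Longrightarrow> open_in L {P \<in> L. nonvanishing g P}"
  unfolding open_in_def zariski_open_def
  by (intro exI[of _ "{P \<in> proj_plane. \<exists>h\<in>{g}. nonvanishing h P}"] conjI exI[of _ "{g}"]) auto

text \<open>A form that does not vanish at some point of the line has only finitely many zeros on it. In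
  particular, any two nonempty open subsets of the line intersect.\<close>

lemma open_in_cofinite:
  assumes w: "invertible w" and V: "open_in (curve (coord w 3)) V" "P \<in> V"
  shows "\<exists>p. p \<noteq> 0 \<and> (\<forall>t. poly p t \<noteq> 0 \<longrightarrow> aff_pt w t \<in> V)"
proof -
  let ?L = "curve (coord w 3)"
  obtain G where G: "G \<subseteq> (\<Union>k. homog k)" "V = {P \<in> proj_plane. \<exists>g\<in>G. nonvanishing g P} \<inter> ?L"
    using V(1) by (auto simp: open_in_def zariski_open_def)
  then obtain g k where g: "g \<in> G" "g \<in> homog k" "nonvanishing g P" "P \<in> ?L" using V(2) by blast
  have "aff_pt w t \<in> V" if "poly (rest w g) t \<noteq> 0" for t
  proof -
    have "aff_pt w t \<in> ?L" using line_points[OF w] by blast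
    then show ?thesis
      using that nonvanishing_aff[OF w g(2)] g(1) G(2) by (auto simp: curve_def)
  qed
  then show ?thesis using nonvanishing_imp_rest(1)[OF w g(4,2,3)] by blast
qed

lemma poly_nonroot: "p \<noteq> 0 \<Longrightarrow> \<exists>t::complex. poly p t \<noteq> 0"
  using poly_all_0_iff_0 by blast

section \<open>Sections of the restricted sheaf as vectors of rational functions\<close>

text \<open>The restriction of the fraction \<open>m / g\<close> to the line, in terms of the affine coordinate.\<close>

definition rfrac :: "complex ^ 3 ^ 3 \<Rightarrow> 3 mpoly ^ 'n \<Rightarrow> 3 mpoly \<Rightarrow> (complex poly fract) ^ 'n" where
  "rfrac w m g = (\<chi> i. emb (rest w (m $ i)) / emb (rest w g))"

text \<open>The graded modules to be treated: \<open>D i\<close> is the shift of the \<open>i\<close>-th coordinate, and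
  divisibility by the equation of the line can be checked in the free module.\<close>

locale line_module =
  fixes w :: "complex ^ 3 ^ 3" and M :: "'n::finite gmod" and D :: "'n \<Rightarrow> int"
  assumes w: "invertible w"
    and M_homog: "m \<in> M k \<Longrightarrow> m $ i \<in> homog (k - D i)"
    and M_0: "0 \<in> M k"
    and M_add: "m \<in> M k \<Longrightarrow> m' \<in> M k \<Longrightarrow> m + m' \<in> M k"
    and M_scale: "c \<in> homog j \<Longrightarrow> m \<in> M k \<Longrightarrow> c *s m \<in> M (k + j)"
    and M_div: "m \<in> M k \<Longrightarrow> (\<And>i. rest w (m $ i) = 0) \<Longrightarrow> \<exists>m'\<in>M (k - 1). m = coord w 3 *s m'"
begin

abbreviation line :: "point set" where
  "line \<equiv> curve (coord w 3)"

text \<open>\<open>St P\<close> is the stalk of the restricted sheaf at \<open>P\<close>, and \<open>fib P q\<close> is the coset of \<open>I\<^sub>P F\<^sub>P\<close> that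
  represents the element \<open>q\<close> of this stalk.\<close>

definition St :: "point \<Rightarrow> ((complex poly fract) ^ 'n) set" where
  "St P = {rfrac w m g | m g k. m \<in> M k \<and> g \<in> homog k \<and> nonvanishing g P}"

definition fib :: "point \<Rightarrow> (complex poly fract) ^ 'n \<Rightarrow> ('n ratvec) set" where
  "fib P q = {frac_vec m g | m g k. m \<in> M k \<and> g \<in> homog k \<and> nonvanishing g P \<and> rfrac w m g = q}"

lemma fibI: "m \<in> M k \<Longrightarrow> g \<in> homog k \<Longrightarrow> nonvanishing g P \<Longrightarrow> rfrac w m g = q \<Longrightarrow> x = frac_vec m g \<Longrightarrow> x \<in> fib P q"
  unfolding fib_def by blast

lemma fibE:
  assumes "x \<in> fib P q"
  obtains m g k where "m \<in> M k" "g \<in> homog k" "nonvanishing g P" "rfrac w m g = q" "x = frac_vec m g"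
  using assms unfolding fib_def by blast

lemma StI: "m \<in> M k \<Longrightarrow> g \<in> homog k \<Longrightarrow> nonvanishing g P \<Longrightarrow> q = rfrac w m g \<Longrightarrow> q \<in> St P"
  unfolding St_def by blast

lemma StE:
  assumes "q \<in> St P"
  obtains m g k where "m \<in> M k" "g \<in> homog k" "nonvanishing g P" "q = rfrac w m g"
  using assms unfolding St_def by blast

lemma fib_nonempty: "q \<in> St P \<Longrightarrow> \<exists>x. x \<in> fib P q"
  unfolding St_def fib_def by blast

lemma fib_St: "x \<in> fib P q \<Longrightarrow> q \<in> St P"
  unfolding St_def fib_def by blast

lemma stalk_fib: "x \<in> stalk M P \<Longrightarrow> \<exists>q. x \<in> fib P q"
  unfolding fib_def stalk_def by blast

lemma frac_vec_inj:
  assumes P: "P \<in> line" and "x \<in> fib P q" "x \<in> fib P q'"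
  shows "q = q'"
proof -
  obtain m g k where a: "m \<in> M k" "g \<in> homog k" "nonvanishing g P" "rfrac w m g = q" "x = frac_vec m g"
    using assms(2) by (rule fibE)
  obtain m' g' k' where b: "m' \<in> M k'" "g' \<in> homog k'" "nonvanishing g' P" "rfrac w m' g' = q'" "x = frac_vec m' g'"
    using assms(3) by (rule fibE)
  note r = nonvanishing_imp_rest(1)[OF w P a(2,3)] nonvanishing_imp_rest(1)[OF w P b(2,3)]
  then have g: "g \<noteq> 0" "g' \<noteq> 0" by auto
  have "m $ i * g' = m' $ i * g" for i
    using a(5) b(5) g by (auto simp: frac_vec_def vec_eq_iff eq_fract)
  then have "rest w (m $ i) * rest w g' = rest w (m' $ i) * rest w g" for i
    using rest.map_mult by metis
  then have "emb (rest w (m $ i)) * emb (rest w g') = emb (rest w (m' $ i)) * emb (rest w g)" for i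
    using emb.map_mult by metis
  then show ?thesis
    using r unfolding a(4)[symmetric] b(4)[symmetric] rfrac_def by (simp add: vec_eq_iff frac_eq_eq)
qed

lemma fib_add:
  assumes P: "P \<in> line" and "x \<in> fib P q" "x' \<in> fib P q'"
  shows "x + x' \<in> fib P (q + q')"
proof -
  obtain m g k where a: "m \<in> M k" "g \<in> homog k" "nonvanishing g P" "rfrac w m g = q" "x = frac_vec m g"
    using assms(2) by (rule fibE)
  obtain m' g' k' where b: "m' \<in> M k'" "g' \<in> homog k'" "nonvanishing g' P" "rfrac w m' g' = q'" "x' = frac_vec m' g'"
    using assms(3) by (rule fibE)
  note r = nonvanishing_imp_rest(1)[OF w P a(2,3)] nonvanishing_imp_rest(1)[OF w P b(2,3)]
  then have g: "g \<noteq> 0" "g' \<noteq> 0" by auto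
  show ?thesis
  proof (rule fibI)
    show "g' *s m + g *s m' \<in> M (k + k')"
      using M_add[OF M_scale[OF b(2) a(1)], of "g *s m'"] M_scale[OF a(2) b(1)] by (simp add: add.commute)
    show "g * g' \<in> homog (k + k')" by (rule homog_mult[OF a(2) b(2)])
    show "nonvanishing (g * g') P" using a(3) b(3) by (simp add: nonvanishing_mult)
    show "rfrac w (g' *s m + g *s m') (g * g') = q + q'"
      unfolding a(4)[symmetric] b(4)[symmetric] rfrac_def using r
      by (simp add: vec_eq_iff rest.hom_simps emb.hom_simps add_frac_eq mult.commute)
    show "x + x' = frac_vec (g' *s m + g *s m') (g * g')"
      unfolding a(5) b(5) frac_vec_def using g by (simp add: vec_eq_iff algebra_simps)
  qed
qed

lemma fib_scale:
  assumes P: "P \<in> line" and "x \<in> fib P q" and c: "a \<in> homog j" "h \<in> homog j" "nonvanishing h P"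
  shows "Fract a h *s x \<in> fib P ((emb (rest w a) / emb (rest w h)) *s q)"
proof -
  obtain m g k where b: "m \<in> M k" "g \<in> homog k" "nonvanishing g P" "rfrac w m g = q" "x = frac_vec m g"
    using assms(2) by (rule fibE)
  show ?thesis
  proof (rule fibI)
    show "a *s m \<in> M (k + j)" by (rule M_scale[OF c(1) b(1)])
    show "h * g \<in> homog (k + j)" using homog_mult[OF b(2) c(2)] by (simp add: mult.commute)
    show "nonvanishing (h * g) P" using b(3) c(3) by (simp add: nonvanishing_mult)
    show "rfrac w (a *s m) (h * g) = (emb (rest w a) / emb (rest w h)) *s q"
      unfolding b(4)[symmetric] rfrac_def by (simp add: vec_eq_iff rest.hom_simps emb.hom_simps)
    show "Fract a h *s x = frac_vec (a *s m) (h * g)"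
      unfolding b(5) frac_vec_def by (simp add: vec_eq_iff)
  qed
qed

lemma fib_0: "P \<in> line \<Longrightarrow> 0 \<in> fib P 0"
  by (rule fibI[of 0 0 1]) (auto simp: M_0 homog_1 nonvanishing_def rfrac_def frac_vec_def vec_eq_iff Zero_fract_def)

lemma fib_diff:
  assumes P: "P \<in> line" and "x \<in> fib P q" "x' \<in> fib P q'"
  shows "x - x' \<in> fib P (q - q')"
proof -
  have c1: "const (-1) \<in> homog 0" by (rule homog_const)
  have h1: "(1 :: 3 mpoly) \<in> homog 0" by (rule homog_1)
  have "Fract (const (-1)) 1 *s x' \<in> fib P ((emb (rest w (const (-1))) / emb (rest w 1)) *s q')"
    by (rule fib_scale[OF P assms(3) c1 h1]) (simp add: nonvanishing_def)
  moreover have "Fract (const (-1)) 1 = (- 1 :: 3 mpoly fract)"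
    by (simp add: Fract_emb const.map_uminus emb.map_uminus)
  moreover have "emb (rest w (const (-1))) / emb (rest w 1) = (- 1 :: complex poly fract)"
    by (simp add: const.map_uminus rest.map_uminus emb.map_uminus)
  ultimately have "(- 1) *s x' \<in> fib P ((- 1) *s q')" by (simp only:)
  then have "- x' \<in> fib P (- q')" by (simp only: vector_sneg_minus1)
  from fib_add[OF P assms(2) this] show ?thesis by simp
qed

text \<open>The cosets of \<open>I\<^sub>P F\<^sub>P\<close> are the fibres of the restriction of fractions to the line.\<close>

lemma ideal_mult_eq:
  assumes P: "P \<in> line"
  shows "ideal_mult line M P = fib P 0"
proof
  show "ideal_mult line M P \<subseteq> fib P 0"
  proof
    fix x assume "x \<in> ideal_mult line M P"
    then obtain n :: nat and c e where x: "x = (\<Sum>j<n. c j *s e j)"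
      and ce: "\<And>j. j < n \<Longrightarrow> c j \<in> ideal_stalk line P" "\<And>j. j < n \<Longrightarrow> e j \<in> stalk M P"
      unfolding ideal_mult_def by blast
    have "c j *s e j \<in> fib P 0" if "j < n" for j
    proof -
      obtain a g k where a: "c j = Fract a g" "a \<in> homog k" "\<forall>Q\<in>line. vanishes a Q" "g \<in> homog k" "nonvanishing g P"
        using ce(1)[OF \<open>j < n\<close>] unfolding ideal_stalk_def by blast
      have "poly (rest w a) t = 0" for t
      proof -
        have "aff_pt w t \<in> line" using line_points[OF w] by blast
        then have "vanishes a (aff_pt w t)" using a(3) by blast
        then show ?thesis unfolding aff_pt_def using vanishes_span[OF aff_nonzero[OF w] a(2)] by (simp add: poly_rest)
      qed
      then have "rest w a = 0" using poly_nonroot by blast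
      moreover obtain q where "e j \<in> fib P q" using stalk_fib[OF ce(2)[OF \<open>j < n\<close>]] by blast
      ultimately show ?thesis using fib_scale[OF P _ a(2,4,5), of "e j" q] a(1) by simp
    qed
    then have "(\<Sum>j<k. c j *s e j) \<in> fib P 0" if "k \<le> n" for k
      using that fib_0[OF P] fib_add[OF P, of _ 0 _ 0] by (induction k) auto
    then show "x \<in> fib P 0" unfolding x by blast
  qed
  show "fib P 0 \<subseteq> ideal_mult line M P"
  proof
    fix x assume "x \<in> fib P 0"
    then obtain m g k where b: "m \<in> M k" "g \<in> homog k" "nonvanishing g P" "rfrac w m g = 0" "x = frac_vec m g"
      by (rule fibE)
    have "rest w (m $ i) = 0" for i
      using b(4) nonvanishing_imp_rest(1)[OF w P b(2,3)] by (auto simp: rfrac_def vec_eq_iff)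
    then obtain m' where m': "m' \<in> M (k - 1)" "m = coord w 3 *s m'" using M_div[OF b(1)] by blast
    obtain h where h: "h \<in> homog 1" "nonvanishing h P"
    proof -
      have "nonvanishing (coord w 1) (aff_pt w t)" for t
        using nonvanishing_aff[OF w coord_homog[of w 1]] by (simp add: w)
      moreover have "nonvanishing (coord w 2) (inf_pt w)"
        using nonvanishing_inf[OF w, of "coord w 2" 1] coord_homog[of w 2] by (simp add: w)
      ultimately show ?thesis using that P coord_homog unfolding line_points[OF w] by blast
    qed
    have h0: "h \<noteq> 0" using nonvanishing_imp_rest(1)[OF w P h] by auto
    have c: "Fract (coord w 3) h \<in> ideal_stalk line P"
      unfolding ideal_stalk_def using coord_homog[of w 3] h by (auto simp: curve_def)
    have e: "frac_vec (h *s m') g \<in> stalk M P"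
      unfolding stalk_def using M_scale[OF h(1) m'(1)] b(2,3) by auto
    have "x = Fract (coord w 3) h *s frac_vec (h *s m') g"
      unfolding b(5) m'(2) frac_vec_def using h0 by (simp add: vec_eq_iff mult.left_commute mult_fract_cancel)
    then have "x = (\<Sum>j<(1::nat). Fract (coord w 3) h *s frac_vec (h *s m') g)" by simp
    moreover have "\<forall>j<(1::nat). Fract (coord w 3) h \<in> ideal_stalk line P \<and> frac_vec (h *s m') g \<in> stalk M P"
      using c e by blast
    ultimately show "x \<in> ideal_mult line M P"
      unfolding ideal_mult_def
      by (intro CollectI exI[of _ "1::nat"] exI[of _ "\<lambda>_. Fract (coord w 3) h"] exI[of _ "\<lambda>_. frac_vec (h *s m') g"] conjI)
  qed
qed

lemma coset_eq:
  assumes P: "P \<in> line" and m: "m \<in> M k" "g \<in> homog k" "nonvanishing g P"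
  shows "{frac_vec m g + y | y. y \<in> ideal_mult line M P} = fib P (rfrac w m g)"
proof -
  have f: "frac_vec m g \<in> fib P (rfrac w m g)" using m by (auto intro: fibI)
  have "x \<in> fib P (rfrac w m g) \<longleftrightarrow> x - frac_vec m g \<in> fib P 0" for x
    using fib_diff[OF P _ f, of x "rfrac w m g"] fib_add[OF P f, of "x - frac_vec m g" 0] by auto
  note * = this
  show ?thesis
    unfolding ideal_mult_eq[OF P]
  proof (intro set_eqI iffI)
    fix x assume "x \<in> {frac_vec m g + y | y. y \<in> fib P 0}"
    then obtain y where "x = frac_vec m g + y" "y \<in> fib P 0" by blast
    then show "x \<in> fib P (rfrac w m g)" using *[of x] by simp
  next
    fix x assume "x \<in> fib P (rfrac w m g)"
    then have "x = frac_vec m g + (x - frac_vec m g) \<and> x - frac_vec m g \<in> fib P 0" using *[of x] by simp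
    then show "x \<in> {frac_vec m g + y | y. y \<in> fib P 0}" by blast
  qed
qed

text \<open>\<open>Q V\<close> consists of the sections over \<open>V\<close> as vectors of rational functions; \<open>sec\<close> translates them
  into families of cosets.\<close>

definition Q :: "point set \<Rightarrow> ((complex poly fract) ^ 'n) set" where
  "Q V = {q. \<forall>P\<in>V. q \<in> St P}"

definition sec :: "point set \<Rightarrow> (complex poly fract) ^ 'n \<Rightarrow> 'n family" where
  "sec V q = (\<lambda>P\<in>V. fib P q)"

lemma open_subset: "open_in line V \<Longrightarrow> V \<subseteq> line"
  by (auto simp: open_in_def)

text \<open>A section of the restricted sheaf over a nonempty open set is given by one vector of rational
  functions, as the line is irreducible.\<close>

lemma res_sections_eq:
  assumes V: "open_in line V" "V \<noteq> {}"
  shows "res_sections line M V = sec V ` Q V"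
proof
  show "sec V ` Q V \<subseteq> res_sections line M V"
  proof
    fix s assume "s \<in> sec V ` Q V"
    then obtain q where q: "q \<in> Q V" "s = sec V q" by blast
    show "s \<in> res_sections line M V"
      unfolding res_sections_def
    proof (intro CollectI conjI ballI)
      show "s \<in> extensional V" by (simp add: q(2) sec_def)
      fix P assume P: "P \<in> V"
      then obtain m g k where m: "m \<in> M k" "g \<in> homog k" "nonvanishing g P" "q = rfrac w m g"
        using q(1) unfolding Q_def by (blast elim: StE)
      let ?W = "{P \<in> V. nonvanishing g P}"
      have a: "open_in line ?W" by (rule open_in_restrict[OF V(1) m(2)])
      have b: "P \<in> ?W" "?W \<subseteq> V" using P m(3) by blast+
      have c: "\<forall>R\<in>?W. nonvanishing g R \<and> s R = {frac_vec m g + y | y. y \<in> ideal_mult line M R}"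
      proof (intro ballI conjI)
        fix R assume R: "R \<in> ?W"
        then have "R \<in> line" using open_subset[OF V(1)] by blast
        then show "s R = {frac_vec m g + y | y. y \<in> ideal_mult line M R}"
          using coset_eq[OF _ m(1,2), of R] R by (simp add: q(2) sec_def m(4))
      qed blast
      show "\<exists>W m g k. open_in line W \<and> P \<in> W \<and> W \<subseteq> V \<and> m \<in> M k \<and> g \<in> homog k \<and>
          (\<forall>Q\<in>W. nonvanishing g Q \<and> s Q = {frac_vec m g + y | y. y \<in> ideal_mult line M Q})"
        by (rule exI[of _ ?W], rule exI[of _ m], rule exI[of _ g], rule exI[of _ k])
           (intro conjI a b m(1,2) c)
    qed
  qed
  show "res_sections line M V \<subseteq> sec V ` Q V"
  proof
    fix s assume s: "s \<in> res_sections line M V"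
    have loc: "\<exists>q W. open_in line W \<and> P \<in> W \<and> W \<subseteq> V \<and> (\<forall>R\<in>W. q \<in> St R \<and> s R = fib R q)" if "P \<in> V" for P
    proof -
      have "\<exists>W m g k. open_in line W \<and> P \<in> W \<and> W \<subseteq> V \<and> m \<in> M k \<and> g \<in> homog k \<and>
          (\<forall>Q\<in>W. nonvanishing g Q \<and> s Q = {frac_vec m g + y | y. y \<in> ideal_mult line M Q})"
        using s \<open>P \<in> V\<close> unfolding res_sections_def by (elim CollectE conjE) (rule bspec)
      then obtain W m g k where *: "open_in line W \<and> P \<in> W \<and> W \<subseteq> V \<and> m \<in> M k \<and> g \<in> homog k \<and>
          (\<forall>Q\<in>W. nonvanishing g Q \<and> s Q = {frac_vec m g + y | y. y \<in> ideal_mult line M Q})"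
        by (elim exE) (rule that)
      then have W: "open_in line W" "P \<in> W" "W \<subseteq> V" and m: "m \<in> M k" "g \<in> homog k" by simp_all
      have sW: "nonvanishing g R" "s R = {frac_vec m g + y | y. y \<in> ideal_mult line M R}" if "R \<in> W" for R
        using * that by simp_all
      have "rfrac w m g \<in> St R \<and> s R = fib R (rfrac w m g)" if "R \<in> W" for R
        using coset_eq[OF _ m sW(1)[OF that]] sW(2)[OF that] subsetD[OF open_subset[OF W(1)] that]
          StI[OF m sW(1)[OF that] refl] by simp
      then show ?thesis using W by (intro exI[of _ "rfrac w m g"] exI[of _ W]) simp
    qed
    obtain P0 where P0: "P0 \<in> V" using V(2) by blast
    obtain q W where W: "open_in line W" "P0 \<in> W" and q: "\<And>R. R \<in> W \<Longrightarrow> q \<in> St R \<and> s R = fib R q"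
      using loc[OF P0] by blast
    have "q \<in> St P \<and> s P = fib P q" if P: "P \<in> V" for P
    proof -
      obtain q' W' where W': "open_in line W'" "P \<in> W'" and q': "\<And>R. R \<in> W' \<Longrightarrow> q' \<in> St R \<and> s R = fib R q'"
        using loc[OF P] by blast
      obtain p p' where pp: "p \<noteq> 0" "\<And>t. poly p t \<noteq> 0 \<Longrightarrow> aff_pt w t \<in> W"
        "p' \<noteq> 0" "\<And>t. poly p' t \<noteq> 0 \<Longrightarrow> aff_pt w t \<in> W'"
        using open_in_cofinite[OF w W] open_in_cofinite[OF w W'] by blast
      then obtain t where "poly (p * p') t \<noteq> 0" using poly_nonroot[of "p * p'"] by auto
      then have R: "aff_pt w t \<in> W" "aff_pt w t \<in> W'" using pp by auto
      have RL: "aff_pt w t \<in> line" using line_points[OF w] by blast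
      obtain x where "x \<in> fib (aff_pt w t) q" using fib_nonempty q[OF R(1)] by blast
      moreover from this have "x \<in> fib (aff_pt w t) q'" using q[OF R(1)] q'[OF R(2)] by simp
      ultimately have "q = q'" using frac_vec_inj[OF RL] by blast
      then show ?thesis using q'[OF W'(2)] by simp
    qed
    then have "q \<in> Q V" "s = sec V q"
      using s unfolding Q_def sec_def res_sections_def by (auto simp: fun_eq_iff extensional_def)
    then show "s \<in> sec V ` Q V" by blast
  qed
qed

lemma sec_inj:
  assumes V: "open_in line V" "V \<noteq> {}" and q: "q \<in> Q V" and e: "sec V q = sec V q'"
  shows "q = q'"
proof -
  obtain P where P: "P \<in> V" using V(2) by blast
  then have "fib P q = fib P q'" using e by (auto simp: sec_def fun_eq_iff split: if_splits)
  moreover obtain x where "x \<in> fib P q" using q P fib_nonempty unfolding Q_def by blast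
  ultimately show ?thesis using frac_vec_inj[of P x q q'] P open_subset[OF V(1)] by auto
qed

lemma sec_add_eq:
  assumes V: "open_in line V" and q: "q \<in> Q V" "q' \<in> Q V"
  shows "sec_add V (sec V q) (sec V q') = sec V (q + q')" "q + q' \<in> Q V"
proof -
  have "{a + b | a b. a \<in> fib P q \<and> b \<in> fib P q'} = fib P (q + q')" if P: "P \<in> V" for P
  proof
    have PL: "P \<in> line" using P open_subset[OF V] by blast
    show "{a + b | a b. a \<in> fib P q \<and> b \<in> fib P q'} \<subseteq> fib P (q + q')" using fib_add[OF PL] by blast
    obtain a where a: "a \<in> fib P q" using q(1) P fib_nonempty unfolding Q_def by blast
    show "fib P (q + q') \<subseteq> {a + b | a b. a \<in> fib P q \<and> b \<in> fib P q'}"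
    proof
      fix x assume "x \<in> fib P (q + q')"
      from fib_diff[OF PL this a] have "x - a \<in> fib P q'" by simp
      moreover have "x = a + (x - a)" by simp
      ultimately show "x \<in> {a + b | a b. a \<in> fib P q \<and> b \<in> fib P q'}" using a by blast
    qed
  qed
  then show "sec_add V (sec V q) (sec V q') = sec V (q + q')"
    by (auto simp: sec_add_def sec_def restrict_def fun_eq_iff)
  show "q + q' \<in> Q V"
    unfolding Q_def
  proof (intro CollectI ballI)
    fix P assume P: "P \<in> V"
    obtain a b where "a \<in> fib P q" "b \<in> fib P q'" using q P fib_nonempty unfolding Q_def by blast
    then show "q + q' \<in> St P" using fib_add fib_St P open_subset[OF V] by blast
  qed
qed

lemma Q_mono: "W \<subseteq> V \<Longrightarrow> Q V \<subseteq> Q W"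
  by (auto simp: Q_def)

lemma sec_restrict: "W \<subseteq> V \<Longrightarrow> restrict (sec V q) W = sec W q"
  by (auto simp: sec_def restrict_def fun_eq_iff)

end

lemma twist_module:
  assumes "invertible w"
  shows "line_module w (twist D) (\<lambda>i. D $ i)"
proof
  show "invertible w" by fact
  show "m \<in> twist D k \<Longrightarrow> m $ i \<in> homog (k - D $ i)" for m k i by (simp add: twist_def)
  show "0 \<in> twist D k" for k by (simp add: twist_def)
  show "m \<in> twist D k \<Longrightarrow> m' \<in> twist D k \<Longrightarrow> m + m' \<in> twist D k" for m m' k
    by (simp add: twist_def homog_add)
  show "c *s m \<in> twist D (k + j)" if c: "c \<in> homog j" and m: "m \<in> twist D k" for c j m k
    unfolding twist_def
  proof (intro CollectI allI)
    fix i
    show "(c *s m) $ i \<in> homog (k + j - D $ i)"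
      using homog_mult[OF c, of "m $ i" "k - D $ i"] m by (simp add: twist_def algebra_simps)
  qed
  show "\<exists>m'\<in>twist D (k - 1). m = coord w 3 *s m'" if m: "m \<in> twist D k" "\<And>i. rest w (m $ i) = 0" for m k
  proof -
    have "\<forall>i. \<exists>p\<in>homog (k - D $ i - 1). m $ i = coord w 3 * p"
      using rest_kernel[OF assms _ m(2)] m(1) by (simp add: twist_def)
    then obtain p where p: "\<And>i. p i \<in> homog (k - D $ i - 1)" "\<And>i. m $ i = coord w 3 * p i" by metis
    have "(\<chi> i. p i) \<in> twist D (k - 1)" using p(1) by (simp add: twist_def algebra_simps)
    moreover have "m = coord w 3 *s (\<chi> i. p i)" by (simp add: vec_eq_iff p(2))
    ultimately show ?thesis by blast
  qed
qed

text \<open>A vector of polynomials vanishing on the line is divisible by the equation of the line, and the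
  quotient of a syzygy is again a syzygy.\<close>

lemma AR_module:
  assumes w: "invertible w"
  shows "line_module w (AR f) (\<lambda>_. 0)"
proof
  show "invertible w" by fact
  show "m \<in> AR f k \<Longrightarrow> m $ i \<in> homog (k - 0)" for m k i by (simp add: AR_def)
  show "0 \<in> AR f k" for k by (simp add: AR_def syz_def)
  show "m \<in> AR f k \<Longrightarrow> m' \<in> AR f k \<Longrightarrow> m + m' \<in> AR f k" for m m' k
    by (simp add: AR_def syz_def homog_add distrib_right sum.distrib)
  show "c *s m \<in> AR f (k + j)" if c: "c \<in> homog j" and m: "m \<in> AR f k" for c j m k
  proof -
    have "(\<Sum>i\<in>UNIV. c * m $ i * pdiff i f) = c * (\<Sum>i\<in>UNIV. m $ i * pdiff i f)"
      by (simp add: sum_distrib_left mult.assoc)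
    moreover have "c * m $ i \<in> homog (k + j)" for i
      using homog_mult[OF c, of "m $ i" k] m by (simp add: AR_def add.commute)
    ultimately show ?thesis using m by (simp add: AR_def syz_def)
  qed
  show "\<exists>m'\<in>AR f (k - 1). m = coord w 3 *s m'" if m: "m \<in> AR f k" "\<And>i. rest w (m $ i) = 0" for m k
  proof -
    have "\<forall>i. \<exists>p\<in>homog (k - 1). m $ i = coord w 3 * p"
      using rest_kernel[OF w _ m(2)] m(1) by (simp add: AR_def)
    then obtain p where p: "\<And>i. p i \<in> homog (k - 1)" "\<And>i. m $ i = coord w 3 * p i" by metis
    have "coord w 3 * (\<Sum>i\<in>UNIV. p i * pdiff i f) = 0"
      using m(1) by (simp add: AR_def syz_def p(2) sum_distrib_left mult.assoc)
    then have "(\<Sum>i\<in>UNIV. p i * pdiff i f) = 0" using coord_nonzero[OF w, of 3] by simp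
    then have "(\<chi> i. p i) \<in> AR f (k - 1)" using p(1) by (simp add: AR_def syz_def)
    moreover have "m = coord w 3 *s (\<chi> i. p i)" by (simp add: vec_eq_iff p(2))
    ultimately show ?thesis by blast
  qed
qed

abbreviation O_Q :: "complex ^ 3 ^ 3 \<Rightarrow> point set \<Rightarrow> ((complex poly fract) ^ 1) set" where
  "O_Q w \<equiv> line_module.Q w (twist 0)"

abbreviation O_sec :: "complex ^ 3 ^ 3 \<Rightarrow> point set \<Rightarrow> (complex poly fract) ^ 1 \<Rightarrow> 1 family" where
  "O_sec w \<equiv> line_module.sec w (twist 0)"

lemma (in line_module) sec_scale_eq:
  assumes V: "open_in line V" and c: "c \<in> O_Q w V" and q: "q \<in> Q V"
  shows "sec_scale line M V (O_sec w V c) (sec V q) = sec V ((c $ 1) *s q)" "(c $ 1) *s q \<in> Q V"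
proof -
  interpret S: line_module w "twist 0 :: 1 gmod" "\<lambda>i. (0 :: int ^ 1) $ i" by (rule twist_module[OF w])
  have scl: "a $ 1 *s b \<in> fib P ((c $ 1) *s p)" if P: "P \<in> line" and a: "a \<in> S.fib P c" and b: "b \<in> fib P p" for a b P p
  proof -
    obtain m g k where m: "m \<in> twist 0 k" "g \<in> homog k" "nonvanishing g P" "rfrac w m g = c" "a = frac_vec m g"
      using a by (rule S.fibE)
    have "m $ 1 \<in> homog k" using m(1) by (simp add: twist_def)
    from fib_scale[OF P b this m(2,3)] show ?thesis
      by (simp add: m(5) m(4)[symmetric] frac_vec_def rfrac_def)
  qed
  have "{(a $ 1) *s b + y | a b y. a \<in> S.fib P c \<and> b \<in> fib P q \<and> y \<in> ideal_mult line M P} = fib P ((c $ 1) *s q)"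
    if P: "P \<in> V" for P
  proof (intro set_eqI iffI)
    have PL: "P \<in> line" using P open_subset[OF V] by blast
    fix x
    {
      assume "x \<in> {(a $ 1) *s b + y | a b y. a \<in> S.fib P c \<and> b \<in> fib P q \<and> y \<in> ideal_mult line M P}"
      then obtain a b y where x: "x = (a $ 1) *s b + y" "a \<in> S.fib P c" "b \<in> fib P q" "y \<in> fib P 0"
        unfolding ideal_mult_eq[OF PL] by blast
      then show "x \<in> fib P ((c $ 1) *s q)" using fib_add[OF PL scl[OF PL x(2,3)] x(4)] by simp
    next
      assume x: "x \<in> fib P ((c $ 1) *s q)"
      obtain a where a: "a \<in> S.fib P c" using c P S.fib_nonempty unfolding S.Q_def by blast
      obtain b where b: "b \<in> fib P q" using q P fib_nonempty unfolding Q_def by blast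
      have "x - (a $ 1) *s b \<in> fib P 0" using fib_diff[OF PL x scl[OF PL a b]] by simp
      then show "x \<in> {(a $ 1) *s b + y | a b y. a \<in> S.fib P c \<and> b \<in> fib P q \<and> y \<in> ideal_mult line M P}"
        unfolding ideal_mult_eq[OF PL] using a b
        by (intro CollectI exI[of _ a] exI[of _ b] exI[of _ "x - (a $ 1) *s b"]) simp
    }
  qed
  then show "sec_scale line M V (O_sec w V c) (sec V q) = sec V ((c $ 1) *s q)"
    by (auto simp: sec_scale_def sec_def S.sec_def restrict_def fun_eq_iff)
  show "(c $ 1) *s q \<in> Q V"
    unfolding Q_def
  proof (intro CollectI ballI)
    fix P assume P: "P \<in> V"
    obtain a where a: "a \<in> S.fib P c" using c P S.fib_nonempty unfolding S.Q_def by blast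
    obtain b where b: "b \<in> fib P q" using q P fib_nonempty unfolding Q_def by blast
    show "(c $ 1) *s q \<in> St P" using fib_St[OF scl[OF _ a b]] P open_subset[OF V] by blast
  qed
qed

text \<open>An isomorphism of the restricted sheaves, seen on vectors of rational functions: \<open>R V q q'\<close>
  says that the section given by \<open>q\<close> is mapped to the one given by \<open>q'\<close>.\<close>

locale line_iso = A: line_module w M D + B: line_module w N E
  for w :: "complex ^ 3 ^ 3" and M :: "'n::finite gmod" and D and N :: "'m::finite gmod" and E +
  fixes \<phi> :: "point set \<Rightarrow> 'n family \<Rightarrow> 'm family"
  assumes bij: "open_in A.line V \<Longrightarrow> bij_betw (\<phi> V) (res_sections A.line M V) (res_sections A.line N V)"
    and add: "open_in A.line V \<Longrightarrow> s \<in> res_sections A.line M V \<Longrightarrow> t \<in> res_sections A.line M V \<Longrightarrow>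
      \<phi> V (sec_add V s t) = sec_add V (\<phi> V s) (\<phi> V t)"
    and scale: "open_in A.line V \<Longrightarrow> c \<in> res_sections A.line (twist 0) V \<Longrightarrow> s \<in> res_sections A.line M V \<Longrightarrow>
      \<phi> V (sec_scale A.line M V c s) = sec_scale A.line N V c (\<phi> V s)"
    and res: "open_in A.line V \<Longrightarrow> open_in A.line W \<Longrightarrow> W \<subseteq> V \<Longrightarrow> s \<in> res_sections A.line M V \<Longrightarrow>
      \<phi> W (restrict s W) = restrict (\<phi> V s) W"
begin

definition R :: "point set \<Rightarrow> (complex poly fract) ^ 'n \<Rightarrow> (complex poly fract) ^ 'm \<Rightarrow> bool" where
  "R V q q' \<longleftrightarrow> q \<in> A.Q V \<and> q' \<in> B.Q V \<and> \<phi> V (A.sec V q) = B.sec V q'"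

lemma R_dom: "R V q q' \<Longrightarrow> q \<in> A.Q V" "R V q q' \<Longrightarrow> q' \<in> B.Q V"
  by (auto simp: R_def)

context
  fixes V :: "point set"
  assumes V: "open_in A.line V" "V \<noteq> {}"
begin

lemma R_right_total:
  assumes "q' \<in> B.Q V"
  shows "\<exists>q. R V q q'"
proof -
  have "B.sec V q' \<in> res_sections A.line N V" using assms by (simp add: B.res_sections_eq[OF V])
  then have "B.sec V q' \<in> \<phi> V ` res_sections A.line M V"
    using bij_betw_imp_surj_on[OF bij[OF V(1)]] by simp
  then obtain s where "s \<in> res_sections A.line M V" "\<phi> V s = B.sec V q'" by (metis imageE)
  then show ?thesis using assms by (auto simp: A.res_sections_eq[OF V] R_def)
qed

lemma R_left_total:
  assumes "q \<in> A.Q V"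
  shows "\<exists>q'. R V q q'"
proof -
  have "A.sec V q \<in> res_sections A.line M V" using assms by (simp add: A.res_sections_eq[OF V])
  then have "\<phi> V (A.sec V q) \<in> res_sections A.line N V"
    using bij[OF V(1)] by (auto simp: bij_betw_def)
  then show ?thesis using assms by (auto simp: B.res_sections_eq[OF V] R_def)
qed

lemma R_inj:
  assumes "R V q q'" "R V p q'"
  shows "q = p"
proof -
  have "A.sec V q \<in> res_sections A.line M V" "A.sec V p \<in> res_sections A.line M V"
    using assms by (auto simp: A.res_sections_eq[OF V] R_def)
  moreover have "\<phi> V (A.sec V q) = \<phi> V (A.sec V p)" using assms by (simp add: R_def)
  ultimately have "A.sec V q = A.sec V p" using bij[OF V(1)] by (auto simp: bij_betw_def inj_on_def)
  then show ?thesis using A.sec_inj[OF V] R_dom(1)[OF assms(1)] by blast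
qed

lemma R_fun:
  assumes "R V q q'" "R V q p'"
  shows "q' = p'"
  using assms B.sec_inj[OF V, of q' p'] by (simp add: R_def)

lemma R_add:
  assumes "R V q q'" "R V p p'"
  shows "R V (q + p) (q' + p')"
proof -
  have "A.sec V q \<in> res_sections A.line M V" "A.sec V p \<in> res_sections A.line M V"
    using assms by (auto simp: A.res_sections_eq[OF V] R_def)
  from add[OF V(1) this] show ?thesis
    using assms A.sec_add_eq[OF V(1), of q p] B.sec_add_eq[OF V(1), of q' p'] by (simp add: R_def)
qed

lemma R_scale:
  assumes "R V q q'" "c \<in> O_Q w V"
  shows "R V ((c $ 1) *s q) ((c $ 1) *s q')"
proof -
  interpret S: line_module w "twist 0 :: 1 gmod" "\<lambda>i. (0 :: int ^ 1) $ i" by (rule twist_module[OF A.w])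
  have q: "A.sec V q \<in> res_sections A.line M V" using assms by (auto simp: A.res_sections_eq[OF V] R_def)
  have c: "O_sec w V c \<in> res_sections A.line (twist 0) V" using assms by (auto simp: S.res_sections_eq[OF V])
  note d = R_dom[OF assms(1)]
  have "\<phi> V (A.sec V ((c $ 1) *s q)) = sec_scale A.line N V (O_sec w V c) (\<phi> V (A.sec V q))"
    using scale[OF V(1) c q] unfolding A.sec_scale_eq(1)[OF V(1) assms(2) d(1)] .
  also have "\<phi> V (A.sec V q) = B.sec V q'" using assms(1) by (simp add: R_def)
  also have "sec_scale A.line N V (O_sec w V c) (B.sec V q') = B.sec V ((c $ 1) *s q')"
    by (rule B.sec_scale_eq(1)[OF V(1) assms(2) d(2)])
  finally show ?thesis
    unfolding R_def using A.sec_scale_eq(2)[OF V(1) assms(2) d(1)] B.sec_scale_eq(2)[OF V(1) assms(2) d(2)] by blast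
qed

lemma R_restrict:
  assumes "R V q q'" "open_in A.line W" "W \<subseteq> V"
  shows "R W q q'"
proof -
  have "A.sec V q \<in> res_sections A.line M V" using assms by (auto simp: A.res_sections_eq[OF V] R_def)
  from res[OF V(1) assms(2,3) this] show ?thesis
    using assms A.Q_mono[OF assms(3)] B.Q_mono[OF assms(3)]
    by (auto simp: R_def A.sec_restrict B.sec_restrict)
qed

lemma R_zero: "R V 0 q' \<Longrightarrow> q' = 0"
proof -
  assume q: "R V 0 q'"
  from R_add[OF q q] have "R V 0 (q' + q')" by simp
  from R_fun[OF this q] show "q' = 0" by simp
qed

end

end

section \<open>The splitting of the restriction\<close>

text \<open>The affine coordinate of the line.\<close>

definition tvar :: "complex poly fract" where
  "tvar = emb [:0, 1:]"

lemma tvar_nonzero [simp]: "tvar \<noteq> 0"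
  by (simp add: tvar_def)

lemma emb_monom: "emb (monom 1 k) = tvar ^ k"
  by (simp add: tvar_def emb.map_power[symmetric] monom_altdef)

lemma nonvanishing_monomial:
  assumes w: "invertible w"
  shows "nonvanishing (coord w 1 ^ a * coord w 2 ^ b) (aff_pt w t) \<longleftrightarrow> b = 0 \<or> t \<noteq> 0"
    "nonvanishing (coord w 1 ^ a * coord w 2 ^ b) (inf_pt w) \<longleftrightarrow> a = 0"
proof -
  have h: "coord w 1 ^ a * coord w 2 ^ b \<in> homog (int (a + b))"
    using homog_mult[OF homog_power1[OF coord_homog] homog_power1[OF coord_homog]] by simp
  have r: "rest w (coord w 1 ^ a * coord w 2 ^ b) = monom 1 b"
    by (simp add: rest.hom_simps w monom_altdef)
  show "nonvanishing (coord w 1 ^ a * coord w 2 ^ b) (aff_pt w t) \<longleftrightarrow> b = 0 \<or> t \<noteq> 0"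
    unfolding nonvanishing_aff[OF w h] r by (simp add: poly_monom) blast
  show "nonvanishing (coord w 1 ^ a * coord w 2 ^ b) (inf_pt w) \<longleftrightarrow> a = 0"
    unfolding nonvanishing_inf[OF w h] r by simp
qed

text \<open>Denominators that are monomials in the two coordinates suffice for the sections needed of the
  twisting sheaves; the parameters are the exponents.\<close>

lemma twist_stalkI:
  assumes w: "invertible w" and p: "\<And>i. p i \<in> bform (int (a + b) - D $ i)"
    and nv: "nonvanishing (coord w 1 ^ a * coord w 2 ^ b) P"
  shows "(\<chi> i. emb (p i) / tvar ^ b) \<in> line_module.St w (twist D) P"
proof -
  interpret line_module w "twist D" "\<lambda>i. D $ i" by (rule twist_module[OF w])
  have "\<forall>i. \<exists>m\<in>homog (int (a + b) - D $ i). rest w m = p i" using rest_onto[OF w p] by blast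
  then obtain m where m: "\<And>i. m i \<in> homog (int (a + b) - D $ i)" "\<And>i. rest w (m i) = p i" by metis
  show ?thesis
  proof (rule StI)
    show "(\<chi> i. m i) \<in> twist D (int (a + b))" using m(1) by (simp add: twist_def)
    show "coord w 1 ^ a * coord w 2 ^ b \<in> homog (int (a + b))"
      using homog_mult[OF homog_power1[OF coord_homog] homog_power1[OF coord_homog]] by simp
    show "nonvanishing (coord w 1 ^ a * coord w 2 ^ b) P" by (rule nv)
    show "(\<chi> i. emb (p i) / tvar ^ b) = rfrac w (\<chi> i. m i) (coord w 1 ^ a * coord w 2 ^ b)"
      by (simp add: rfrac_def m(2) rest.hom_simps w tvar_def emb.map_power)
  qed
qed

text \<open>The denominators of \<open>x\<close> form an ideal without common zeros.\<close>

lemma regular_imp_polynomial: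
  fixes x :: "complex poly fract"
  assumes "\<And>t. \<exists>a b. x = emb a / emb b \<and> poly b t \<noteq> 0"
  shows "\<exists>p. x = emb p"
proof -
  let ?U = "{b. \<exists>a. emb b * x = emb a}"
  have "1 \<in> ?U"
  proof (rule poly_ideal_one)
    show "p - q \<in> ?U" if pq: "p \<in> ?U" "q \<in> ?U" for p q
    proof -
      obtain a b where "emb p * x = emb a" "emb q * x = emb b" using pq by blast
      then have "emb (p - q) * x = emb (a - b)" by (simp add: emb.map_diff left_diff_distrib)
      then show ?thesis by blast
    qed
    show "q * p \<in> ?U" if p: "p \<in> ?U" for p q
    proof -
      obtain a where "emb p * x = emb a" using p by blast
      then have "emb (q * p) * x = emb (q * a)" by (simp add: emb.map_mult mult.assoc)
      then show ?thesis by blast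
    qed
    show "\<exists>p\<in>?U. poly p t \<noteq> 0" for t
    proof -
      obtain a b where ab: "x = emb a / emb b" "poly b t \<noteq> 0" using assms by blast
      then have "b \<noteq> 0" by auto
      then have "emb b * x = emb a" using ab(1) by simp
      then show ?thesis using ab(2) by blast
    qed
  qed
  then show ?thesis by simp
qed

lemma degree_of_fraction:
  assumes "emb a = tvar powi k * emb b" "a \<noteq> 0"
  shows "int (degree a) = k + int (degree b)"
proof -
  have b0: "b \<noteq> 0" using assms by auto
  show ?thesis
  proof (cases "k \<ge> 0")
    case True
    then have "emb a = emb (monom 1 (nat k) * b)"
      using assms(1) by (simp add: power_int_def emb.map_mult emb_monom)
    then have "a = monom 1 (nat k) * b" by (simp only: emb_eq_iff)
    then show ?thesis using True b0 by (simp add: degree_mult_eq degree_monom_eq)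
  next
    case False
    then have "emb (monom 1 (nat (- k)) * a) = emb b"
      using assms(1) by (simp add: power_int_def emb.map_mult emb_monom field_simps)
    then have "monom 1 (nat (- k)) * a = b" by (simp only: emb_eq_iff)
    then have "degree b = nat (- k) + degree a" using assms(2) by (auto simp: degree_mult_eq degree_monom_eq)
    then show ?thesis using False by simp
  qed
qed

definition embv :: "complex poly ^ 'n \<Rightarrow> (complex poly fract) ^ 'n" where
  "embv v = (\<chi> i. emb (v $ i))"

lemma embv_inj: "embv v = embv u \<Longrightarrow> v = u"
  by (simp add: embv_def vec_eq_iff emb_eq_iff)

lemma embv_add: "embv (v + u) = embv v + embv u"
  by (simp add: embv_def vec_eq_iff emb.map_add)

lemma embv_scale: "embv (a *s v) = emb a *s embv v"
  by (simp add: embv_def vec_eq_iff emb.map_mult)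

definition rv :: "complex ^ 3 ^ 3 \<Rightarrow> 3 mpoly ^ 'n \<Rightarrow> complex poly ^ 'n" where
  "rv w m = (\<chi> i. rest w (m $ i))"

lemma rfrac_rv: "rfrac w m g = (1 / emb (rest w g)) *s embv (rv w m)"
  by (simp add: rfrac_def embv_def rv_def vec_eq_iff)

context line_module
begin

text \<open>The global sections of the \<open>k\<close>-th twist of the restricted sheaf.\<close>

definition Gam :: "int \<Rightarrow> ((complex poly fract) ^ 'n) set" where
  "Gam k = {v. (\<forall>t. v \<in> St (aff_pt w t)) \<and> tvar powi (- k) *s v \<in> St (inf_pt w)}"

lemma rv_in_Gam:
  assumes "m \<in> M k" "k \<ge> 0"
  shows "embv (rv w m) \<in> Gam k"
proof -
  have h: "coord w j ^ nat k \<in> homog k" for j using homog_power1[OF coord_homog, of w j "nat k"] assms(2) by simp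
  show ?thesis
    unfolding Gam_def
  proof (intro CollectI conjI allI)
    show "embv (rv w m) \<in> St (aff_pt w t)" for t
      using nonvanishing_monomial(1)[OF w, of "nat k" 0 t]
      by (intro StI[OF assms(1) h[of 1]]) (auto simp: rfrac_rv rest.hom_simps w)
    show "tvar powi (- k) *s embv (rv w m) \<in> St (inf_pt w)"
      using nonvanishing_monomial(2)[OF w, of 0 "nat k"] assms(2)
      by (intro StI[OF assms(1) h[of 2]])
         (auto simp: rfrac_rv rest.hom_simps w emb.map_power tvar_def[symmetric] power_int_minus power_int_def field_simps)
  qed
qed

lemma rv_add: "v \<in> rv w ` M k \<Longrightarrow> u \<in> rv w ` M k \<Longrightarrow> v + u \<in> rv w ` M k"
proof -
  assume "v \<in> rv w ` M k" "u \<in> rv w ` M k"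
  then obtain m m' where "m \<in> M k" "m' \<in> M k" "v = rv w m" "u = rv w m'" by blast
  moreover from this have "v + u = rv w (m + m')" by (simp add: rv_def vec_eq_iff rest.map_add)
  ultimately show ?thesis using M_add by blast
qed

lemma rv_scale:
  assumes "v \<in> rv w ` M k" "c \<in> bform j"
  shows "c *s v \<in> rv w ` M (k + j)"
proof -
  obtain m where m: "m \<in> M k" "v = rv w m" using assms(1) by blast
  obtain p where p: "p \<in> homog j" "rest w p = c" using rest_onto[OF w assms(2)] by blast
  have "c *s v = rv w (p *s m)" by (simp add: rv_def m(2) p(2) vec_eq_iff rest.map_mult)
  then show ?thesis using M_scale[OF p(1) m(1)] by blast
qed

lemma rv_mono: "v \<in> rv w ` M k \<Longrightarrow> k \<le> j \<Longrightarrow> v \<in> rv w ` M j"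
  using rv_scale[of v k 1 "j - k"] by (simp add: bform_def)

text \<open>A global section becomes a restriction of an element of the module after multiplication by
  any form of large degree: the admissible multipliers form a graded ideal, and they include the
  local denominators, so they have no common zero.\<close>

lemma Gam_eventually:
  assumes v: "v \<in> Gam d"
  shows "\<exists>m0. \<forall>m\<ge>m0. \<forall>a. degree a \<le> m \<longrightarrow> emb a *s v \<in> embv ` rv w ` M (d + int m)"
proof -
  define g where "g m = {a. emb a *s v \<in> embv ` rv w ` M (d + int m)}" for m :: nat
  have gI: "a \<in> g m" if "emb a *s v = embv u" "u \<in> rv w ` M (d + int m)" for a u m
    using that unfolding g_def by (intro CollectI image_eqI[of _ _ u])
  have gE: "\<exists>u\<in>rv w ` M (d + int m). emb a *s v = embv u" if "a \<in> g m" for a m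
    using that unfolding g_def by blast
  have "\<exists>m0. \<forall>m\<ge>m0. \<forall>a. degree a \<le> m \<longrightarrow> a \<in> g m"
  proof (rule binary_ideal_eventually_all)
    fix m
    show "up.subspace (g m)"
      unfolding up.subspace_def
    proof (intro conjI ballI allI)
      show "0 \<in> g m"
      proof (rule gI)
        show "emb 0 *s v = embv (rv w 0)" by (simp add: embv_def rv_def vec_eq_iff)
        show "rv w 0 \<in> rv w ` M (d + int m)" using M_0 by blast
      qed
      fix a assume "a \<in> g m"
      then obtain u where u: "u \<in> rv w ` M (d + int m)" "emb a *s v = embv u" using gE by blast
      show "smult c a \<in> g m" for c
      proof (rule gI)
        have "smult c a = [:c:] * a" by simp
        then have "emb (smult c a) *s v = emb [:c:] *s (emb a *s v)"
          by (simp only: emb.map_mult vector_smult_assoc)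
        then show "emb (smult c a) *s v = embv ([:c:] *s u)" by (simp add: u(2) embv_scale)
        show "[:c:] *s u \<in> rv w ` M (d + int m)" using rv_scale[OF u(1), of "[:c:]" 0] by (simp add: bform_def)
      qed
      fix b assume "b \<in> g m"
      then obtain u' where u': "u' \<in> rv w ` M (d + int m)" "emb b *s v = embv u'" using gE by blast
      show "a + b \<in> g m"
      proof (rule gI)
        show "emb (a + b) *s v = embv (u + u')"
          by (simp add: emb.map_add vector_sadd_rdistrib u(2) u'(2) embv_add)
        show "u + u' \<in> rv w ` M (d + int m)" by (rule rv_add[OF u(1) u'(1)])
      qed
    qed
    show "g m \<subseteq> g (Suc m)"
    proof
      fix a assume "a \<in> g m"
      then obtain u where u: "u \<in> rv w ` M (d + int m)" "emb a *s v = embv u" using gE by blast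
      show "a \<in> g (Suc m)" by (rule gI[OF u(2) rv_mono[OF u(1)]]) simp
    qed
    show "[:0, 1:] * a \<in> g (Suc m)" if a: "a \<in> g m" for a
    proof -
      obtain u where u: "u \<in> rv w ` M (d + int m)" "emb a *s v = embv u" using gE[OF a] by blast
      show ?thesis
      proof (rule gI)
        show "emb ([:0, 1:] * a) *s v = embv ([:0, 1:] *s u)"
          by (simp only: emb.map_mult vector_smult_assoc[symmetric] u(2) embv_scale)
        show "[:0, 1:] *s u \<in> rv w ` M (d + int (Suc m))"
          using rv_scale[OF u(1), of "[:0, 1:]" 1] by (simp add: bform_def algebra_simps)
      qed
    qed
  next
    fix t
    have "v \<in> St (aff_pt w t)" using v by (simp add: Gam_def)
    then obtain m h k where m: "m \<in> M k" "h \<in> homog k" "nonvanishing h (aff_pt w t)" "v = rfrac w m h"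
      by (rule StE)
    have PL: "aff_pt w t \<in> line" using line_points[OF w] by blast
    note h0 = nonvanishing_imp_rest[OF w PL m(2,3)]
    have "emb (rest w h) *s v = embv (rv w m)"
      unfolding m(4) rfrac_rv using h0(1) by (simp add: vector_smult_assoc)
    moreover have "rv w m \<in> rv w ` M (d + int (nat k + nat \<bar>d\<bar>))"
    proof (rule rv_mono)
      show "rv w m \<in> rv w ` M k" using m(1) by blast
      show "k \<le> d + int (nat k + nat \<bar>d\<bar>)" using h0(2) by simp
    qed
    ultimately have "rest w h \<in> g (nat k + nat \<bar>d\<bar>)" by (rule gI)
    moreover have "poly (rest w h) t \<noteq> 0" using nonvanishing_aff[OF w m(2)] m(3) by blast
    ultimately show "\<exists>m. \<exists>p\<in>g m. poly p t \<noteq> 0" by blast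
  next
    have "tvar powi (- d) *s v \<in> St (inf_pt w)" using v by (simp add: Gam_def)
    then obtain m h k where m: "m \<in> M k" "h \<in> homog k" "nonvanishing h (inf_pt w)" "tvar powi (- d) *s v = rfrac w m h"
      by (rule StE)
    have PL: "inf_pt w \<in> line" using line_points[OF w] by blast
    note h0 = nonvanishing_imp_rest[OF w PL m(2,3)]
    have hk: "h \<in> homog (int (nat k))" using m(2) h0(2) by simp
    have "coeff (rest w h) (nat k) \<noteq> 0" using nonvanishing_inf[OF w hk] m(3) by blast
    then have deg: "degree (rest w h) = nat k"
      using le_antisym[OF frame_decomp(1)[OF w hk] le_degree] by blast
    have hv: "emb (rest w h) *s (tvar powi (- d) *s v) = embv (rv w m)"
      unfolding m(4) rfrac_rv using h0(1) by (simp add: vector_smult_assoc)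
    have mM: "rv w m \<in> rv w ` M k" using m(1) by blast
    show "\<exists>m. \<exists>p\<in>g m. p \<noteq> 0 \<and> degree p = m"
    proof (cases "d \<ge> 0")
      case True
      have "tvar powi d = tvar ^ nat d" using True by (simp add: power_int_def)
      then have "tvar ^ nat d * tvar powi (- d) = 1" by (simp add: power_int_minus)
      then have "emb (rest w h) *s v = (tvar ^ nat d * emb (rest w h) * tvar powi (- d)) *s v"
        by (simp add: mult.commute mult.left_commute)
      also have "\<dots> = tvar ^ nat d *s embv (rv w m)"
        unfolding hv[symmetric] by (simp add: vector_smult_assoc mult.assoc)
      finally have "emb (rest w h) *s v = embv (monom 1 (nat d) *s rv w m)" by (simp add: embv_scale emb_monom)
      moreover have "monom 1 (nat d) *s rv w m \<in> rv w ` M (d + int (nat k))"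
        using rv_scale[OF mM, of "monom 1 (nat d)" d] True h0(2) by (simp add: bform_def degree_monom_eq add.commute)
      ultimately have "rest w h \<in> g (nat k)" by (rule gI)
      then show ?thesis using h0(1) deg by blast
    next
      case False
      let ?p = "monom 1 (nat (- d)) * rest w h"
      have "emb ?p *s v = embv (rv w m)"
        unfolding hv[symmetric] using False
        by (simp add: emb.map_mult emb_monom vector_smult_assoc power_int_def mult.commute)
      moreover have "rv w m \<in> rv w ` M (d + int (nat k + nat (- d)))" using mM h0(2) False by simp
      ultimately have "?p \<in> g (nat k + nat (- d))" by (rule gI)
      moreover have "?p \<noteq> 0" "degree ?p = nat k + nat (- d)"
        using h0(1) deg by (auto simp: degree_mult_eq degree_monom_eq)
      ultimately show ?thesis by blast
    qed
  qed
  then show ?thesis unfolding g_def by blast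
qed

end


lemma twist_poly_St:
  assumes w: "invertible w"
  shows "(\<chi> i. emb (p i)) \<in> line_module.St w (twist D) (aff_pt w t)"
proof -
  define a where "a = (\<Sum>i\<in>UNIV. degree (p i) + nat \<bar>D $ i\<bar>)"
  have "p i \<in> bform (int (a + 0) - D $ i)" for i
  proof -
    have "degree (p i) + nat \<bar>D $ i\<bar> \<le> a" unfolding a_def by (rule member_le_sum) auto
    then show ?thesis by (auto simp: bform_def)
  qed
  from twist_stalkI[OF w this, of "aff_pt w t"] show ?thesis
    using nonvanishing_monomial(1)[OF w, of a 0 t] by simp
qed

lemma tvar_powi: "int x - int y = k \<Longrightarrow> tvar ^ x / tvar ^ y = tvar powi k"
  by (auto simp: power_int_diff)

lemma twist_power_St:
  assumes w: "invertible w" and nv: "nonvanishing (coord w 1 ^ a * coord w 2 ^ b) P"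
    and c: "int c - int b = j" "int c \<le> int (a + b) - D $ i"
  shows "(\<chi> k. if k = i then tvar powi j else 0) \<in> line_module.St w (twist D) P"
proof -
  have "(if k = i then monom 1 c else 0) \<in> bform (int (a + b) - D $ k)" for k
    using c(2) by (auto simp: bform_def degree_monom_eq)
  from twist_stalkI[OF w this nv] show ?thesis
    by (simp add: if_distrib[of emb] if_distrib[of "\<lambda>x. x / _"] emb_monom tvar_powi[OF c(1)] cong: if_cong)
qed

lemma splits_line_iso:
  assumes w: "invertible w" and s: "splits_on f (curve (coord w 3)) d1 d2"
  shows "\<exists>\<phi>. line_iso w (AR f) (\<lambda>_. 0) (twist (vector [d1, d2] :: int ^ 2)) (\<lambda>i. (vector [d1, d2] :: int ^ 2) $ i) \<phi>"
proof -
  obtain \<phi> where \<phi>: "\<And>V. open_in (curve (coord w 3)) V \<Longrightarrow>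
        bij_betw (\<phi> V) (res_sections (curve (coord w 3)) (AR f) V) (res_sections (curve (coord w 3)) (twist (vector [d1, d2] :: int ^ 2)) V) \<and>
        (\<forall>s \<in> res_sections (curve (coord w 3)) (AR f) V. \<forall>t \<in> res_sections (curve (coord w 3)) (AR f) V.
           \<phi> V (sec_add V s t) = sec_add V (\<phi> V s) (\<phi> V t)) \<and>
        (\<forall>c \<in> res_sections (curve (coord w 3)) (twist 0) V. \<forall>s \<in> res_sections (curve (coord w 3)) (AR f) V.
           \<phi> V (sec_scale (curve (coord w 3)) (AR f) V c s) = sec_scale (curve (coord w 3)) (twist (vector [d1, d2] :: int ^ 2)) V c (\<phi> V s)) \<and>
        (\<forall>W. open_in (curve (coord w 3)) W \<and> W \<subseteq> V \<longrightarrow>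
           (\<forall>s \<in> res_sections (curve (coord w 3)) (AR f) V. \<phi> W (restrict s W) = restrict (\<phi> V s) W))"
    using s unfolding splits_on_def res_isomorphic_def by blast
  show ?thesis
    by (rule exI[of _ \<phi>], intro line_iso.intro AR_module twist_module w line_iso_axioms.intro) (use \<phi> in blast)+
qed

text \<open>The basis consists of the sections that correspond over the affine chart \<open>U0\<close> to the standard
  basis of the split bundle. After division by \<open>t\<close> to the power \<open>D $ i\<close> the \<open>i\<close>-th of them is also
  regular at infinity: on the overlap the isomorphism commutes with multiplication by powers of
  \<open>t\<close>. Conversely, the coordinates of a section in this basis are regular on the affine chart, so
  polynomials, and regularity at infinity bounds their degrees.\<close>

theorem splitting_basis:
  assumes w: "invertible w" and s: "splits_on f (curve (coord w 3)) d1 d2"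
  defines "D \<equiv> (vector [d1, d2] :: int ^ 2)"
  shows "\<exists>y :: 2 \<Rightarrow> complex poly ^ 3.
    (\<forall>i. \<exists>m0. \<forall>m\<ge>m0. \<forall>a. degree a \<le> m \<longrightarrow> a *s y i \<in> rv w ` AR f (D $ i + int m)) \<and>
    (\<forall>k. \<forall>v\<in>rv w ` AR f k. \<exists>p. (\<forall>i. p i \<in> bform (k - D $ i)) \<and> v = p 1 *s y 1 + p 2 *s y 2) \<and>
    (\<forall>a b. a *s y 1 + b *s y 2 = 0 \<longrightarrow> a = 0 \<and> b = 0)"
proof -
  obtain \<phi> where "line_iso w (AR f) (\<lambda>_. 0) (twist D) (\<lambda>i. D $ i) \<phi>"
    using splits_line_iso[OF w s] unfolding D_def by blast
  then interpret line_iso w "AR f" "\<lambda>_. 0" "twist D" "\<lambda>i. D $ i" \<phi> .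
  interpret S: line_module w "twist 0 :: 1 gmod" "\<lambda>i. (0 :: int ^ 1) $ i" by (rule twist_module[OF w])
  let ?L = "curve (coord w 3)"
  \<comment> \<open>The two standard charts and their intersection.\<close>
  define U0 where "U0 = {P \<in> ?L. nonvanishing (coord w 1) P}"
  define Ui where "Ui = {P \<in> ?L. nonvanishing (coord w 2) P}"
  define U where "U = {P \<in> U0. nonvanishing (coord w 2) P}"
  have LP: "?L \<subseteq> proj_plane" by (auto simp: curve_def)
  have open0: "open_in ?L U0" and openi: "open_in ?L Ui"
    unfolding U0_def Ui_def by (rule open_in_basic[OF coord_homog LP])+
  have openU: "open_in ?L U" unfolding U_def by (rule open_in_restrict[OF open0 coord_homog])
  have X1: "nonvanishing (coord w 1) (aff_pt w t)" "\<not> nonvanishing (coord w 1) (inf_pt w)"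
    and X2: "nonvanishing (coord w 2) (aff_pt w t) \<longleftrightarrow> t \<noteq> 0" "nonvanishing (coord w 2) (inf_pt w)" for t
    using nonvanishing_monomial[OF w, of 1 0] nonvanishing_monomial[OF w, of 0 1] by simp_all
  have aL: "aff_pt w t \<in> ?L" "inf_pt w \<in> ?L" for t using line_points[OF w] by blast+
  have U0_iff: "P \<in> U0 \<longleftrightarrow> (\<exists>t. P = aff_pt w t)" for P
    unfolding U0_def using line_points[OF w] X1 by blast
  have Ui_iff: "P \<in> Ui \<longleftrightarrow> P = inf_pt w \<or> (\<exists>t. t \<noteq> 0 \<and> P = aff_pt w t)" for P
    unfolding Ui_def using line_points[OF w] X2 by blast
  have U_iff: "P \<in> U \<longleftrightarrow> (\<exists>t. t \<noteq> 0 \<and> P = aff_pt w t)" for P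
    unfolding U_def U0_iff using X2 by blast
  have ne: "U0 \<noteq> {}" "Ui \<noteq> {}" "U \<noteq> {}"
    using U0_iff Ui_iff U_iff zero_neq_one by blast+
  have sub: "U \<subseteq> U0" "U \<subseteq> Ui" unfolding subset_iff U0_iff Ui_iff U_iff by blast+
  have aU0: "aff_pt w t \<in> U0" for t using U0_iff by blast
  have iUi: "inf_pt w \<in> Ui" using Ui_iff by blast
  note V0 = open0 ne(1) and Vi = openi ne(2) and VU = openU ne(3)
  have poly_Q: "(\<chi> i. emb (p i)) \<in> B.Q U0" for p
    unfolding B.Q_def by (auto simp: U0_iff intro: twist_poly_St[OF w])
  have poly_O: "(\<chi> i. emb a) \<in> O_Q w U0" for a
    unfolding S.Q_def by (auto simp: U0_iff intro: twist_poly_St[OF w])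
  have powi_O: "(\<chi> i. tvar powi j) \<in> O_Q w U" for j
    unfolding S.Q_def
  proof (intro CollectI ballI)
    fix P assume "P \<in> U"
    then obtain t where t: "t \<noteq> 0" "P = aff_pt w t" unfolding U_iff by blast
    have "(\<chi> k. if k = 1 then tvar powi j else 0) \<in> S.St P"
      by (rule twist_power_St[OF w, of "nat \<bar>j\<bar>" "nat \<bar>j\<bar>" _ "nat (\<bar>j\<bar> + j)"])
         (use nonvanishing_monomial(1)[OF w] t in auto)
    moreover have "(\<chi> k :: 1. if k = 1 then tvar powi j else 0) = (\<chi> i. tvar powi j)" by (simp add: vec_eq_iff)
    ultimately show "(\<chi> i. tvar powi j) \<in> S.St P" by simp
  qed
  define E where "E i = (\<chi> k. if k = i then (1 :: complex poly fract) else 0)" for i :: 2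
  have E0: "E i \<in> B.Q U0" for i
  proof -
    have "E i = (\<chi> k. emb (if k = i then 1 else 0))" by (simp add: E_def vec_eq_iff)
    then show ?thesis using poly_Q by metis
  qed
  have Ei: "tvar powi (- (D $ i)) *s E i \<in> B.Q Ui" for i
  proof -
    have "tvar powi (- (D $ i)) *s E i = (\<chi> k. if k = i then tvar powi (- (D $ i)) else 0)"
      by (simp add: E_def vec_eq_iff)
    moreover have "(\<chi> k. if k = i then tvar powi (- (D $ i)) else 0) \<in> B.St P" if "P \<in> Ui" for P
      by (rule twist_power_St[OF w, of 0 "nat \<bar>D $ i\<bar>" _ "nat (\<bar>D $ i\<bar> - D $ i)"])
         (use nonvanishing_monomial[OF w, of 0 "nat \<bar>D $ i\<bar>"] \<open>P \<in> Ui\<close> in \<open>auto simp: Ui_iff\<close>)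
    ultimately show ?thesis unfolding B.Q_def by simp
  qed
  obtain v where v: "\<And>i. R U0 (v i) (E i)" using R_right_total[OF V0 E0] by metis
  obtain u where u: "\<And>i. R Ui (u i) (tvar powi (- (D $ i)) *s E i)" using R_right_total[OF Vi Ei] by metis
  have uv: "u i = tvar powi (- (D $ i)) *s v i" for i
  proof (rule R_inj[OF VU])
    show "R U (u i) (tvar powi (- (D $ i)) *s E i)" by (rule R_restrict[OF Vi u openU sub(2)])
    show "R U (tvar powi (- (D $ i)) *s v i) (tvar powi (- (D $ i)) *s E i)"
      using R_scale[OF VU R_restrict[OF V0 v openU sub(1)] powi_O] by simp
  qed
  have vG: "v i \<in> A.Gam (D $ i)" for i
  proof -
    have "v i \<in> A.Q U0" by (rule R_dom(1)[OF v])
    moreover have "u i \<in> A.Q Ui" by (rule R_dom(1)[OF u])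
    ultimately show ?thesis
      using U0_iff Ui_iff unfolding A.Gam_def A.Q_def uv by blast
  qed
  have "\<exists>y. v i = embv y \<and> (\<exists>m0. \<forall>m\<ge>m0. \<forall>a. degree a \<le> m \<longrightarrow> a *s y \<in> rv w ` AR f (D $ i + int m))" for i
  proof -
    obtain m0 where m0: "\<And>m a. m \<ge> m0 \<Longrightarrow> degree a \<le> m \<Longrightarrow> emb a *s v i \<in> embv ` rv w ` AR f (D $ i + int m)"
      using A.Gam_eventually[OF vG[of i]] by blast
    have "emb 1 *s v i \<in> embv ` rv w ` AR f (D $ i + int m0)" by (rule m0) auto
    then obtain y where y: "v i = embv y" unfolding emb.map_one vector_smult_lid by (elim imageE)
    have "a *s y \<in> rv w ` AR f (D $ i + int m)" if "m \<ge> m0" "degree a \<le> m" for m a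
    proof -
      have "embv (a *s y) \<in> embv ` rv w ` AR f (D $ i + int m)"
        using m0[OF that] by (simp only: y embv_scale)
      then obtain x where "embv (a *s y) = embv x" "x \<in> rv w ` AR f (D $ i + int m)" by (rule imageE)
      then show ?thesis using embv_inj by metis
    qed
    then show ?thesis using y by blast
  qed
  then obtain y where y: "\<And>i. v i = embv (y i)"
    "\<And>i. \<exists>m0. \<forall>m\<ge>m0. \<forall>a. degree a \<le> m \<longrightarrow> a *s y i \<in> rv w ` AR f (D $ i + int m)" by metis
  have comb: "R U0 (embv (p 1 *s y 1 + p 2 *s y 2)) (\<chi> i. emb (p i))" for p
  proof -
    have "R U0 (emb (p i) *s v i) (emb (p i) *s E i)" for i
      using R_scale[OF V0 v poly_O] by simp
    from R_add[OF V0 this[of 1] this[of 2]]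
    have "R U0 (emb (p 1) *s v 1 + emb (p 2) *s v 2) (emb (p 1) *s E 1 + emb (p 2) *s E 2)" .
    moreover have "emb (p 1) *s E 1 + emb (p 2) *s E 2 = (\<chi> i. emb (p i))"
      by (simp add: E_def vec_eq_iff forall_2)
    ultimately show ?thesis by (simp add: embv_add embv_scale y(1))
  qed
  have indep: "a = 0 \<and> b = 0" if "a *s y 1 + b *s y 2 = 0" for a b
  proof -
    have "R U0 (embv 0) (\<chi> i. emb (if i = 1 then a else b))"
      using comb[of "\<lambda>i. if i = 1 then a else b"] that by simp
    moreover have "embv 0 = (0 :: (complex poly fract) ^ 3)" by (simp add: embv_def vec_eq_iff)
    ultimately have "(\<chi> i :: 2. emb (if i = 1 then a else b)) = 0" using R_zero[OF V0] by simp
    then show ?thesis by (simp add: vec_eq_iff forall_2)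
  qed
  have gen: "\<exists>p. (\<forall>i. p i \<in> bform (k - D $ i)) \<and> x = p 1 *s y 1 + p 2 *s y 2" if x: "x \<in> rv w ` AR f k" for x k
  proof (cases "k < 0")
    case True
    obtain m where m: "m \<in> AR f k" "x = rv w m" using x by blast
    have "m $ i = 0" for i using homog_neg[OF _ True, of "m $ i"] m(1) by (simp add: AR_def)
    then have "x = 0" by (simp add: m(2) rv_def vec_eq_iff)
    then show ?thesis by (intro exI[of _ "\<lambda>_. 0"]) (simp add: bform_def)
  next
    case False
    then have xG: "embv x \<in> A.Gam k" using x A.rv_in_Gam by auto
    then have xQ: "embv x \<in> A.Q U0" by (auto simp: A.Gam_def A.Q_def U0_iff)
    then obtain q where q: "R U0 (embv x) q" using R_left_total[OF V0] by blast
    have "\<exists>p. q $ i = emb p" for i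
    proof (rule regular_imp_polynomial)
      fix t
      have "q \<in> B.St (aff_pt w t)" using R_dom(2)[OF q] aU0[of t] by (simp add: B.Q_def)
      then obtain m g j where m: "m \<in> twist D j" "g \<in> homog j" "nonvanishing g (aff_pt w t)" "q = rfrac w m g"
        by (rule B.StE)
      have "poly (rest w g) t \<noteq> 0" using nonvanishing_aff[OF w m(2)] m(3) by blast
      then show "\<exists>a b. q $ i = emb a / emb b \<and> poly b t \<noteq> 0" unfolding m(4) rfrac_def by auto
    qed
    then obtain p where p: "\<And>i. q $ i = emb (p i)" by metis
    then have qp: "q = (\<chi> i. emb (p i))" by (simp add: vec_eq_iff)
    have "embv x = embv (p 1 *s y 1 + p 2 *s y 2)" by (rule R_inj[OF V0 q]) (unfold qp, rule comb)
    then have xp: "x = p 1 *s y 1 + p 2 *s y 2" by (rule embv_inj)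
    \<comment> \<open>The coordinates \<open>q\<close>, divided by \<open>t\<close> to the power \<open>k\<close>, agree on the overlap with a section over
      the chart at infinity.\<close>
    let ?S = "tvar powi (- k)"
    have RU: "R U (?S *s embv x) (?S *s q)"
      using R_scale[OF VU R_restrict[OF V0 q openU sub(1)] powi_O] by simp
    have "?S *s embv x \<in> A.St P" if P: "P \<in> Ui" for P
    proof (cases "P = inf_pt w")
      case True
      then show ?thesis using xG by (simp add: A.Gam_def)
    next
      case False
      then have "P \<in> U" using P unfolding Ui_iff U_iff by blast
      then show ?thesis using R_dom(1)[OF RU] by (simp add: A.Q_def)
    qed
    then have "?S *s embv x \<in> A.Q Ui" by (simp add: A.Q_def)
    then obtain c where c: "R Ui (?S *s embv x) c" using R_left_total[OF Vi] by blast
    have "c = ?S *s q" by (rule R_fun[OF VU R_restrict[OF Vi c openU sub(2)] RU])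
    then have "?S *s q \<in> B.St (inf_pt w)" using R_dom(2)[OF c] iUi by (simp add: B.Q_def)
    then obtain m g j where m: "m \<in> twist D j" "g \<in> homog j" "nonvanishing g (inf_pt w)" "?S *s q = rfrac w m g"
      by (rule B.StE)
    note g0 = nonvanishing_imp_rest[OF w aL(2) m(2,3)]
    have gj: "g \<in> homog (int (nat j))" using m(2) g0(2) by simp
    have "coeff (rest w g) (nat j) \<noteq> 0" using nonvanishing_inf[OF w gj] m(3) by blast
    then have deg: "degree (rest w g) = nat j"
      using le_antisym[OF frame_decomp(1)[OF w gj] le_degree] by blast
    have "p i \<in> bform (k - D $ i)" for i
    proof (cases "p i = 0")
      case False
      have "?S * emb (p i) = emb (rest w (m $ i)) / emb (rest w g)"
        using m(4) by (simp add: vec_eq_iff rfrac_def p)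
      then have "emb (rest w (m $ i)) = tvar powi (- k) * emb (p i * rest w g)"
        using g0(1) by (simp add: field_simps emb.map_mult)
      moreover from this have "rest w (m $ i) \<noteq> 0" using False g0(1) by (auto simp: emb.map_mult)
      ultimately have "int (degree (rest w (m $ i))) = - k + int (degree (p i * rest w g))"
        by (rule degree_of_fraction)
      moreover have "int (degree (rest w (m $ i))) \<le> j - D $ i"
        using homog_rest[OF w, of "m $ i" "j - D $ i"] m(1) \<open>rest w (m $ i) \<noteq> 0\<close> by (simp add: twist_def bform_def)
      ultimately show ?thesis using False g0 deg by (simp add: bform_def degree_mult_eq)
    qed (simp add: bform_def)
    then show ?thesis using xp by blast
  qed
  show ?thesis
    by (rule exI[of _ y]) (use y(2) gen indep in blast)
qed

section \<open>Counting dimensions\<close>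

definition forms3 :: "int \<Rightarrow> (3 mpoly ^ 3) set" where
  "forms3 k = {r. \<forall>i. r $ i \<in> homog k}"

lemma forms3_part_subspace: "mv.subspace {r \<in> forms3 k. \<forall>i\<in>A. r $ i = 0}"
  by (auto simp: mv.subspace_def forms3_def mvscale_def homog_add homog_cmult)

lemma quot_dim_forms3_part:
  "mv.fin_quot (forms3 k) {r \<in> forms3 k. \<forall>i\<in>A. r $ i = 0} \<and>
   int (quot_dim mvscale (forms3 k) {r \<in> forms3 k. \<forall>i\<in>A. r $ i = 0}) = int (card A) * hdim k"
proof -
  have "finite A" by simp
  then show ?thesis
  proof (induction A rule: finite_induct)
    case empty
    have "mv.subspace (forms3 k)" using forms3_part_subspace[of k "{}"] by simp
    then show ?case using mv.quot_dim_trivial[of "forms3 k" "forms3 k"] by simp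
  next
    case (insert j A)
    let ?V = "{r \<in> forms3 k. \<forall>i\<in>A. r $ i = 0}" and ?W = "{r \<in> forms3 k. \<forall>i\<in>insert j A. r $ i = 0}"
    note sV = forms3_part_subspace[of k A] and sW = forms3_part_subspace[of k "insert j A"]
    have tr: "\<And>v. v \<in> ?V \<Longrightarrow> v $ j \<in> homog k" "\<And>v. v \<in> ?V \<Longrightarrow> (v $ j \<in> {0}) = (v \<in> ?W)"
      by (auto simp: forms3_def)
    have onto: "\<exists>v\<in>?V. v $ j - p \<in> {0}" if "p \<in> homog k" for p
      using that insert.hyps by (intro bexI[of _ "\<chi> i. if i = j then p else 0"]) (auto simp: forms3_def)
    have f: "mv.fin_quot ?V ?W"
      by (rule fin_quot_pullback[OF mv.cvs_axioms mp.cvs_axioms sV sW, where T = "\<lambda>r. r $ j" and V' = "homog k" and W' = "{0}"])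
         (use tr onto quot_dim_homog in \<open>auto simp: mp.subspace_single_0 mvscale_def mscale_def\<close>)
    have q: "quot_dim mscale (homog k) {0 :: 3 mpoly} = quot_dim mvscale ?V ?W"
      by (rule quot_dim_transport(2)[OF mv.cvs_axioms mp.cvs_axioms sV sW, where T = "\<lambda>r. r $ j" and V' = "homog k" and W' = "{0}"])
         (use tr onto f in \<open>auto simp: mp.subspace_single_0 mvscale_def mscale_def\<close>)
    have fin: "mv.fin_quot (forms3 k) ?W"
      by (rule mv.fin_quot_chain[OF sW sV _ _ _ f]) (use insert.IH in auto)
    have "quot_dim mvscale (forms3 k) ?W = quot_dim mvscale (forms3 k) ?V + quot_dim mvscale ?V ?W"
      by (rule mv.quot_dim_chain[OF sW sV _ _ fin]) auto
    then have "int (quot_dim mvscale (forms3 k) ?W) = int (card A) * hdim k + hdim k"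
      using insert.IH q quot_dim_homog[of k] by simp
    then show ?case using fin insert.hyps by (simp add: algebra_simps)
  qed
qed

lemma quot_dim_forms3:
  "mv.fin_quot (forms3 k) {0}" "int (quot_dim mvscale (forms3 k) {0}) = 3 * hdim k"
proof -
  have "{r \<in> forms3 k. \<forall>i\<in>UNIV. r $ i = 0} = {0}" by (auto simp: forms3_def vec_eq_iff)
  then show "mv.fin_quot (forms3 k) {0}" "int (quot_dim mvscale (forms3 k) {0}) = 3 * hdim k"
    using quot_dim_forms3_part[of k UNIV] by simp_all
qed

lemma AR_subspace: "mv.subspace (AR f k)"
  by (auto simp: mv.subspace_def AR_def syz_def mvscale_def homog_add homog_cmult distrib_right sum.distrib
      mult.assoc sum_distrib_left[symmetric])

lemma AR_sub_forms3: "AR f k \<subseteq> forms3 k"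
  by (auto simp: AR_def forms3_def)

lemma AR_fin: "mv.fin_quot (AR f k) {0}"
  by (rule mv.fin_quot_sub[OF _ AR_sub_forms3 quot_dim_forms3(1)]) (simp add: mv.subspace_single_0)

lemma AR_neg: "k < 0 \<Longrightarrow> AR f k = {0}"
proof -
  assume k: "k < 0"
  have "r = 0" if "r \<in> AR f k" for r
  proof -
    have "r $ i = 0" for i using homog_neg[of "r $ i" k] k that by (simp add: AR_def)
    then show ?thesis by (simp add: vec_eq_iff)
  qed
  then show ?thesis using mv.subspace_0[OF AR_subspace] by blast
qed

definition ar_dim :: "3 mpoly \<Rightarrow> int \<Rightarrow> int" where
  "ar_dim f k = int (quot_dim mvscale (AR f k) {0})"

text \<open>The exact sequence of \<open>AR(f)\<^sub>k\<close>, \<open>S\<^sub>k\<^sup>3\<close> and the Jacobian ideal.\<close>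

lemma jacobian_dimension:
  assumes f: "f \<in> homog d"
  shows "int (quot_dim mscale (homog (k + d - 1)) (jac f d (k + d - 1))) = hdim (k + d - 1) - 3 * hdim k + ar_dim f k"
proof -
  let ?m = "k + d - 1"
  let ?T = "\<lambda>r :: 3 mpoly ^ 3. \<Sum>i\<in>UNIV. r $ i * pdiff i f"
  have f3: "mv.subspace (forms3 k)" using forms3_part_subspace[of k "{}"] by simp
  have fin: "mv.fin_quot (forms3 k) (AR f k)"
    by (rule mv.fin_quot_mono[OF _ AR_subspace _ quot_dim_forms3(1)])
       (use mv.subspace_0[OF AR_subspace] in \<open>auto simp: mv.subspace_single_0\<close>)
  have "quot_dim mscale (jac f d ?m) {0} = quot_dim mvscale (forms3 k) (AR f k)"
  proof (rule quot_dim_transport(2)[OF mv.cvs_axioms mp.cvs_axioms f3 AR_subspace, where T = ?T])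
    show "?T v \<in> jac f d ?m" if "v \<in> forms3 k" for v
      using that by (intro jacI) (simp add: forms3_def)
    show "(?T v \<in> {0}) = (v \<in> AR f k)" if "v \<in> forms3 k" for v
      using that by (simp add: AR_def syz_def forms3_def)
    show "\<exists>v\<in>forms3 k. ?T v - p \<in> {0}" if p: "p \<in> jac f d ?m" for p
    proof -
      obtain a where a: "\<And>i. a i \<in> homog (?m - (d - 1))" "p = (\<Sum>i\<in>UNIV. a i * pdiff i f)"
        using p unfolding jac_def by blast
      then show ?thesis by (intro bexI[of _ "\<chi> i. a i"]) (auto simp: forms3_def)
    qed
    show "?T (x + y) = ?T x + ?T y" for x y by (simp add: distrib_right sum.distrib)
    show "?T (mvscale c x) = mscale c (?T x)" for c x
      by (simp add: mvscale_def mscale_def sum_distrib_left mult.assoc)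
  qed (use fin in \<open>auto simp: mp.subspace_single_0\<close>)
  moreover have "quot_dim mvscale (forms3 k) {0} = quot_dim mvscale (forms3 k) (AR f k) + quot_dim mvscale (AR f k) {0}"
    by (rule mv.quot_dim_chain[OF _ AR_subspace _ AR_sub_forms3 quot_dim_forms3(1)])
       (use mv.subspace_0[OF AR_subspace] in \<open>auto simp: mv.subspace_single_0\<close>)
  moreover have "quot_dim mscale (homog ?m) {0 :: 3 mpoly} = quot_dim mscale (homog ?m) (jac f d ?m) + quot_dim mscale (jac f d ?m) {0}"
    by (rule mp.quot_dim_chain[OF _ jac_subspace _ jac_homog[OF f]])
       (use mp.subspace_0[OF jac_subspace] quot_dim_homog in \<open>auto simp: mp.subspace_single_0\<close>)
  ultimately show ?thesis using quot_dim_forms3(2)[of k] quot_dim_homog[of ?m] by (simp add: ar_dim_def)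
qed

lemma rv_image_subspace: "pv.subspace (rv w ` AR f k)"
  unfolding pv.subspace_def
proof (intro conjI ballI allI)
  note A = AR_subspace[of f k]
  have "rv w 0 = 0" by (simp add: rv_def vec_eq_iff)
  then show "0 \<in> rv w ` AR f k" using mv.subspace_0[OF A] by (metis imageI)
  fix x assume "x \<in> rv w ` AR f k"
  then obtain m where m: "m \<in> AR f k" "x = rv w m" by blast
  have "pvscale c x = rv w (mvscale c m)" for c
    by (simp add: m(2) rv_def pvscale_def mvscale_def vec_eq_iff rest.map_mult)
  then show "pvscale c x \<in> rv w ` AR f k" for c using mv.subspace_scale[OF A m(1)] by blast
  fix y assume "y \<in> rv w ` AR f k"
  then obtain m' where m': "m' \<in> AR f k" "y = rv w m'" by blast
  have "x + y = rv w (m + m')" by (simp add: m(2) m'(2) rv_def vec_eq_iff rest.map_add)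
  then show "x + y \<in> rv w ` AR f k" using mv.subspace_add[OF A m(1) m'(1)] by blast
qed

text \<open>Multiplication by the equation of the line identifies \<open>AR(f)\<close>, shifted by one degree, with the kernel of the
  restriction.\<close>

lemma ar_dim_rec:
  assumes w: "invertible w"
  shows "pv.fin_quot (rv w ` AR f k) {0}"
    "ar_dim f k = ar_dim f (k - 1) + int (quot_dim pvscale (rv w ` AR f k) {0})"
proof -
  interpret line_module w "AR f" "\<lambda>_. 0" by (rule AR_module[OF w])
  let ?X = "(\<lambda>r. coord w 3 *s r) ` AR f (k - 1)"
  note A = AR_subspace[of f k] and A' = AR_subspace[of f "k - 1"]
  have X: "mv.subspace ?X"
    unfolding mv.subspace_def
  proof (intro conjI ballI allI)
    have "0 = coord w 3 *s (0 :: 3 mpoly ^ 3)" by simp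
    then show "0 \<in> ?X" using mv.subspace_0[OF A'] by blast
    fix x assume "x \<in> ?X"
    then obtain r where r: "r \<in> AR f (k - 1)" "x = coord w 3 *s r" by blast
    have "mvscale c x = coord w 3 *s mvscale c r" for c
      by (simp add: r(2) mvscale_def vec_eq_iff mult.left_commute)
    then show "mvscale c x \<in> ?X" for c using mv.subspace_scale[OF A' r(1)] by blast
    fix y assume "y \<in> ?X"
    then obtain s where s: "s \<in> AR f (k - 1)" "y = coord w 3 *s s" by blast
    have "x + y = coord w 3 *s (r + s)" by (simp add: r(2) s(2) vector_add_ldistrib)
    then show "x + y \<in> ?X" using mv.subspace_add[OF A' r(1) s(1)] by blast
  qed
  have XA: "?X \<subseteq> AR f k" using M_scale[OF coord_homog, of _ "k - 1" w 3] by auto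
  have 0: "{0} \<subseteq> ?X" using mv.subspace_0[OF X] by simp
  have ker: "(rv w v \<in> {0}) = (v \<in> ?X)" if v: "v \<in> AR f k" for v
  proof
    assume "rv w v \<in> {0}"
    then have "rest w (v $ i) = 0" for i by (simp add: rv_def vec_eq_iff)
    from M_div[OF v this] show "v \<in> ?X" by blast
  next
    assume "v \<in> ?X"
    then show "rv w v \<in> {0}" by (auto simp: rv_def vec_eq_iff rest.map_mult w)
  qed
  have fX: "mv.fin_quot (AR f k) ?X"
    by (rule mv.fin_quot_mono[OF _ X 0 AR_fin]) (simp add: mv.subspace_single_0)
  have N: "pv.fin_quot (rv w ` AR f k) {0} \<and> quot_dim pvscale (rv w ` AR f k) {0} = quot_dim mvscale (AR f k) ?X"
    by (intro conjI; rule quot_dim_transport[OF mv.cvs_axioms pv.cvs_axioms A X, where T = "rv w"])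
       (use ker fX in \<open>auto simp: pv.subspace_single_0 rv_def pvscale_def mvscale_def vec_eq_iff rest.hom_simps\<close>)
  then show "pv.fin_quot (rv w ` AR f k) {0}" by blast
  have s: "quot_dim mvscale ?X {0} = quot_dim mvscale (AR f (k - 1)) {0}"
    by (rule quot_dim_transport(2)[OF mv.cvs_axioms mv.cvs_axioms A', where T = "\<lambda>r. coord w 3 *s r"])
       (use coord_nonzero[OF w, of 3] AR_fin in
        \<open>auto simp: mv.subspace_single_0 mvscale_def vec_eq_iff algebra_simps\<close>)
  have "quot_dim mvscale (AR f k) {0} = quot_dim mvscale (AR f k) ?X + quot_dim mvscale ?X {0}"
    by (rule mv.quot_dim_chain[OF _ X 0 XA AR_fin]) (simp add: mv.subspace_single_0)
  then show "ar_dim f k = ar_dim f (k - 1) + int (quot_dim pvscale (rv w ` AR f k) {0})"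
    using N s by (simp add: ar_dim_def)
qed

text \<open>The graded module over the coordinate ring of the line with the basis \<open>y 1\<close>, \<open>y 2\<close> in
  degrees \<open>D 1\<close>, \<open>D 2\<close>.\<close>

definition free_mod :: "(2 \<Rightarrow> complex poly ^ 3) \<Rightarrow> (2 \<Rightarrow> int) \<Rightarrow> int \<Rightarrow> (complex poly ^ 3) set" where
  "free_mod y D k = {p *s y 1 + q *s y 2 | p q. p \<in> bform (k - D 1) \<and> q \<in> bform (k - D 2)}"

lemma free_modI: "p \<in> bform (k - D 1) \<Longrightarrow> q \<in> bform (k - D 2) \<Longrightarrow> p *s y 1 + q *s y 2 \<in> free_mod y D k"
  unfolding free_mod_def by blast

lemma bform_add: "p \<in> bform k \<Longrightarrow> q \<in> bform k \<Longrightarrow> p + q \<in> bform k"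
  and bform_cmult: "p \<in> bform k \<Longrightarrow> [:c:] * p \<in> bform k"
  and bform_0: "0 \<in> bform k"
  by (auto simp: bform_iff)

lemma free_mod_subspace: "pv.subspace (free_mod y D k)"
  unfolding pv.subspace_def
proof (intro conjI ballI allI)
  show "0 \<in> free_mod y D k" using free_modI[of 0 k D 0 y, OF bform_0 bform_0] by simp
  fix x assume "x \<in> free_mod y D k"
  then obtain p q where x: "x = p *s y 1 + q *s y 2" "p \<in> bform (k - D 1)" "q \<in> bform (k - D 2)"
    unfolding free_mod_def by blast
  have "pvscale c x = ([:c:] * p) *s y 1 + ([:c:] * q) *s y 2" for c
    unfolding x(1) pvscale_def by (simp only: vector_add_ldistrib vector_smult_assoc)
  then show "pvscale c x \<in> free_mod y D k" for c using free_modI[of _ k D _ y, OF bform_cmult[OF x(2)] bform_cmult[OF x(3)]] by simp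
  fix z assume "z \<in> free_mod y D k"
  then obtain p' q' where z: "z = p' *s y 1 + q' *s y 2" "p' \<in> bform (k - D 1)" "q' \<in> bform (k - D 2)"
    unfolding free_mod_def by blast
  have "x + z = (p + p') *s y 1 + (q + q') *s y 2"
    unfolding x(1) z(1) by (simp add: vector_sadd_rdistrib)
  then show "x + z \<in> free_mod y D k" using free_modI[of _ k D _ y, OF bform_add[OF x(2) z(2)] bform_add[OF x(3) z(3)]] by simp
qed

lemma quot_dim_free_mod:
  assumes indep: "\<And>a b. a *s y 1 + b *s y 2 = 0 \<Longrightarrow> a = 0 \<and> b = 0"
  shows "pv.fin_quot (free_mod y D k) {0}"
    "quot_dim pvscale (free_mod y D k) {0} = nat (k - D 1 + 1) + nat (k - D 2 + 1)"
proof -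
  let ?V = "free_mod y D k" and ?W = "(\<lambda>q. q *s y 2) ` bform (k - D 2)"
  have W: "pv.subspace ?W"
    unfolding pv.subspace_def
  proof (intro conjI ballI allI)
    have "0 = (0 :: complex poly) *s y 2" by simp
    then show "0 \<in> ?W" using bform_0 by blast
    fix x assume "x \<in> ?W"
    then obtain q where q: "q \<in> bform (k - D 2)" "x = q *s y 2" by blast
    have "pvscale c x = ([:c:] * q) *s y 2" for c
      unfolding q(2) pvscale_def by (simp only: vector_smult_assoc)
    then show "pvscale c x \<in> ?W" for c using bform_cmult[OF q(1)] by blast
    fix z assume "z \<in> ?W"
    then obtain q' where q': "q' \<in> bform (k - D 2)" "z = q' *s y 2" by blast
    have "x + z = (q + q') *s y 2" by (simp add: q(2) q'(2) vector_sadd_rdistrib)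
    then show "x + z \<in> ?W" using bform_add[OF q(1) q'(1)] by blast
  qed
  have WV: "?W \<subseteq> ?V"
  proof
    fix x assume "x \<in> ?W"
    then obtain q where q: "q \<in> bform (k - D 2)" "x = 0 *s y 1 + q *s y 2" by auto
    show "x \<in> ?V" unfolding q(2) by (rule free_modI[of 0 k D q y, OF bform_0 q(1)])
  qed
  note V = free_mod_subspace[of y D k]
  have y1: "p *s y 1 \<in> ?W \<longleftrightarrow> p = 0" for p
  proof
    assume "p *s y 1 \<in> ?W"
    then obtain q where "p *s y 1 = q *s y 2" by blast
    then have "p *s y 1 + (- q) *s y 2 = 0" by (simp add: vec_eq_iff)
    then show "p = 0" using indep by blast
  next
    assume "p = 0"
    then show "p *s y 1 \<in> ?W" using pv.subspace_0[OF W] by simp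
  qed
  have "y 2 \<noteq> 0" using indep[of 0 1] by auto
  have scl: "smult c p *s z = pvscale c (p *s z)" for c p and z :: "complex poly ^ 3"
    by (simp add: pvscale_def vec_eq_iff)
  have q1: "pv.fin_quot ?V ?W \<and> quot_dim pvscale ?V ?W = quot_dim smult (bform (k - D 1)) {0}"
  proof (intro conjI; rule quot_dim_transport[OF up.cvs_axioms pv.cvs_axioms bform_subspace _ W, where T = "\<lambda>p. p *s y 1" and W = "{0}"])
    show "v *s y 1 \<in> ?V" if "v \<in> bform (k - D 1)" for v using free_modI[of v k D 0 y, OF that bform_0] by simp
    show "v *s y 1 \<in> ?V" if "v \<in> bform (k - D 1)" for v using free_modI[of v k D 0 y, OF that bform_0] by simp
    show "\<exists>v\<in>bform (k - D 1). v *s y 1 - x \<in> ?W" if x: "x \<in> ?V" for x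
    proof -
      obtain p q where pq: "x = p *s y 1 + q *s y 2" "p \<in> bform (k - D 1)" "q \<in> bform (k - D 2)"
        using x unfolding free_mod_def by blast
      have "q *s y 2 \<in> ?W" using pq(3) by blast
      from pv.subspace_neg[OF W this] show ?thesis using pq(1,2) by (intro bexI[of _ p]) simp
    qed
    then show "\<exists>v\<in>bform (k - D 1). v *s y 1 - x \<in> ?W" if x: "x \<in> ?V" for x using x by blast
  qed (auto simp: up.subspace_single_0 y1 quot_dim_bform scl vector_sadd_rdistrib)
  have q2: "pv.fin_quot ?W {0} \<and> quot_dim pvscale ?W {0} = quot_dim smult (bform (k - D 2)) {0}"
    by (intro conjI; rule quot_dim_transport[OF up.cvs_axioms pv.cvs_axioms bform_subspace, where T = "\<lambda>p. p *s y 2" and W = "{0}" and W' = "{0}"])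
       (auto simp: up.subspace_single_0 pv.subspace_single_0 \<open>y 2 \<noteq> 0\<close> quot_dim_bform scl vector_sadd_rdistrib)
  have 0: "{0} \<subseteq> ?W" using pv.subspace_0[OF W] by simp
  show f: "pv.fin_quot ?V {0}"
    by (rule pv.fin_quot_chain[OF _ W 0 WV]) (use q1 q2 in \<open>auto simp: pv.subspace_single_0\<close>)
  show "quot_dim pvscale ?V {0} = nat (k - D 1 + 1) + nat (k - D 2 + 1)"
    using pv.quot_dim_chain[OF _ W 0 WV f] q1 q2 quot_dim_bform(2) by (simp add: pv.subspace_single_0)
qed

lemma hdim2: "k \<ge> -2 \<Longrightarrow> 2 * hdim k = (k + 1) * (k + 2)"
proof (cases "k < 0")
  case True
  assume "k \<ge> -2"
  then have "k = -1 \<or> k = -2" using True by auto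
  then show ?thesis by (auto simp: hdim_def)
next
  case False
  have "even ((k + 1) * (k + 2))" by auto
  then show ?thesis using False by (simp add: hdim_def)
qed

text \<open>The discrepancy \<open>b k\<close> between the Hilbert functions of the free module with generators in
  degrees \<open>D 1\<close>, \<open>D 2\<close> and of \<open>AR(f)\<close> is nondecreasing, since its increments are the codimensions
  of the restrictions in the sections of the restricted bundle. Its final value is the defect in
  the inequality.\<close>

theorem tjurina_splitting_formula:
  assumes f: "f \<in> homog (int d)" and d: "d \<ge> 1" and sqf: "squarefree f" and w: "invertible w"
    and large: "\<And>i :: 2. \<exists>m0. \<forall>m\<ge>m0. \<forall>a. degree a \<le> m \<longrightarrow> a *s y i \<in> rv w ` AR f (D i + int m)"
    and gen: "\<And>k. rv w ` AR f k \<subseteq> free_mod y D k"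
    and indep: "\<And>a b. a *s y 1 + b *s y 2 = 0 \<Longrightarrow> a = 0 \<and> b = 0"
  shows "int (tjurina f) \<le> (int d - 1)\<^sup>2 - D 1 * D 2"
    "int (tjurina f) = (int d - 1)\<^sup>2 - D 1 * D 2 \<longleftrightarrow> (\<forall>k. rv w ` AR f k = free_mod y D k)"
proof -
  define N where "N k = rv w ` AR f k" for k
  define G where "G = free_mod y D"
  define \<delta> where "\<delta> k = int (quot_dim pvscale (G k) (N k))" for k
  define b where "b k = hdim (k - D 1) + hdim (k - D 2) - ar_dim f k" for k
  have N0: "{0} \<subseteq> N k" for k using pv.subspace_0[OF rv_image_subspace] by (simp add: N_def)
  have fG: "pv.fin_quot (G k) (N k)" for k
    unfolding G_def
    by (rule pv.fin_quot_mono[OF _ _ _ quot_dim_free_mod(1)[of y D k, OF indep]])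
       (use N0 rv_image_subspace in \<open>auto simp: pv.subspace_single_0 N_def\<close>)
  have b_rec: "b k = b (k - 1) + \<delta> k" for k
  proof -
    have swap: "k - x - 1 = k - 1 - x" for x by simp
    have "quot_dim pvscale (G k) {0} = quot_dim pvscale (G k) (N k) + quot_dim pvscale (N k) {0}"
      unfolding G_def N_def
      by (rule pv.quot_dim_chain[OF _ rv_image_subspace _ gen quot_dim_free_mod(1)[OF indep]])
         (use N0 in \<open>auto simp: pv.subspace_single_0 N_def\<close>)
    moreover have "quot_dim pvscale (G k) {0} = nat (k - D 1 + 1) + nat (k - D 2 + 1)"
      unfolding G_def by (rule quot_dim_free_mod(2)[OF indep])
    ultimately have "int (nat (k - D 1 + 1)) + int (nat (k - D 2 + 1)) = \<delta> k + int (quot_dim pvscale (N k) {0})"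
      unfolding \<delta>_def by (simp only: of_nat_add[symmetric])
    moreover have "hdim (k - D 1) = hdim (k - 1 - D 1) + int (nat (k - D 1 + 1))"
      "hdim (k - D 2) = hdim (k - 1 - D 2) + int (nat (k - D 2 + 1))"
      using hdim_rec[of "k - D 1"] hdim_rec[of "k - D 2"] by (simp_all only: swap)
    moreover have "ar_dim f k = ar_dim f (k - 1) + int (quot_dim pvscale (N k) {0})"
      unfolding N_def by (rule ar_dim_rec(2)[OF w])
    ultimately show ?thesis unfolding b_def by linarith
  qed
  have \<delta>0: "\<delta> k \<ge> 0" for k by (simp add: \<delta>_def)
  have \<delta>_iff: "\<delta> k = 0 \<longleftrightarrow> N k = G k" for k
  proof
    assume "\<delta> k = 0"
    then have "G k \<subseteq> N k" using pv.quot_dim_0D[OF rv_image_subspace fG[unfolded N_def]] by (simp add: \<delta>_def N_def)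
    then show "N k = G k" using gen[of k] by (auto simp: N_def G_def)
  next
    assume "N k = G k"
    then show "\<delta> k = 0" using pv.quot_dim_trivial(2)[OF rv_image_subspace, of "G k" w f k] by (simp add: \<delta>_def N_def)
  qed
  have b_mono: "b j \<le> b k" if "j \<le> k" for j k
    using that
  proof (induction k rule: int_ge_induct)
    case (step i)
    then show ?case using b_rec[of "i + 1"] \<delta>0[of "i + 1"] by simp
  qed simp
  \<comment> \<open>Below this degree all three Hilbert functions vanish.\<close>
  define k0 where "k0 = min 0 (min (D 1) (D 2)) - 1"
  have b_start: "b k = 0" if "k \<le> k0" for k
  proof -
    have "k < 0" using that by (simp add: k0_def)
    then have "ar_dim f k = 0"
      using AR_neg[of k f] mv.quot_dim_trivial(2)[of "{0}" "{0}"] by (simp add: ar_dim_def mv.subspace_single_0)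
    then show ?thesis using that by (simp add: b_def hdim_def k0_def)
  qed
  have b_nonneg: "b k \<ge> 0" for k
    using b_mono[of "min k k0" k] b_start[of "min k k0"] by simp
  obtain m where m: "\<And>i j a. j \<ge> m i \<Longrightarrow> degree a \<le> j \<Longrightarrow> a *s y i \<in> N (D i + int j)"
    using large unfolding N_def by metis
  define K where "K = Max (range (\<lambda>i. D i + int (m i)))"
  have NG: "N k = G k" if k: "k \<ge> K" for k
  proof
    show "N k \<subseteq> G k" using gen by (simp add: N_def G_def)
    have el: "p *s y i \<in> N k" if p: "p \<in> bform (k - D i)" for p i
    proof -
      have "D i + int (m i) \<le> K" unfolding K_def by (intro Max_ge) auto
      then have *: "int (m i) \<le> k - D i" using k by simp
      then have "degree p \<le> nat (k - D i)" using p by (auto simp: bform_def)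
      moreover have "m i \<le> nat (k - D i)" using * by simp
      moreover have "D i + int (nat (k - D i)) = k" using * by simp
      ultimately show ?thesis using m[of i "nat (k - D i)" p] by simp
    qed
    show "G k \<subseteq> N k"
    proof
      fix x assume "x \<in> G k"
      then obtain p q where x: "x = p *s y 1 + q *s y 2" "p \<in> bform (k - D 1)" "q \<in> bform (k - D 2)"
        unfolding G_def free_mod_def by blast
      show "x \<in> N k"
        unfolding x(1) N_def by (rule pv.subspace_add[OF rv_image_subspace el[OF x(2), unfolded N_def] el[OF x(3), unfolded N_def]])
    qed
  qed
  have b_end: "b k = b K" if "k \<ge> K" for k
    using that
  proof (induction k rule: int_ge_induct)
    case (step i)
    then show ?case using b_rec[of "i + 1"] \<delta>_iff[of "i + 1"] NG[of "i + 1"] by simp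
  qed simp
  obtain m1 where m1: "\<And>m. m \<ge> m1 \<Longrightarrow> quot_dim mscale (homog (int m)) (jac f (int d) (int m)) = tjurina f"
    using hilbert_function_jacobian[OF f d sqf] by blast
  define k where "k = max (max 0 K) (max (int m1) (max (D 1) (D 2)))"
  have tau: "int (tjurina f) = hdim (j + int d - 1) - 3 * hdim j + hdim (j - D 1) + hdim (j - D 2) - b K" if j: "j \<ge> k" for j
  proof -
    have "int (nat (j + int d - 1)) = j + int d - 1" "m1 \<le> nat (j + int d - 1)" using j d by (auto simp: k_def)
    then have "int (tjurina f) = int (quot_dim mscale (homog (j + int d - 1)) (jac f (int d) (j + int d - 1)))"
      using m1[of "nat (j + int d - 1)"] by simp
    also have "\<dots> = hdim (j + int d - 1) - 3 * hdim j + ar_dim f j" by (rule jacobian_dimension[OF f])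
    also have "ar_dim f j = hdim (j - D 1) + hdim (j - D 2) - b K"
      using b_end[of j] j by (simp add: b_def k_def)
    finally show ?thesis by simp
  qed
  have k: "k \<ge> 0" "k \<ge> D 1" "k \<ge> D 2" by (auto simp: k_def)
  \<comment> \<open>The difference of the formula for consecutive degrees is linear in \<open>k\<close> and must vanish.\<close>
  have sum: "D 1 + D 2 = int d - 1"
  proof -
    have "hdim (k + 1 + int d - 1) = hdim (k + int d - 1) + (k + int d + 1)"
      "hdim (k + 1) = hdim k + (k + 2)" "hdim (k + 1 - D 1) = hdim (k - D 1) + (k - D 1 + 2)"
      "hdim (k + 1 - D 2) = hdim (k - D 2) + (k - D 2 + 2)"
      using hdim_rec[of "k + 1 + int d - 1"] hdim_rec[of "k + 1"] hdim_rec[of "k + 1 - D 1"] hdim_rec[of "k + 1 - D 2"] k d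
      by (simp_all add: algebra_simps)
    then show ?thesis using tau[of k] tau[of "k + 1"] by simp
  qed
  have main: "int (tjurina f) = (int d - 1)\<^sup>2 - D 1 * D 2 - b K"
  proof -
    have "2 * int (tjurina f) + 2 * b K = 2 * hdim (k + int d - 1) - 3 * (2 * hdim k) + 2 * hdim (k - D 1) + 2 * hdim (k - D 2)"
      using tau[of k] by simp
    also have "\<dots> = (k + (int d - 1) + 1) * (k + (int d - 1) + 2) - 3 * ((k + 1) * (k + 2))
        + (k - D 1 + 1) * (k - D 1 + 2) + (k - D 2 + 1) * (k - D 2 + 2)"
      using hdim2[of "k + int d - 1"] hdim2[of k] hdim2[of "k - D 1"] hdim2[of "k - D 2"] k d by (simp add: algebra_simps)
    also have "\<dots> = 2 * ((int d - 1)\<^sup>2 - D 1 * D 2)"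
      unfolding sum[symmetric] by (simp add: power2_eq_square algebra_simps)
    finally show ?thesis by simp
  qed
  show "int (tjurina f) \<le> (int d - 1)\<^sup>2 - D 1 * D 2" using main b_nonneg[of K] by simp
  have "b K = 0 \<longleftrightarrow> (\<forall>k. N k = G k)"
  proof
    assume bK: "b K = 0"
    have bz: "b k = 0" for k
      using b_mono[of k "max k K"] b_end[of "max k K"] b_nonneg[of k] bK by simp
    then show "\<forall>k. N k = G k" using b_rec \<delta>_iff by (metis add_0)
  next
    assume NG: "\<forall>k. N k = G k"
    then have \<delta>z: "\<delta> k = 0" for k using \<delta>_iff by blast
    have "b k = b k0" if "k0 \<le> k" for k
      using that
    proof (induction k rule: int_ge_induct)
      case (step i)
      then show ?case using b_rec[of "i + 1"] \<delta>z by simp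
    qed simp
    from this[of "max k0 K"] have "b (max k0 K) = 0" using b_start[of k0] by simp
    then show "b K = 0" using b_end[of "max k0 K"] by simp
  qed
  then show "int (tjurina f) = (int d - 1)\<^sup>2 - D 1 * D 2 \<longleftrightarrow> (\<forall>k. rv w ` AR f k = free_mod y D k)"
    using main by (simp add: N_def G_def)
qed

section \<open>Freeness\<close>

interpretation sm: module "vector_scalar_mult :: 3 mpoly \<Rightarrow> 3 mpoly ^ 3 \<Rightarrow> 3 mpoly ^ 3"
  by unfold_locales (auto simp: vec_eq_iff algebra_simps)

lemma syz_subspace: "sm.subspace (syz f)"
  by (auto simp: sm.subspace_def syz_def distrib_right sum.distrib mult.assoc sum_distrib_left[symmetric])

definition vcomp :: "int \<Rightarrow> 3 mpoly ^ 3 \<Rightarrow> 3 mpoly ^ 3" where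
  "vcomp k r = (\<chi> i. hcomp k (r $ i))"

lemma vcomp_syz:
  assumes f: "f \<in> homog d" and r: "r \<in> syz f"
  shows "vcomp k r \<in> AR f k"
proof -
  have "0 = hcomp ((d - 1) + k) (\<Sum>i\<in>UNIV. pdiff i f * r $ i)"
    using r by (simp add: syz_def mult.commute)
  also have "\<dots> = (\<Sum>i\<in>UNIV. pdiff i f * hcomp k (r $ i))"
    unfolding hcomp_sum by (intro sum.cong refl hcomp_mult pdiff_homog f)
  finally show ?thesis by (simp add: AR_def syz_def vcomp_def hcomp_homog mult.commute)
qed

lemma vcomp_sum: "\<exists>n. r = (\<Sum>k<n. vcomp (int k) r)"
proof -
  have "\<forall>i. \<exists>n. \<forall>N\<ge>n. r $ i = (\<Sum>k<N. hcomp (int k) (r $ i))"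
    using hcomp_sum_eq by blast
  then obtain n where n: "\<forall>i. \<forall>N\<ge>n i. r $ i = (\<Sum>k<N. hcomp (int k) (r $ i))"
    by (rule choice[THEN exE])
  have "r $ i = (\<Sum>k<Max (range n). vcomp (int k) r) $ i" for i
  proof -
    have "r $ i = (\<Sum>k<Max (range n). hcomp (int k) (r $ i))"
      by (rule n[rule_format]) (auto intro: Max_ge)
    also have "\<dots> = (\<Sum>k<Max (range n). vcomp (int k) r) $ i" by (simp add: vcomp_def)
    finally show ?thesis .
  qed
  then show ?thesis by (intro exI vec_eq_iff[THEN iffD2] allI)
qed

text \<open>Modulo the equation of a line the other two coordinates are a regular sequence.\<close>

lemma coord_regular:
  assumes w: "invertible w" and e: "coord w 1 ^ m * b' - coord w 2 ^ m * b = coord w 3 * c"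
  shows "\<exists>h z. b = coord w 1 ^ m * h + coord w 3 * z"
proof -
  note X = homog_power1[OF coord_homog, of w _ m]
  have "\<exists>h z. hcomp k b = coord w 1 ^ m * h + coord w 3 * z" for k
  proof -
    have "hcomp (int m + k) (coord w 1 ^ m * b') = hcomp (int m + k) (coord w 2 ^ m * b) + hcomp (1 + (int m + k - 1)) (coord w 3 * c)"
      using e hcomp_add[of "int m + k" "coord w 2 ^ m * b" "coord w 3 * c"] by (simp add: algebra_simps)
    then have "coord w 1 ^ m * hcomp k b' = coord w 2 ^ m * hcomp k b + coord w 3 * hcomp (int m + k - 1) c"
      unfolding hcomp_mult[OF X] hcomp_mult[OF coord_homog] .
    from arg_cong[OF this, of "rest w"] have r: "rest w (hcomp k b') = monom 1 m * rest w (hcomp k b)"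
      by (simp add: rest.hom_simps w monom_altdef)
    have "rest w (hcomp k b) \<in> bform (k - int m)"
    proof (cases "rest w (hcomp k b) = 0")
      case False
      have "int (degree (rest w (hcomp k b'))) \<le> k"
        using homog_rest[OF w hcomp_homog, of k b'] False r by (simp add: bform_def)
      then show ?thesis unfolding r using False by (simp add: bform_def degree_mult_eq degree_monom_eq)
    qed (simp add: bform_0)
    then obtain h where h: "h \<in> homog (k - int m)" "rest w h = rest w (hcomp k b)" using rest_onto[OF w] by blast
    have "coord w 1 ^ m * h \<in> homog k" using homog_mult[OF X h(1)] by simp
    from rest_kernel[OF w homog_diff[OF hcomp_homog this], of b] h(2)
    obtain z where "hcomp k b - coord w 1 ^ m * h = coord w 3 * z" by (auto simp: rest.hom_simps w)
    then have "hcomp k b = coord w 1 ^ m * h + coord w 3 * z" by (simp add: algebra_simps)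
    then show ?thesis by blast
  qed
  then obtain h z where hz: "\<And>k. hcomp k b = coord w 1 ^ m * h k + coord w 3 * z k" by metis
  obtain n where "b = (\<Sum>k<n. hcomp (int k) b)" using hcomp_sum_eq by blast
  also have "\<dots> = coord w 1 ^ m * (\<Sum>k<n. h (int k)) + coord w 3 * (\<Sum>k<n. z (int k))"
    unfolding hz by (simp add: sum.distrib sum_distrib_left)
  finally show ?thesis by blast
qed

lemma span_coefficients:
  assumes "x \<in> sm.span B"
  shows "\<exists>F c. finite F \<and> F \<subseteq> B \<and> (\<forall>F'. finite F' \<longrightarrow> F \<subseteq> F' \<longrightarrow> x = (\<Sum>v\<in>F'. c v *s v))"
proof -
  obtain F c where F: "finite F" "F \<subseteq> B" "x = (\<Sum>v\<in>F. c v *s v)"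
    using assms unfolding sm.span_explicit by blast
  let ?c = "\<lambda>v. if v \<in> F then c v else 0"
  have "x = (\<Sum>v\<in>F'. ?c v *s v)" if "finite F'" "F \<subseteq> F'" for F'
    unfolding F(3) using that by (intro sum.mono_neutral_cong_left) auto
  then show ?thesis using F(1,2) by (intro exI[of _ F] exI[of _ ?c]) blast
qed

text \<open>In terms of the coefficients with respect to a basis of \<open>AR(f)\<close> this is the regularity of the two
  coordinates of the line modulo its equation.\<close>

lemma free_imp_lifting:
  assumes f: "f \<in> homog d" and free: "free_curve f" and w: "invertible w"
    and v: "v \<in> rv w ` AR f (e + int m)" "monom 1 m *s v \<in> rv w ` AR f (e + int m)"
  shows "v \<in> rv w ` AR f e"
proof -
  interpret line_module w "AR f" "\<lambda>_. 0" by (rule AR_module[OF w])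
  obtain B where ind: "\<not> sm.dependent B" and spn: "sm.span B = syz f"
    using free unfolding free_curve_def by blast
  obtain b where b: "b \<in> AR f (e + int m)" "v = rv w b" using v(1) by blast
  obtain b' where b': "b' \<in> AR f (e + int m)" "monom 1 m *s v = rv w b'" using v(2) by blast
  let ?X = "coord w"
  \<comment> \<open>This combination vanishes on the line, so it is a multiple of its equation. In terms of the
    basis of \<open>AR(f)\<close>, regularity of the coordinates then shows that each coefficient of \<open>b\<close> is
    divisible by \<open>coord w 1 ^ m\<close> modulo the equation.\<close>
  let ?r = "?X 1 ^ m *s b' + (- 1) *s (?X 2 ^ m *s b)"
  have c1: "(- 1 :: 3 mpoly) \<in> homog 0" using homog_uminus[OF homog_1] .
  have "?r \<in> AR f (e + int m + int m)"
    using M_add[OF M_scale[OF homog_power1[OF coord_homog, of w 1 m] b'(1)]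
        M_scale[OF c1 M_scale[OF homog_power1[OF coord_homog, of w 2 m] b(1)], unfolded add_0_right]] .
  moreover have "rest w (?r $ i) = 0" for i
  proof -
    have "rest w (b' $ i) = monom 1 m * rest w (b $ i)"
      using b'(2) unfolding b(2) by (simp add: rv_def vec_eq_iff)
    then show ?thesis by (simp add: rest.hom_simps w monom_altdef)
  qed
  ultimately obtain c where c: "c \<in> AR f (e + int m + int m - 1)" "?r = ?X 3 *s c" using M_div by blast
  have spans: "b \<in> sm.span B" "b' \<in> sm.span B" "c \<in> sm.span B"
    using b(1) b'(1) c(1) unfolding spn by (auto simp: AR_def)
  obtain F1 \<beta> where 1: "finite F1" "F1 \<subseteq> B" "\<forall>F. finite F \<longrightarrow> F1 \<subseteq> F \<longrightarrow> b = (\<Sum>v\<in>F. \<beta> v *s v)"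
    using span_coefficients[OF spans(1)] by (elim exE conjE)
  obtain F2 \<beta>' where 2: "finite F2" "F2 \<subseteq> B" "\<forall>F. finite F \<longrightarrow> F2 \<subseteq> F \<longrightarrow> b' = (\<Sum>v\<in>F. \<beta>' v *s v)"
    using span_coefficients[OF spans(2)] by (elim exE conjE)
  obtain F3 \<gamma> where 3: "finite F3" "F3 \<subseteq> B" "\<forall>F. finite F \<longrightarrow> F3 \<subseteq> F \<longrightarrow> c = (\<Sum>v\<in>F. \<gamma> v *s v)"
    using span_coefficients[OF spans(3)] by (elim exE conjE)
  define F where "F = F1 \<union> F2 \<union> F3"
  have fF: "finite F" "F \<subseteq> B" using 1(1,2) 2(1,2) 3(1,2) unfolding F_def by auto
  have bF: "b = (\<Sum>v\<in>F. \<beta> v *s v)" and bF': "b' = (\<Sum>v\<in>F. \<beta>' v *s v)" and cF: "c = (\<Sum>v\<in>F. \<gamma> v *s v)"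
    using 1(3)[rule_format, OF fF(1)] 2(3)[rule_format, OF fF(1)] 3(3)[rule_format, OF fF(1)]
    unfolding F_def by blast+
  have "(\<Sum>v\<in>F. (?X 1 ^ m * \<beta>' v - ?X 2 ^ m * \<beta> v - ?X 3 * \<gamma> v) *s v) =
      ?X 1 ^ m *s b' - ?X 2 ^ m *s b - ?X 3 *s c"
    unfolding bF bF' cF
    by (simp add: sm.scale_left_diff_distrib sum_subtractf sm.scale_sum_right)
  also have "\<dots> = 0" unfolding c(2)[symmetric] by (simp add: vec_eq_iff)
  finally have "?X 1 ^ m * \<beta>' v - ?X 2 ^ m * \<beta> v - ?X 3 * \<gamma> v = 0" if "v \<in> F" for v
    using sm.independentD[OF ind fF, of "\<lambda>v. ?X 1 ^ m * \<beta>' v - ?X 2 ^ m * \<beta> v - ?X 3 * \<gamma> v"] that by simp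
  then have "\<exists>h z. \<beta> v = ?X 1 ^ m * h + ?X 3 * z" if "v \<in> F" for v
    using coord_regular[OF w, of m "\<beta>' v" "\<beta> v" "\<gamma> v"] that by simp
  then obtain h z where hz: "\<And>v. v \<in> F \<Longrightarrow> \<beta> v = ?X 1 ^ m * h v + ?X 3 * z v" by metis
  define a where "a = (\<Sum>v\<in>F. h v *s v)"
  define a' where "a' = (\<Sum>v\<in>F. z v *s v)"
  have syz: "a \<in> syz f"
    unfolding a_def spn[symmetric] using fF by (intro sm.span_sum sm.span_scale sm.span_base) auto
  have ba: "b = ?X 1 ^ m *s a + ?X 3 *s a'"
    unfolding bF a_def a'_def by (simp add: hz sm.scale_left_distrib sum.distrib sm.scale_sum_right cong: sum.cong)
  \<comment> \<open>The quotient \<open>a\<close> need not be homogeneous; its component of degree \<open>e\<close> is the element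
    whose restriction is \<open>v\<close>.\<close>
  have "hcomp (int m + e) (b $ i) = ?X 1 ^ m * hcomp e (a $ i) + ?X 3 * hcomp (int m + e - 1) (a' $ i)" for i
    using hcomp_mult[OF homog_power1[OF coord_homog], of m e w 1 "a $ i"]
      hcomp_mult[OF coord_homog, of "int m + e - 1" w 3 "a' $ i"]
    by (simp add: ba hcomp_add)
  moreover have "hcomp (int m + e) (b $ i) = b $ i" for i
    using hcomp_of_homog[of "b $ i" "e + int m" "int m + e"] b(1) by (simp add: AR_def)
  ultimately have "b $ i = ?X 1 ^ m * hcomp e (a $ i) + ?X 3 * hcomp (int m + e - 1) (a' $ i)" for i
    by simp
  then have "rv w b = rv w (vcomp e a)"
    by (simp add: rv_def vcomp_def vec_eq_iff rest.hom_simps w)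
  then show ?thesis using vcomp_syz[OF f syz, of e] b(2) by blast
qed

text \<open>Homogeneous lifts of a basis of the restriction form a basis of \<open>AR(f)\<close>: they
  generate it by the graded Nakayama lemma, and they are independent since one of their minors is
  nonzero on the line.\<close>

lemma lifting_imp_free:
  assumes f: "f \<in> homog d" and w: "invertible w"
    and gen: "\<And>k. rv w ` AR f k = free_mod y D k"
    and indep: "\<And>a b. a *s y 1 + b *s y 2 = 0 \<Longrightarrow> a = 0 \<and> b = 0"
  shows "free_curve f"
proof -
  interpret line_module w "AR f" "\<lambda>_. 0" by (rule AR_module[OF w])
  have "1 *s y 1 + 0 *s y 2 \<in> free_mod y D (D 1)" by (rule free_modI) (auto simp: bform_def)
  then obtain z1 where z1: "z1 \<in> AR f (D 1)" "rv w z1 = y 1" unfolding gen[symmetric] by auto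
  have "0 *s y 1 + 1 *s y 2 \<in> free_mod y D (D 2)" by (rule free_modI) (auto simp: bform_def)
  then obtain z2 where z2: "z2 \<in> AR f (D 2)" "rv w z2 = y 2" unfolding gen[symmetric] by auto
  have r: "rest w (z1 $ i) = y 1 $ i" "rest w (z2 $ i) = y 2 $ i" for i
    using z1(2) z2(2) by (auto simp: rv_def vec_eq_iff)
  have ind: "a = 0 \<and> b = 0" if ab: "a *s z1 + b *s z2 = 0" for a b
  proof -
    have "y 1 \<noteq> 0" using indep[of 1 0] by auto
    then obtain i where i: "y 1 $ i \<noteq> 0" by (auto simp: vec_eq_iff)
    have "(- (y 2 $ i)) *s y 1 + (y 1 $ i) *s y 2 \<noteq> 0" using indep[of "- (y 2 $ i)" "y 1 $ i"] i by blast
    then obtain j where j: "y 1 $ i * y 2 $ j - y 2 $ i * y 1 $ j \<noteq> 0" by (auto simp: vec_eq_iff)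
    have "rest w (z1 $ i * z2 $ j - z2 $ i * z1 $ j) \<noteq> 0" using j by (simp add: rest.hom_simps r)
    then have mn: "z1 $ i * z2 $ j - z2 $ i * z1 $ j \<noteq> 0" by auto
    have e: "a * z1 $ k + b * z2 $ k = 0" for k using ab by (simp add: vec_eq_iff)
    have "a * (z1 $ i * z2 $ j - z2 $ i * z1 $ j) = (a * z1 $ i + b * z2 $ i) * z2 $ j - (a * z1 $ j + b * z2 $ j) * z2 $ i"
      by (simp add: algebra_simps)
    moreover have "b * (z1 $ i * z2 $ j - z2 $ i * z1 $ j) = (a * z1 $ j + b * z2 $ j) * z1 $ i - (a * z1 $ i + b * z2 $ i) * z1 $ j"
      by (simp add: algebra_simps)
    ultimately show ?thesis using mn by (simp add: e)
  qed
  have ne: "z1 \<noteq> z2" using ind[of 1 "-1"] by (auto simp: vec_eq_iff)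
  have "\<not> sm.dependent {z1, z2}"
    using ind ne by (auto simp: sm.dependent_finite)
  moreover have "{z1, z2} \<subseteq> (\<Union>k. AR f k)" using z1(1) z2(1) by blast
  moreover have "sm.span {z1, z2} = syz f"
  proof
    show "sm.span {z1, z2} \<subseteq> syz f"
      by (rule sm.span_minimal[OF _ syz_subspace]) (use z1(1) z2(1) in \<open>auto simp: AR_def\<close>)
    have base: "z1 \<in> sm.span {z1, z2}" "z2 \<in> sm.span {z1, z2}" by (auto intro: sm.span_base)
    have ARk: "r \<in> sm.span {z1, z2}" if "r \<in> AR f k" for r k
      using that
    proof (induction "nat (k + 1)" arbitrary: k r)
      case 0
      then show ?case using AR_neg[of k f] by (auto intro: sm.span_zero)
    next
      case (Suc n)
      have "rv w r \<in> free_mod y D k" using Suc.prems gen by blast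
      then obtain p q where pq: "rv w r = p *s y 1 + q *s y 2" "p \<in> bform (k - D 1)" "q \<in> bform (k - D 2)"
        unfolding free_mod_def by blast
      obtain p' where p': "p' \<in> homog (k - D 1)" "rest w p' = p" using rest_onto[OF w pq(2)] by blast
      obtain q' where q': "q' \<in> homog (k - D 2)" "rest w q' = q" using rest_onto[OF w pq(3)] by blast
      let ?s = "r + ((- p') *s z1 + (- q') *s z2)"
      have "(- p') *s z1 \<in> AR f k" using M_scale[OF homog_uminus[OF p'(1)] z1(1)] by simp
      moreover have "(- q') *s z2 \<in> AR f k" using M_scale[OF homog_uminus[OF q'(1)] z2(1)] by simp
      ultimately have "?s \<in> AR f k" by (intro M_add Suc.prems)
      moreover have "rest w (?s $ i) = 0" for i
      proof -
        have "rest w (r $ i) = p * y 1 $ i + q * y 2 $ i" using pq(1) by (simp add: rv_def vec_eq_iff)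
        then show ?thesis by (simp add: rest.hom_simps r p'(2) q'(2))
      qed
      ultimately obtain t where t: "t \<in> AR f (k - 1)" "?s = coord w 3 *s t" using M_div by blast
      have "t \<in> sm.span {z1, z2}" using Suc.hyps(1)[of "k - 1" t] Suc.hyps(2) t(1) by simp
      then have "coord w 3 *s t + (p' *s z1 + q' *s z2) \<in> sm.span {z1, z2}"
        by (intro sm.span_add sm.span_scale base)
      also have "coord w 3 *s t + (p' *s z1 + q' *s z2) = r"
        unfolding t(2)[symmetric] by (simp add: vec_eq_iff)
      finally show ?case .
    qed
    show "syz f \<subseteq> sm.span {z1, z2}"
    proof
      fix r assume "r \<in> syz f"
      obtain n where "r = (\<Sum>k<n. vcomp (int k) r)" using vcomp_sum by blast
      also have "\<dots> \<in> sm.span {z1, z2}" using ARk[OF vcomp_syz[OF f \<open>r \<in> syz f\<close>]] by (intro sm.span_sum)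
      finally show "r \<in> sm.span {z1, z2}" .
    qed
  qed
  ultimately show ?thesis unfolding free_curve_def by blast
qed

lemma degree_pos:
  assumes f: "f \<in> homog (int d)" and mdr: "mdr f \<ge> 1"
  shows "d \<ge> 1"
proof (rule ccontr)
  assume "\<not> d \<ge> 1"
  then have "d = 0" by simp
  then have "f \<in> homog 0" using f by simp
  then obtain c where c: "f = const c" using homog_deg0 by blast
  \<comment> \<open>All partial derivatives of a constant vanish, so there are syzygies of degree zero.\<close>
  have "(\<chi> i. 1) \<in> AR f (int 0)" by (simp add: AR_def syz_def c homog_1)
  moreover have "(\<chi> i. 1) \<noteq> (0 :: 3 mpoly ^ 3)" by (simp add: vec_eq_iff)
  ultimately have "AR f (int 0) \<noteq> {0}" by blast
  then have "mdr f = 0" unfolding mdr_def by (rule Least_eq_0)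
  then show False using mdr by simp
qed

text \<open>Equality means that the restrictions of syzygies exhaust the sections of the restricted bundle. By
  \<open>splitting_basis\<close> these become restrictions in large degrees, which is what the lifting property
  of free modules needs.\<close>

theorem tjurina_line_bound:
  assumes f: "f \<in> homog (int d)" and sqf: "squarefree f" and d: "d \<ge> 1"
    and L: "L \<in> lines" and s: "splits_on f L d1 d2"
  shows "int (tjurina f) \<le> (int d - 1)\<^sup>2 - d1 * d2"
    and "int (tjurina f) = (int d - 1)\<^sup>2 - d1 * d2 \<longleftrightarrow> free_curve f"
proof -
  obtain l where "l \<in> homog 1" "l \<noteq> 0" "L = curve l" using L by (auto simp: lines_def)
  then obtain w where w: "invertible w" "L = curve (coord w 3)" using frame_of_line by metis
  let ?D = "\<lambda>i. (vector [d1, d2] :: int ^ 2) $ i"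
  obtain y :: "2 \<Rightarrow> complex poly ^ 3" where
    "\<forall>i. \<exists>m0. \<forall>m\<ge>m0. \<forall>a. degree a \<le> m \<longrightarrow> a *s y i \<in> rv w ` AR f (?D i + int m)"
    "\<forall>k. \<forall>v\<in>rv w ` AR f k. \<exists>p. (\<forall>i. p i \<in> bform (k - ?D i)) \<and> v = p 1 *s y 1 + p 2 *s y 2"
    "\<forall>a b. a *s y 1 + b *s y 2 = 0 \<longrightarrow> a = 0 \<and> b = 0"
    using splitting_basis[OF w(1) s[unfolded w(2)]] by (elim exE conjE)
  note large = this(1)[rule_format] and gen = this(2)[rule_format] and indep = this(3)[rule_format]
  have sub: "rv w ` AR f k \<subseteq> free_mod y ?D k" for k
  proof
    fix v assume "v \<in> rv w ` AR f k"
    from gen[OF this] obtain p where p: "\<forall>i. p i \<in> bform (k - ?D i)" "v = p 1 *s y 1 + p 2 *s y 2"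
      by (elim exE conjE)
    show "v \<in> free_mod y ?D k"
      unfolding p(2) by (rule free_modI[of "p 1" k ?D "p 2" y]; rule p(1)[rule_format])
  qed
  note formula = tjurina_splitting_formula[OF f d sqf w(1) large sub indep]
  show "int (tjurina f) \<le> (int d - 1)\<^sup>2 - d1 * d2" using formula(1) by simp
  have "(\<forall>k. rv w ` AR f k = free_mod y ?D k) \<longleftrightarrow> free_curve f"
  proof
    assume "\<forall>k. rv w ` AR f k = free_mod y ?D k"
    then show "free_curve f" using lifting_imp_free[OF f w(1) _ indep] by blast
  next
    assume free: "free_curve f"
    have yi: "y i \<in> rv w ` AR f (?D i)" for i
    proof -
      \<comment> \<open>The multipliers \<open>1\<close> and \<open>t ^ m0\<close> are the restrictions of the \<open>m0\<close>-th powers of the two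
        coordinates of the line.\<close>
      from large[of i] obtain m0
        where "\<forall>m\<ge>m0. \<forall>a. degree a \<le> m \<longrightarrow> a *s y i \<in> rv w ` AR f (?D i + int m)" by (elim exE)
      note m = this[rule_format, of m0]
      show ?thesis
        by (rule free_imp_lifting[OF f free w(1), of _ _ m0])
           (use m[of 1] m[of "monom 1 m0"] in \<open>simp_all add: degree_monom_eq\<close>)
    qed
    interpret line_module w "AR f" "\<lambda>_. 0" by (rule AR_module[OF w(1)])
    have "free_mod y ?D k \<subseteq> rv w ` AR f k" for k
    proof
      fix v assume "v \<in> free_mod y ?D k"
      then obtain p q where v: "v = p *s y 1 + q *s y 2" "p \<in> bform (k - ?D 1)" "q \<in> bform (k - ?D 2)"
        unfolding free_mod_def by blast
      show "v \<in> rv w ` AR f k"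
        using rv_add[OF rv_scale[OF yi[of 1] v(2)], of "q *s y 2"] rv_scale[OF yi[of 2] v(3)]
        by (simp add: v(1))
    qed
    then show "\<forall>k. rv w ` AR f k = free_mod y ?D k" using sub by blast
  qed
  then show "int (tjurina f) = (int d - 1)\<^sup>2 - d1 * d2 \<longleftrightarrow> free_curve f" using formula(2) by simp
qed

theorem corollary1p3:
  fixes f :: "3 mpoly" and d :: nat
  assumes "f \<in> homog (int d)"
    and "squarefree f"
    and "mdr f \<ge> 1"
  shows "(\<forall>L \<in> lines. \<forall>d1 d2. splits_on f L d1 d2 \<longrightarrow>
            int (tjurina f) \<le> (int d - 1)\<^sup>2 - d1 * d2) \<and>
         (\<forall>L \<in> lines. \<forall>d1 d2. splits_on f L d1 d2 \<longrightarrow>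
            (int (tjurina f) = (int d - 1)\<^sup>2 - d1 * d2 \<longleftrightarrow> free_curve f)) \<and>
         (free_curve f \<longrightarrow> (\<forall>L \<in> lines. \<forall>d1 d2. splits_on f L d1 d2 \<longrightarrow>
            int (tjurina f) = (int d - 1)\<^sup>2 - d1 * d2))"
  using tjurina_line_bound[OF assms(1,2) degree_pos[OF assms(1,3)]] by blast

end
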